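(* There exists a set of parameters $(n,D,b(\cdot),f(\cdot),\lambda(\cdot))$ such that, for any $T>0$, $M\ge 0$, $$\inf_{K\ge 0} C_1(K,M,{\cal P}(\mu))= \frac{1}{2}$$ for $\mu=(T,n,D,b(\cdot),f(\cdot),\lambda(\cdot))$.
   Context: Let $D\subseteq\mathbb{R}^n$ be open, either $D=\mathbb{R}^n$ or bounded with $C^2$ boundary; $T>0$, $Q=D\times(0,T)$. Let $H^0=L_2(D)$, $H^1$ the closure in $W_2^1(D)$ of smooth functions vanishing on $\partial D$, $H^{-1}$ its dual, $X^k=L^2([0,T];H^k)$, and $Y^1=X^1\cap C([0,T];H^0)$. Consider the problem $\partial u/\partial t={\cal A}u+\varphi$ on $Q$, $u(x,0)=0$, $u|_{\partial D}=0$, where ${\cal A}y=\sum_{i}\partial_{x_i}\sum_j (b_{ij}(x,t)\partial_{x_j}y)+\sum_i f_i(x,t)\partial_{x_i}y+\lambda(x,t)y$, with $b=b^\top$, $f$, $\lambda$ measurable, $\xi^\top b(x,t)\xi\ge\delta|\xi|^2$ for some $\delta>0$, and $\mathrm{ess\,sup}_Q[|b|+|b^{-1}|+|f|+|\lambda|]<\infty$. Let ${\cal P}(\mu)=(T,n,D,\delta,\mathrm{ess\,sup}_Q[|b|+|f|+|\lambda|])$. For $\varphi\in X^{-1}$ write $\varphi=\nabla\cdot F+F_0$ with $F=(F_1,\dots,F_n)$, $F_k\in L_2(Q)$; the problem has a unique solution $u\in Y^1$. For $K\in\mathbb{R}$, $M\ge0$, let $C_1(K,M,{\cal P})$ (together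 with $C_0$) be the infimum of constants $\tilde C_1$ (resp. $\tilde C_0$) such that for all $\varphi\in X^{-1}$ and $t\in(0,T]$: $e^{-2Kt}\|u(\cdot,t)\|^2_{H^0}+M\int_0^t e^{-2Ks}\|u(\cdot,s)\|^2_{H^0}ds\le\tilde C_1\int_0^t e^{-2Ks}(F(\cdot,s),b(\cdot,s)^{-1}F(\cdot,s))_{H^0}ds+\tilde C_0\int_0^te^{-2Ks}\|F_0(\cdot,s)\|^2_{H^0}ds$. *)

theory Defs
  imports "HOL-Analysis.Analysis"
begin

text \<open>Points of R^n are represented as extensional functions nat => real supported on {..<n}.\<close>

definition Rn :: "nat \<Rightarrow> (nat \<Rightarrow> real) set" where
  "Rn n = PiE {..<n} (\<lambda>_. UNIV)"

definition lebn :: "nat \<Rightarrow> (nat \<Rightarrow> real) measure" where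
  "lebn n = PiM {..<n} (\<lambda>_. lborel)"

definition distn :: "nat \<Rightarrow> (nat \<Rightarrow> real) \<Rightarrow> (nat \<Rightarrow> real) \<Rightarrow> real" where
  "distn n x y = sqrt (\<Sum>i<n. (x i - y i)^2)"

definition open_Rn :: "nat \<Rightarrow> (nat \<Rightarrow> real) set \<Rightarrow> bool" where
  "open_Rn n D \<longleftrightarrow> D \<subseteq> Rn n \<and> (\<forall>x\<in>D. \<exists>e>0. \<forall>y\<in>Rn n. distn n x y < e \<longrightarrow> y \<in> D)"

definition bounded_Rn :: "nat \<Rightarrow> (nat \<Rightarrow> real) set \<Rightarrow> bool" where
  "bounded_Rn n S \<longleftrightarrow> (\<exists>R. \<forall>x\<in>S. \<forall>i<n. \<bar>x i\<bar> \<le> R)"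

definition closure_Rn :: "nat \<Rightarrow> (nat \<Rightarrow> real) set \<Rightarrow> (nat \<Rightarrow> real) set" where
  "closure_Rn n S = {x\<in>Rn n. \<forall>e>0. \<exists>y\<in>S. distn n x y < e}"

definition cont_Rn :: "nat \<Rightarrow> ((nat \<Rightarrow> real) \<Rightarrow> real) \<Rightarrow> bool" where
  "cont_Rn n g \<longleftrightarrow> (\<forall>x\<in>Rn n. \<forall>e>0. \<exists>d>0. \<forall>y\<in>Rn n. distn n x y < d \<longrightarrow> \<bar>g y - g x\<bar> < e)"

definition pdiff :: "nat \<Rightarrow> ((nat \<Rightarrow> real) \<Rightarrow> real) \<Rightarrow> (nat \<Rightarrow> real) \<Rightarrow> real" where
  "pdiff i g x = deriv (\<lambda>s. g (x(i := s))) (x i)"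

fun pdiffs :: "nat list \<Rightarrow> ((nat \<Rightarrow> real) \<Rightarrow> real) \<Rightarrow> (nat \<Rightarrow> real) \<Rightarrow> real" where
  "pdiffs [] g = g"
| "pdiffs (i # is) g = pdiff i (pdiffs is g)"

definition Ck_Rn :: "nat \<Rightarrow> nat \<Rightarrow> ((nat \<Rightarrow> real) \<Rightarrow> real) \<Rightarrow> bool" where
  "Ck_Rn n k g \<longleftrightarrow>
     (\<forall>is. set is \<subseteq> {..<n} \<and> length is \<le> k \<longrightarrow> cont_Rn n (pdiffs is g)) \<and>
     (\<forall>is. set is \<subseteq> {..<n} \<and> length is < k \<longrightarrow>
        (\<forall>i<n. \<forall>x\<in>Rn n. (\<lambda>s. pdiffs is g (x(i := s))) differentiable (at (x i))))"

definition test_fun :: "nat \<Rightarrow> (nat \<Rightarrow> real) set \<Rightarrow> ((nat \<Rightarrow> real) \<Rightarrow> real) \<Rightarrow> bool" where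
  "test_fun n D g \<longleftrightarrow> (\<forall>k. Ck_Rn n k g) \<and>
     bounded_Rn n (closure_Rn n {x\<in>Rn n. g x \<noteq> 0}) \<and>
     closure_Rn n {x\<in>Rn n. g x \<noteq> 0} \<subseteq> D"

text \<open>C^2 boundary: near every boundary point, after a rotation/reflection of coordinates
  (orthogonal Q), D is the supergraph of a C^2 function of n-1 variables.\<close>
definition C2_boundary :: "nat \<Rightarrow> (nat \<Rightarrow> real) set \<Rightarrow> bool" where
  "C2_boundary n D \<longleftrightarrow>
     (\<forall>p \<in> closure_Rn n D - D. \<exists>r>0. \<exists>Q :: nat \<Rightarrow> nat \<Rightarrow> real. \<exists>\<gamma>.
        (\<forall>i<n. \<forall>j<n. (\<Sum>k<n. Q k i * Q k j) = (if i = j then 1 else 0)) \<and>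
        Ck_Rn (n - 1) 2 \<gamma> \<and>
        (\<forall>x\<in>Rn n. distn n x p < r \<longrightarrow>
           (x \<in> D \<longleftrightarrow>
             (let y = (\<lambda>i. \<Sum>j<n. Q i j * x j) in \<gamma> (restrict y {..<n - 1}) < y (n - 1)))))"

definition dom_ok :: "nat \<Rightarrow> (nat \<Rightarrow> real) set \<Rightarrow> bool" where
  "dom_ok n D \<longleftrightarrow> 1 \<le> n \<and> (D = Rn n \<or> (open_Rn n D \<and> bounded_Rn n D \<and> C2_boundary n D))"

definition L2D :: "nat \<Rightarrow> (nat \<Rightarrow> real) set \<Rightarrow> ((nat \<Rightarrow> real) \<Rightarrow> real) \<Rightarrow> bool" where
  "L2D n D g \<longleftrightarrow> g \<in> borel_measurable (lebn n) \<and> set_integrable (lebn n) D (\<lambda>x. (g x)^2)"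

definition sqn :: "nat \<Rightarrow> (nat \<Rightarrow> real) set \<Rightarrow> ((nat \<Rightarrow> real) \<Rightarrow> real) \<Rightarrow> real" where
  "sqn n D g = (LINT x:D|lebn n. (g x)^2)"

definition ipD :: "nat \<Rightarrow> (nat \<Rightarrow> real) set \<Rightarrow> ((nat \<Rightarrow> real) \<Rightarrow> real) \<Rightarrow> ((nat \<Rightarrow> real) \<Rightarrow> real) \<Rightarrow> real" where
  "ipD n D g h = (LINT x:D|lebn n. g x * h x)"

text \<open>v belongs to H^1 (closure of C_c^infinity(D) in W_2^1(D)) with weak gradient w.\<close>
definition H10 :: "nat \<Rightarrow> (nat \<Rightarrow> real) set \<Rightarrow> ((nat \<Rightarrow> real) \<Rightarrow> real) \<Rightarrow> (nat \<Rightarrow> (nat \<Rightarrow> real) \<Rightarrow> real) \<Rightarrow> bool" where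
  "H10 n D v w \<longleftrightarrow> L2D n D v \<and> (\<forall>i<n. L2D n D (w i)) \<and>
     (\<exists>\<psi> :: nat \<Rightarrow> (nat \<Rightarrow> real) \<Rightarrow> real. (\<forall>k. test_fun n D (\<psi> k)) \<and>
        (\<lambda>k. sqn n D (\<lambda>x. \<psi> k x - v x)) \<longlonglongrightarrow> 0 \<and>
        (\<forall>i<n. (\<lambda>k. sqn n D (\<lambda>x. pdiff i (\<psi> k) x - w i x)) \<longlonglongrightarrow> 0))"

definition L2Q :: "nat \<Rightarrow> (nat \<Rightarrow> real) set \<Rightarrow> real \<Rightarrow> ((nat \<Rightarrow> real) \<Rightarrow> real \<Rightarrow> real) \<Rightarrow> bool" where
  "L2Q n D T g \<longleftrightarrow> (\<lambda>z. g (fst z) (snd z)) \<in> borel_measurable (lebn n \<Otimes>\<^sub>M lborel) \<and>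
     set_integrable (lebn n \<Otimes>\<^sub>M lborel) (D \<times> {0<..<T}) (\<lambda>z. (g (fst z) (snd z))^2)"

definition minv :: "nat \<Rightarrow> (nat \<Rightarrow> nat \<Rightarrow> real) \<Rightarrow> nat \<Rightarrow> nat \<Rightarrow> real" where
  "minv n A = (SOME B. \<forall>i<n. \<forall>j<n. (\<Sum>k<n. B i k * A k j) = (if i = j then 1 else 0))"

definition coeff_ok :: "nat \<Rightarrow> (nat \<Rightarrow> real) set \<Rightarrow> real \<Rightarrow>
    ((nat \<Rightarrow> real) \<Rightarrow> real \<Rightarrow> nat \<Rightarrow> nat \<Rightarrow> real) \<Rightarrow> ((nat \<Rightarrow> real) \<Rightarrow> real \<Rightarrow> nat \<Rightarrow> real) \<Rightarrow>
    ((nat \<Rightarrow> real) \<Rightarrow> real \<Rightarrow> real) \<Rightarrow> bool" where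
  "coeff_ok n D T b f lam \<longleftrightarrow>
     (let Q = D \<times> {0<..<T}; M = lebn n \<Otimes>\<^sub>M lborel in
      (\<forall>i<n. \<forall>j<n. (\<lambda>z. indicator Q z * b (fst z) (snd z) i j) \<in> borel_measurable M) \<and>
      (\<forall>i<n. (\<lambda>z. indicator Q z * f (fst z) (snd z) i) \<in> borel_measurable M) \<and>
      (\<lambda>z. indicator Q z * lam (fst z) (snd z)) \<in> borel_measurable M \<and>
      (AE z in M. z \<in> Q \<longrightarrow> (\<forall>i<n. \<forall>j<n. b (fst z) (snd z) i j = b (fst z) (snd z) j i)) \<and>
      (\<exists>\<delta>>0. AE z in M. z \<in> Q \<longrightarrow>
         (\<forall>\<xi> :: nat \<Rightarrow> real. (\<Sum>i<n. \<Sum>j<n. \<xi> i * b (fst z) (snd z) i j * \<xi> j) \<ge> \<delta> * (\<Sum>i<n. (\<xi> i)^2))) \<and>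
      (\<exists>C. AE z in M. z \<in> Q \<longrightarrow>
         (\<forall>i<n. \<forall>j<n. \<bar>b (fst z) (snd z) i j\<bar> \<le> C \<and> \<bar>minv n (b (fst z) (snd z)) i j\<bar> \<le> C) \<and>
         (\<forall>i<n. \<bar>f (fst z) (snd z) i\<bar> \<le> C) \<and> \<bar>lam (fst z) (snd z)\<bar> \<le> C))"

text \<open>u in Y^1 is the (weak) solution of u_t = A u + div F + F0, u(.,0) = 0, u = 0 on the boundary.
  G is the spatial weak gradient of u.\<close>
definition weak_sol :: "nat \<Rightarrow> (nat \<Rightarrow> real) set \<Rightarrow> real \<Rightarrow>
    ((nat \<Rightarrow> real) \<Rightarrow> real \<Rightarrow> nat \<Rightarrow> nat \<Rightarrow> real) \<Rightarrow> ((nat \<Rightarrow> real) \<Rightarrow> real \<Rightarrow> nat \<Rightarrow> real) \<Rightarrow>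
    ((nat \<Rightarrow> real) \<Rightarrow> real \<Rightarrow> real) \<Rightarrow> (nat \<Rightarrow> (nat \<Rightarrow> real) \<Rightarrow> real \<Rightarrow> real) \<Rightarrow>
    ((nat \<Rightarrow> real) \<Rightarrow> real \<Rightarrow> real) \<Rightarrow> ((nat \<Rightarrow> real) \<Rightarrow> real \<Rightarrow> real) \<Rightarrow> bool" where
  "weak_sol n D T b f lam F F0 u \<longleftrightarrow>
     (\<exists>G :: nat \<Rightarrow> (nat \<Rightarrow> real) \<Rightarrow> real \<Rightarrow> real.
        L2Q n D T u \<and> (\<forall>i<n. L2Q n D T (G i)) \<and>
        (AE t in lborel. t \<in> {0<..<T} \<longrightarrow> H10 n D (\<lambda>x. u x t) (\<lambda>i x. G i x t)) \<and>
        (\<forall>t\<in>{0..T}. L2D n D (\<lambda>x. u x t) \<and>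
           ((\<lambda>s. sqn n D (\<lambda>x. u x s - u x t)) \<longlongrightarrow> 0) (at t within {0..T})) \<and>
        sqn n D (\<lambda>x. u x 0) = 0 \<and>
        (\<forall>\<psi>. test_fun n D \<psi> \<longrightarrow> (\<forall>t\<in>{0..T}.
           ipD n D (\<lambda>x. u x t) \<psi> =
             (LINT s:{0..t}|lborel. (LINT x:D|lebn n. (
                - (\<Sum>i<n. \<Sum>j<n. b x s i j * G j x s * pdiff i \<psi> x)
                + ((\<Sum>i<n. f x s i * G i x s) + lam x s * u x s) * \<psi> x
                - (\<Sum>i<n. F i x s * pdiff i \<psi> x)
                + F0 x s * \<psi> x))))))"

definition C1 :: "nat \<Rightarrow> (nat \<Rightarrow> real) set \<Rightarrow> real \<Rightarrow>
    ((nat \<Rightarrow> real) \<Rightarrow> real \<Rightarrow> nat \<Rightarrow> nat \<Rightarrow> real) \<Rightarrow> ((nat \<Rightarrow> real) \<Rightarrow> real \<Rightarrow> nat \<Rightarrow> real) \<Rightarrow>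
    ((nat \<Rightarrow> real) \<Rightarrow> real \<Rightarrow> real) \<Rightarrow> real \<Rightarrow> real \<Rightarrow> ereal" where
  "C1 n D T b f lam K M = Inf {ereal c1 | c1. \<exists>c0.
     \<forall>F F0 u. (\<forall>i<n. L2Q n D T (F i)) \<and> L2Q n D T F0 \<and> weak_sol n D T b f lam F F0 u \<longrightarrow>
       (\<forall>t\<in>{0<..T}.
          exp (-2 * K * t) * sqn n D (\<lambda>x. u x t)
          + M * (LINT s:{0..t}|lborel. (exp (-2 * K * s) * sqn n D (\<lambda>x. u x s)))
          \<le> c1 * (LINT s:{0..t}|lborel. (exp (-2 * K * s) *
                   (LINT x:D|lebn n. (\<Sum>i<n. \<Sum>j<n. F i x s * minv n (b x s) i j * F j x s))))
            + c0 * (LINT s:{0..t}|lborel. (exp (-2 * K * s) * sqn n D (\<lambda>x. F0 x s))))}"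

end

theory Submission
  imports Defs "HOL-Real_Asymp.Real_Asymp"
begin

text \<open>
  The example is the heat equation on the real line: \<open>n = 1\<close>, \<open>b = 1\<close>, \<open>f = 0\<close>, \<open>\<lambda> = 0\<close>.

  Upper bound: testing the equation with the solution gives
  \<open>d/dt |u|\<^sup>2 = - 2 |u\<^sub>x|\<^sup>2 - 2 (F, u\<^sub>x) + 2 (F\<^sub>0, u) \<le> |F|\<^sup>2 / 2 + |F\<^sub>0|\<^sup>2 + |u|\<^sup>2\<close>, and
  \<open>2 K = M + 1\<close> absorbs the last term together with the \<open>M\<close>-term. For weak solutions the
  computation is carried out on Steklov averages \<open>\<integral>\<^bsub>[t, t+h]\<^esub> u\<close>: averaging only decreases the norms
  of \<open>F\<close>, \<open>F\<^sub>0\<close> and \<open>u\<close> on the right, so no convergence of averages of \<open>u\<^sub>x\<close> is needed.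

  Lower bound: completing the square is sharp for \<open>F = - 2 u\<^sub>x\<close>, which turns the equation into the
  backward heat equation. For \<open>u = (exp (k\<^sup>2 t) - 1) g(x)\<close> with \<open>g\<close> close to an eigenfunction of
  frequency \<open>k\<close> the two sides of the estimate have ratio tending to \<open>1/2\<close> as \<open>k \<rightarrow> \<infinity>\<close>, for every
  fixed \<open>K\<close>. The \<open>g\<close> are wide bumps times \<open>sin (k x)\<close> or \<open>cos (k x)\<close>; adding the inequalities for
  both removes all oscillatory integrals.
\<close>
subsection \<open>Square-integrable functions\<close>

text \<open>For the upper bound, the obstacle is that test functions do not depend on time and
  \<open>u\<close> has no time derivative; it is merely continuous in time with values in L2. By
  density the weak identity may be tested with \<open>u\<close> frozen at almost every time
  \<open>\<sigma>\<close>. Integrating over \<open>\<sigma>\<close> leaves scalar calculus: the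
  kernel \<open>\<phi> a b = (u(a), u(b))\<close> is continuous and symmetric, and the squared norm
  of an average is its integral over a square of side h, which is differentiable although
  \<open>\<phi>\<close> need not be.

  For the lower bound, \<open>c0\<close> is arbitrary, so \<open>F0\<close> must be of lower order.
  The zero initial value forces the -1 in \<open>exp (\<kappa> s) - 1\<close>, where
  \<open>\<kappa>\<close> is k^2. It leaves a residual \<open>\<kappa> g\<close> that does not grow
  in time; the other residual \<open>g'' + \<kappa> g\<close> vanishes as the bump gets wide. So the
  width grows first, at fixed \<open>\<kappa>\<close>. After division by
  \<open>exp (2 (\<kappa> - K) T)\<close> the left side tends to 1 and the \<open>c1\<close> term is
  at most about \<open>4 c1 \<kappa> / (2 (\<kappa> - K))\<close>, which tends to
  \<open>2 c1\<close>; hence 1/2. This holds for every nonnegative K, so one good K settles the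
  infimum.\<close>

definition sq_int :: "'a measure \<Rightarrow> ('a \<Rightarrow> real) \<Rightarrow> bool" where
  "sq_int M f \<longleftrightarrow> f \<in> borel_measurable M \<and> integrable M (\<lambda>x. (f x)\<^sup>2)"

lemma sq_int_measurable: "sq_int M f \<Longrightarrow> f \<in> borel_measurable M"
  by (simp add: sq_int_def)

lemma sq_int_integrable_square: "sq_int M f \<Longrightarrow> integrable M (\<lambda>x. (f x)\<^sup>2)"
  by (simp add: sq_int_def)

lemma sq_int_integrable_mult:
  assumes "sq_int M f" "sq_int M g"
  shows "integrable M (\<lambda>x. f x * g x)"
proof (rule Bochner_Integration.integrable_bound)
  show "integrable M (\<lambda>x. (f x)\<^sup>2 + (g x)\<^sup>2)"
    using assms by (simp add: sq_int_def)
  show "(\<lambda>x. f x * g x) \<in> borel_measurable M"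
    using assms by (auto simp: sq_int_def)
  have "\<bar>a * b\<bar> \<le> a\<^sup>2 + b\<^sup>2" for a b :: real
  proof -
    have "2 * \<bar>a * b\<bar> \<le> a\<^sup>2 + b\<^sup>2"
      using sum_squares_bound[of "\<bar>a\<bar>" "\<bar>b\<bar>"] by (simp add: abs_mult mult.assoc)
    then show ?thesis using abs_ge_zero[of "a * b"] by linarith
  qed
  then show "AE x in M. norm (f x * g x) \<le> norm ((f x)\<^sup>2 + (g x)\<^sup>2)"
    by (simp add: abs_of_nonneg)
qed

lemma sq_int_cmult: "sq_int M f \<Longrightarrow> sq_int M (\<lambda>x. c * f x)"
  by (auto simp: sq_int_def power_mult_distrib)

lemma sq_int_add:
  assumes "sq_int M f" "sq_int M g" shows "sq_int M (\<lambda>x. f x + g x)"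
  using assms sq_int_integrable_mult[OF assms]
  by (auto simp: sq_int_def power2_sum mult.assoc)

lemma sq_int_diff:
  assumes "sq_int M f" "sq_int M g" shows "sq_int M (\<lambda>x. f x - g x)"
  using sq_int_add[OF assms(1) sq_int_cmult[OF assms(2), of "-1"]] by simp

text \<open>The nonnegative integral of \<open>(c f - b g)^2\<close> equals
  \<open>c (a c - b^2)\<close>, which gives the claim unless \<open>c = 0\<close>. In that case
  \<open>g\<close> vanishes almost everywhere and so does the product.\<close>

lemma integral_Cauchy_Schwarz:
  assumes f: "sq_int M f" and g: "sq_int M g"
  shows "(\<integral>x. f x * g x \<partial>M)\<^sup>2 \<le> (\<integral>x. (f x)\<^sup>2 \<partial>M) * (\<integral>x. (g x)\<^sup>2 \<partial>M)"
proof -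
  define a b c where "a = (\<integral>x. (f x)\<^sup>2 \<partial>M)" and "b = (\<integral>x. f x * g x \<partial>M)" and "c = (\<integral>x. (g x)\<^sup>2 \<partial>M)"
  note i = sq_int_integrable_mult[OF f g] sq_int_integrable_square[OF f] sq_int_integrable_square[OF g]
  have c0: "0 \<le> c" by (simp add: c_def)
  have "0 \<le> (\<integral>x. (c * f x - b * g x)\<^sup>2 \<partial>M)" by simp
  also have "\<dots> = (\<integral>x. c\<^sup>2 * (f x)\<^sup>2 - 2 * c * b * (f x * g x) + b\<^sup>2 * (g x)\<^sup>2 \<partial>M)"
    by (rule arg_cong[where f="integral\<^sup>L M"]) (auto simp: power2_eq_square algebra_simps)
  also have "\<dots> = c\<^sup>2 * a - 2 * c * b * b + b\<^sup>2 * c"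
    using i by (simp add: a_def b_def c_def)
  also have "\<dots> = c * (a * c - b\<^sup>2)" by (simp add: power2_eq_square algebra_simps)
  finally have *: "0 \<le> c * (a * c - b\<^sup>2)" .
  have "b\<^sup>2 \<le> a * c"
  proof (cases "c = 0")
    case True
    then have "AE x in M. (g x)\<^sup>2 = 0"
      using integral_nonneg_eq_0_iff_AE[OF i(3)] by (simp add: c_def)
    then have "b = (\<integral>x. 0 \<partial>M)"
      unfolding b_def using f g by (intro integral_cong_AE) (auto simp: sq_int_def)
    with True show ?thesis by simp
  next
    case False
    with c0 have "0 < c" by simp
    with * show ?thesis by (simp add: zero_le_mult_iff)
  qed
  then show ?thesis by (simp add: a_def b_def c_def)
qed

lemma abs_integral_Cauchy_Schwarz:
  assumes f: "sq_int M f" and g: "sq_int M g"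
  shows "\<bar>\<integral>x. f x * g x \<partial>M\<bar> \<le> sqrt (\<integral>x. (f x)\<^sup>2 \<partial>M) * sqrt (\<integral>x. (g x)\<^sup>2 \<partial>M)"
  using real_sqrt_le_mono[OF integral_Cauchy_Schwarz[OF assms]] by (simp add: real_sqrt_mult)

lemma sq_int_indicator_Icc: "sq_int lborel (indicator {s..t :: real} :: real \<Rightarrow> real)"
  by (auto simp: sq_int_def power2_eq_square indicator_inter_arith[symmetric] emeasure_lborel_Icc_eq
    intro!: integrable_real_indicator)

text \<open>Cauchy-Schwarz against the indicator of the interval, whose squared norm is the length
  \<open>t - s\<close>.\<close>

lemma set_integral_square_le:
  fixes f :: "real \<Rightarrow> real"
  assumes f: "sq_int lborel f" and "s \<le> t"
  shows "(LINT r:{s..t}|lborel. f r)\<^sup>2 \<le> (t - s) * (LINT r:{s..t}|lborel. (f r)\<^sup>2)"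
proof -
  have m[measurable]: "f \<in> borel_measurable lborel" using f by (rule sq_int_measurable)
  note 1 = sq_int_indicator_Icc[of s t]
  have i: "integrable lborel (\<lambda>r. indicator {s..t} r * (f r)\<^sup>2)"
    using integrable_mult_indicator[of "{s..t}" lborel "\<lambda>r. (f r)\<^sup>2"] f by (simp add: sq_int_def)
  have 2: "sq_int lborel (\<lambda>r. indicator {s..t} r * f r)"
    using i unfolding sq_int_def power_mult_distrib
    by (auto simp: power2_eq_square indicator_inter_arith[symmetric])
  have ind: "(indicator {s..t} r :: real)\<^sup>2 = indicator {s..t} r" for r
    by (simp split: split_indicator)
  have "(\<integral>r. indicator {s..t} r * (indicator {s..t} r * f r) \<partial>lborel)\<^sup>2 \<le>
     (\<integral>r. (indicator {s..t} r)\<^sup>2 \<partial>lborel) * (\<integral>r. (indicator {s..t} r * f r)\<^sup>2 \<partial>lborel)"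
    by (rule integral_Cauchy_Schwarz[OF 1 2])
  then show ?thesis using \<open>s \<le> t\<close>
    by (simp add: set_lebesgue_integral_def power_mult_distrib mult.assoc[symmetric]
      indicator_inter_arith[symmetric] ind)
qed

section \<open>Fubini for sections and time integrals of space-time functions\<close>

context pair_sigma_finite begin

lemma sq_int_section_fst:
  assumes "sq_int (M1 \<Otimes>\<^sub>M M2) (case_prod A)"
  shows "AE x in M1. sq_int M2 (A x)"
proof -
  have m[measurable]: "case_prod A \<in> borel_measurable (M1 \<Otimes>\<^sub>M M2)" using assms by (rule sq_int_measurable)
  have "integrable (M1 \<Otimes>\<^sub>M M2) (\<lambda>(x, y). (A x y)\<^sup>2)"
    using assms by (simp add: sq_int_def case_prod_beta')
  from AE_integrable_fst[OF this] AE_space show ?thesis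
    by eventually_elim (auto simp: sq_int_def)
qed

lemma sq_int_section_snd:
  assumes "sq_int (M1 \<Otimes>\<^sub>M M2) (case_prod A)"
  shows "AE y in M2. sq_int M1 (\<lambda>x. A x y)"
proof -
  have m[measurable]: "case_prod A \<in> borel_measurable (M1 \<Otimes>\<^sub>M M2)" using assms by (rule sq_int_measurable)
  have "integrable (M1 \<Otimes>\<^sub>M M2) (\<lambda>(x, y). (A x y)\<^sup>2)"
    using assms by (simp add: sq_int_def case_prod_beta')
  from AE_integrable_snd[OF this] AE_space show ?thesis
    by eventually_elim (auto simp: sq_int_def)
qed

lemma integrable_square_section:
  assumes "sq_int (M1 \<Otimes>\<^sub>M M2) (case_prod A)"
  shows "integrable M2 (\<lambda>y. \<integral>x. (A x y)\<^sup>2 \<partial>M1)"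
proof -
  have "integrable (M1 \<Otimes>\<^sub>M M2) (\<lambda>(x, y). (A x y)\<^sup>2)"
    using assms by (simp add: sq_int_def case_prod_beta')
  from integrable_snd[OF this] show ?thesis .
qed

end

lemma sq_int_pair_tensor:
  assumes "pair_sigma_finite M1 M2" and a: "sq_int M1 a" and b: "sq_int M2 b"
  shows "sq_int (M1 \<Otimes>\<^sub>M M2) (\<lambda>(x, y). a x * b y)"
proof -
  interpret pair_sigma_finite M1 M2 by fact
  have [measurable]: "a \<in> borel_measurable M1" "b \<in> borel_measurable M2"
    using a b by (auto simp: sq_int_def)
  have "integrable (M1 \<Otimes>\<^sub>M M2) (\<lambda>(x, y). (a x)\<^sup>2 * (b y)\<^sup>2)"
  proof (rule Fubini_integrable)
    show "integrable M1 (\<lambda>x. \<integral>y. norm (case (x, y) of (x, y) \<Rightarrow> (a x)\<^sup>2 * (b y)\<^sup>2) \<partial>M2)"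
      using a by (simp add: abs_mult sq_int_def)
    show "AE x in M1. integrable M2 (\<lambda>y. case (x, y) of (x, y) \<Rightarrow> (a x)\<^sup>2 * (b y)\<^sup>2)"
      using b by (simp add: sq_int_def)
  qed simp
  then show ?thesis
    by (simp add: sq_int_def case_prod_beta' power_mult_distrib)
qed

text \<open>Cauchy-Schwarz in time for almost every point of space, followed by exchanging the
  integrals. The second claim is the precise form of the fact that averaging decreases
  norms.\<close>

lemma sq_int_time_integral:
  fixes A :: "'a \<Rightarrow> real \<Rightarrow> real"
  assumes "sigma_finite_measure M" and A: "sq_int (M \<Otimes>\<^sub>M lborel) (case_prod A)" and "s \<le> t"
  shows "sq_int M (\<lambda>x. LINT r:{s..t}|lborel. A x r)" (is ?a)
    and "(\<integral>x. (LINT r:{s..t}|lborel. A x r)\<^sup>2 \<partial>M) \<le> (t - s) * (LINT r:{s..t}|lborel. \<integral>x. (A x r)\<^sup>2 \<partial>M)" (is ?b)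
proof -
  interpret sigma_finite_measure M by fact
  interpret P: pair_sigma_finite M "lborel :: real measure" ..
  have m[measurable]: "case_prod A \<in> borel_measurable (M \<Otimes>\<^sub>M lborel)" using A by (rule sq_int_measurable)
  have mm[measurable]: "(\<lambda>x. LINT r:{s..t}|lborel. A x r) \<in> borel_measurable M"
    unfolding set_lebesgue_integral_def by measurable
  \<comment> \<open>The later simplification wants \<open>UNIV\<close> as first factor, but only
    \<open>space M \<times> {s..t}\<close> is known to be measurable; on the space of the product
    the two indicators agree.\<close>
  have "integrable (M \<Otimes>\<^sub>M lborel) (\<lambda>z. indicator (UNIV \<times> {s..t}) z *\<^sub>R (case z of (x, r) \<Rightarrow> (A x r)\<^sup>2))"
    using A integrable_mult_indicator[of "space M \<times> {s..t}" "M \<Otimes>\<^sub>M lborel" "\<lambda>(x,r). (A x r)\<^sup>2"]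
    by (subst Bochner_Integration.integrable_cong[OF refl, of _ _ "\<lambda>z. indicator (space M \<times> {s..t}) z *\<^sub>R (case z of (x, r) \<Rightarrow> (A x r)\<^sup>2)"])
      (auto simp: sq_int_def case_prod_beta' space_pair_measure split: split_indicator)
  then have i: "integrable (M \<Otimes>\<^sub>M lborel) (\<lambda>(x, r). indicator {s..t} r *\<^sub>R (A x r)\<^sup>2)"
    by (simp add: case_prod_beta' indicator_times)
  have i1: "integrable M (\<lambda>x. (t - s) * (LINT r:{s..t}|lborel. (A x r)\<^sup>2))"
    using P.integrable_fst[OF i] by (simp add: set_lebesgue_integral_def)
  have ae: "AE x in M. (LINT r:{s..t}|lborel. A x r)\<^sup>2 \<le> (t - s) * (LINT r:{s..t}|lborel. (A x r)\<^sup>2)"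
    using P.sq_int_section_fst[OF A] by eventually_elim (rule set_integral_square_le[OF _ \<open>s \<le> t\<close>])
  show a: ?a
    unfolding sq_int_def
  proof (intro conjI mm Bochner_Integration.integrable_bound[OF i1])
    show "AE x in M. norm ((LINT r:{s..t}|lborel. A x r)\<^sup>2) \<le> norm ((t - s) * (LINT r:{s..t}|lborel. (A x r)\<^sup>2))"
      using ae by eventually_elim (simp add: power2_eq_square)
  qed simp
  have "(\<integral>x. (LINT r:{s..t}|lborel. A x r)\<^sup>2 \<partial>M) \<le> (\<integral>x. (t - s) * (LINT r:{s..t}|lborel. (A x r)\<^sup>2) \<partial>M)"
    by (rule integral_mono_AE[OF sq_int_integrable_square[OF a] i1 ae])
  also have "\<dots> = (t - s) * (LINT r:{s..t}|lborel. \<integral>x. (A x r)\<^sup>2 \<partial>M)"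
    using P.integral_fst[OF i] P.integral_snd[OF i] by (simp add: set_lebesgue_integral_def)
  finally show ?b .
qed

text \<open>Fubini applies because \<open>a x\<close> times the indicator of the interval is
  square-integrable on the product, so that its product with \<open>A\<close> is integrable
  there.\<close>

lemma time_integral_pairing:
  fixes A :: "'a \<Rightarrow> real \<Rightarrow> real"
  assumes "sigma_finite_measure M" and A: "sq_int (M \<Otimes>\<^sub>M lborel) (case_prod A)" and a: "sq_int M a"
  shows "set_integrable lborel {s..t} (\<lambda>r. \<integral>x. a x * A x r \<partial>M)" (is ?a)
    and "(LINT r:{s..t}|lborel. \<integral>x. a x * A x r \<partial>M) = (\<integral>x. a x * (LINT r:{s..t}|lborel. A x r) \<partial>M)" (is ?b)
proof -
  interpret sigma_finite_measure M by fact
  interpret P: pair_sigma_finite M "lborel :: real measure" ..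
  have "sq_int (M \<Otimes>\<^sub>M lborel) (\<lambda>(x, y). a x * indicator {s..t} y)"
    by (intro sq_int_pair_tensor a P.pair_sigma_finite_axioms sq_int_indicator_Icc)
  from sq_int_integrable_mult[OF this A]
  have i: "integrable (M \<Otimes>\<^sub>M lborel) (\<lambda>(x, r). indicator {s..t} r * (a x * A x r))"
    by (simp add: case_prod_beta' mult_ac)
  from P.integrable_snd[OF i] show ?a by (simp add: set_integrable_def)
  from P.integral_fst[OF i] P.integral_snd[OF i] show ?b
    by (simp add: set_lebesgue_integral_def mult_ac flip: integral_mult_right_zero)
qed

subsection \<open>Steklov averages\<close>

text \<open>Moves variable endpoints into the integrand over the fixed interval [0,1], where the
  theorem on parameter integrals yields continuity in the endpoint.\<close>

lemma integral_Icc_rescale: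
  fixes f :: "real \<Rightarrow> real"
  assumes "continuous_on UNIV f" "c \<le> b"
  shows "integral {c..b} f = (b - c) * integral {0..1} (\<lambda>x. f (c + (b - c) * x))"
proof (cases "b = c")
  case False
  with assms have "0 < b - c" by simp
  have fi: "(f has_integral integral {c..b} f) (cbox c b)"
    using integrable_continuous_real[OF continuous_on_subset[OF assms(1)]] by auto
  have "((\<lambda>x. f ((b - c) *\<^sub>R x + c)) has_integral (1 / \<bar>b - c\<bar> ^ DIM(real)) *\<^sub>R integral {c..b} f)
     ((\<lambda>x. (1 / (b - c)) *\<^sub>R x + - ((1 / (b - c)) *\<^sub>R c)) ` cbox c b)"
    by (rule has_integral_affinity[OF fi]) (use False in simp)
  also have "(\<lambda>x. (1 / (b - c)) *\<^sub>R x + - ((1 / (b - c)) *\<^sub>R c)) ` cbox c b = {0..1}"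
    using False \<open>c \<le> b\<close> by (subst image_affinity_cbox) (auto simp: diff_divide_distrib[symmetric])
  finally have "integral {0..1} (\<lambda>x. f (c + (b - c) * x)) = (1 / \<bar>b - c\<bar>) * integral {c..b} f"
    by (auto intro!: integral_unique simp: add.commute)
  then show ?thesis using \<open>0 < b - c\<close> by simp
qed simp

text \<open>The integral \<open>P a b\<close> over the rectangle with corners \<open>(c, c)\<close>
  and \<open>(a, b)\<close> has the inner integrals as partial derivatives. These are continuous, so
  \<open>P\<close> is totally differentiable, and moving both endpoints at unit speed adds them. Of
  \<open>\<phi>\<close> only continuity enters.\<close>

lemma double_integral_diagonal_DERIV:
  fixes \<phi> :: "real \<Rightarrow> real \<Rightarrow> real"
  assumes cont: "continuous_on UNIV (\<lambda>p. \<phi> (fst p) (snd p))"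
    and sym: "\<And>a b. \<phi> a b = \<phi> b a" and p: "c < x + p" and q: "c < x + q"
  shows "((\<lambda>y. integral {c..y + p} (\<lambda>t. integral {c..y + q} (\<phi> t))) has_real_derivative
           integral {c..x + q} (\<phi> (x + p)) + integral {c..x + p} (\<phi> (x + q))) (at x)"
proof -
  \<comment> \<open>The square with side \<open>{c..d}\<close> contains
    \<open>(x + p, x + q)\<close> in its interior, so derivatives within it are ordinary derivatives
    at that point.\<close>
  define d where "d = max (x + p) (x + q) + 1"
  define g where "g s b = integral {c..b} (\<phi> s)" for s b
  define P where "P a b = integral {c..a} (\<lambda>t. g t b)" for a b
  have c1: "continuous_on S (\<lambda>z. \<phi> (f z) (h z))" if "continuous_on S f" "continuous_on S h"
    for S :: "'z::topological_space set" and f h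
    using continuous_on_compose2[OF cont continuous_on_Pair[OF that]] by simp
  have g_cont: "continuous_on (UNIV \<times> {c..}) (\<lambda>z. g (fst z) (snd z))"
  proof -
    have "continuous_on (UNIV \<times> {c..}) (\<lambda>z. (snd z - c) * integral (cbox 0 1) (\<lambda>y. \<phi> (fst z) (c + (snd z - c) * y)))"
    proof (intro continuous_intros integral_continuous_on_param)
      show "continuous_on ((UNIV \<times> {c..}) \<times> cbox 0 1)
        (\<lambda>(z, y). \<phi> (fst z) (c + (snd z - c) * y))"
        unfolding case_prod_beta' by (intro c1 continuous_intros)
    qed
    moreover have "(snd z - c) * integral (cbox 0 1) (\<lambda>y. \<phi> (fst z) (c + (snd z - c) * y)) = g (fst z) (snd z)"
      if "z \<in> UNIV \<times> {c..}" for z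
      using integral_Icc_rescale[OF c1[OF continuous_on_const continuous_on_id], of c "snd z" "fst z"] that
      by (auto simp: g_def)
    ultimately show ?thesis by (rule continuous_on_eq)
  qed
  have g2: "continuous_on S (\<lambda>z. g (f z) (h z))"
    if "continuous_on S f" "continuous_on S h" "\<And>z. z \<in> S \<Longrightarrow> c \<le> h z"
    for S :: "'z::topological_space set" and f h
  proof -
    have "(\<lambda>z. (f z, h z)) ` S \<subseteq> UNIV \<times> {c..}" using that(3) by auto
    from continuous_on_compose2[OF g_cont continuous_on_Pair[OF that(1,2)] this] show ?thesis by simp
  qed
  have g1: "continuous_on S (\<lambda>t. g t b)" if "c \<le> b" for b S
    by (intro g2 continuous_intros that)
  \<comment> \<open>Exchanging the order of integration and using the symmetry of
    \<open>\<phi>\<close> reduces the partial derivative in \<open>b\<close> to the one in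
    \<open>a\<close>.\<close>
  have P_sym: "P a b = P b a" for a b
  proof -
    have "integral {c..a} (\<lambda>t. integral {c..b} (\<phi> t)) = integral {c..b} (\<lambda>s. integral {c..a} (\<lambda>t. \<phi> t s))"
      using integral_swap_continuous[of c c a b "\<phi>"]
      by (auto simp: case_prod_beta' intro: continuous_on_subset[OF cont])
    also have "\<dots> = integral {c..b} (\<lambda>s. integral {c..a} (\<phi> s))"
      by (intro Henstock_Kurzweil_Integration.integral_cong) (rule sym)
    finally show ?thesis by (simp add: P_def g_def)
  qed
  have dP: "((\<lambda>a. P a b) has_derivative (\<lambda>h. h * g a b)) (at a within {c..d})" if "c \<le> b" "a \<in> {c..d}" for a b
    using integral_has_vector_derivative[OF g1[OF \<open>c \<le> b\<close>] that(2)]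
    by (simp add: P_def has_vector_derivative_def mult.commute)
  have D: "((\<lambda>(a, b). P a b) has_derivative (\<lambda>(ta, tb). ta * g (x + p) (x + q) + blinfun_scaleR_left (g (x + q) (x + p)) tb))
     (at (x + p, x + q) within {c..d} \<times> {c..d})"
  proof (rule has_derivative_partialsI)
    show "((\<lambda>a. P a (x + q)) has_derivative (\<lambda>ta. ta * g (x + p) (x + q))) (at (x + p) within {c..d})"
      by (rule dP) (use p q in \<open>auto simp: d_def\<close>)
    show "((\<lambda>b. P a b) has_derivative blinfun_apply (blinfun_scaleR_left (g b a))) (at b within {c..d})"
      if "a \<in> {c..d}" "b \<in> {c..d}" for a b
      using dP[of a b] that by (subst P_sym) (auto simp: blinfun_scaleR_left.rep_eq[abs_def])
    have "continuous_on ({c..d} \<times> {c..d}) (\<lambda>z. g (snd z) (fst z))"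
      by (intro g2 continuous_intros) auto
    then have "continuous_on ({c..d} \<times> {c..d}) (\<lambda>z. blinfun_scaleR_left (g (snd z) (fst z)))"
      by (intro bounded_linear.continuous_on[OF bounded_linear_blinfun_scaleR_left])
    then show "continuous (at (x + p, x + q) within {c..d} \<times> {c..d}) (\<lambda>(a, b). blinfun_scaleR_left (g b a))"
      using p q by (auto simp: continuous_on_eq_continuous_within case_prod_beta' d_def)
  qed (use p q in \<open>auto simp: d_def\<close>)
  have "(x + p, x + q) \<in> interior ({c..d} \<times> {c..d})"
    using p q by (auto simp: interior_Times d_def)
  then have "at (x + p, x + q) within {c..d} \<times> {c..d} = at (x + p, x + q)"
    by (rule at_within_interior)
  with D have D': "((\<lambda>(a, b). P a b) has_derivative (\<lambda>(ta, tb). ta * g (x + p) (x + q) + blinfun_scaleR_left (g (x + q) (x + p)) tb))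
     (at (x + p, x + q))" by simp
  have e: "((\<lambda>y. (y + p, y + q)) has_derivative (\<lambda>t. (t, t))) (at x)"
    by (auto intro!: derivative_eq_intros)
  have "((\<lambda>y. case (y + p, y + q) of (a, b) \<Rightarrow> P a b) has_derivative
     (\<lambda>t. case (t, t) of (ta, tb) \<Rightarrow> ta * g (x + p) (x + q) + blinfun_scaleR_left (g (x + q) (x + p)) tb)) (at x)"
    by (rule has_derivative_compose[OF e D'])
  moreover have "(\<lambda>t. case (t, t) of (ta, tb) \<Rightarrow> ta * g (x + p) (x + q) + blinfun_scaleR_left (g (x + q) (x + p)) tb)
      = (*) (g (x + p) (x + q) + g (x + q) (x + p))"
    by (auto simp: fun_eq_iff blinfun_scaleR_left.rep_eq algebra_simps)
  ultimately show ?thesis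
    by (simp add: has_field_derivative_def P_def g_def)
qed

lemma continuous_on_section:
  fixes \<phi> :: "real \<Rightarrow> real \<Rightarrow> real"
  assumes "continuous_on UNIV (\<lambda>p. \<phi> (fst p) (snd p))"
  shows "continuous_on S (\<phi> t)"
  using continuous_on_compose2[OF assms continuous_on_Pair[OF continuous_on_const[of S t] continuous_on_id]] by simp

lemma continuous_on_integral_section:
  fixes \<phi> :: "real \<Rightarrow> real \<Rightarrow> real"
  assumes cont: "continuous_on UNIV (\<lambda>p. \<phi> (fst p) (snd p))"
  shows "continuous_on S (\<lambda>t. integral {a..b} (\<phi> t))"
proof -
  have "continuous_on UNIV (\<lambda>t. integral (cbox a b) (\<phi> t))"
    using continuous_on_subset[OF cont] by (intro integral_continuous_on_param) (auto simp: case_prod_beta')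
  then show ?thesis by (auto intro: continuous_on_subset)
qed

text \<open>For \<open>\<phi> a b = (u(a), u(b))\<close> this is the derivative of the squared norm
  of the Steklov average over \<open>{y..y + h}\<close>. Inclusion-exclusion writes the square as
  four rectangles with one fixed corner \<open>(c, c)\<close>, each covered by the preceding lemma;
  symmetry produces the factor 2.\<close>

lemma steklov_square_DERIV:
  fixes \<phi> :: "real \<Rightarrow> real \<Rightarrow> real"
  assumes cont: "continuous_on UNIV (\<lambda>p. \<phi> (fst p) (snd p))"
    and sym: "\<And>a b. \<phi> a b = \<phi> b a" and h: "0 < h"
  shows "((\<lambda>y. integral {y..y + h} (\<lambda>t. integral {y..y + h} (\<phi> t))) has_real_derivative
           2 * integral {x..x + h} (\<lambda>s. \<phi> (x + h) s - \<phi> x s)) (at x)"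
proof -
  \<comment> \<open>A fixed corner strictly left of \<open>x\<close> is also left of every
    \<open>y\<close> near \<open>x\<close>; the decomposition is valid for these \<open>y\<close>,
    which suffices for the derivative.\<close>
  define c where "c = x - 1"
  define P where "P p q y = integral {c..y + p} (\<lambda>t. integral {c..y + q} (\<phi> t))" for p q y
  note s1 = continuous_on_section[OF cont] and s2 = continuous_on_integral_section[OF cont]
  have i: "\<phi> t integrable_on {a..b}" for t a b
    by (intro integrable_continuous_real s1)
  have split: "integral {c..y + h} f = integral {c..y} f + integral {y..y + h} f"
    if "c < y" "continuous_on UNIV f" for y and f :: "real \<Rightarrow> real"
    using Henstock_Kurzweil_Integration.integral_combine[of c y "y + h" f] that h
      integrable_continuous_real[OF continuous_on_subset[OF that(2)], of c "y + h"] by simp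
  have eq: "integral {y..y + h} (\<lambda>t. integral {y..y + h} (\<phi> t)) = P h h y - P h 0 y - P 0 h y + P 0 0 y" if "c < y" for y
  proof -
    have *: "P p h y - P p 0 y = integral {c..y + p} (\<lambda>t. integral {y..y + h} (\<phi> t))" for p
      unfolding P_def
      by (simp add: split[OF that s1] integrable_continuous_real s2
          Henstock_Kurzweil_Integration.integral_add)
    show ?thesis using *[of h] *[of 0] split[OF that s2[of UNIV y "y + h"]] by simp
  qed
  have D: "(P p q has_real_derivative integral {c..x + q} (\<phi> (x + p)) + integral {c..x + p} (\<phi> (x + q))) (at x)"
    if "0 \<le> p" "0 \<le> q" for p q
    unfolding P_def
    by (rule double_integral_diagonal_DERIV[OF cont sym]) (use that in \<open>auto simp: c_def\<close>)
  have cx: "c < x" by (simp add: c_def)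
  have "((\<lambda>y. P h h y - P h 0 y - P 0 h y + P 0 0 y) has_real_derivative
     2 * integral {x..x + h} (\<lambda>s. \<phi> (x + h) s - \<phi> x s)) (at x)"
    using h split[OF cx s1, of "x + h"] split[OF cx s1, of x]
    by (auto intro!: derivative_eq_intros D simp: Henstock_Kurzweil_Integration.integral_diff[OF i i])
  moreover have "\<forall>\<^sub>F y in nhds x. P h h y - P h 0 y - P 0 h y + P 0 0 y = integral {y..y + h} (\<lambda>t. integral {y..y + h} (\<phi> t))"
    by (rule eventually_mono[OF eventually_nhds_in_open[OF open_greaterThan, of x c]]) (auto simp: eq cx)
  ultimately show ?thesis by (subst (asm) DERIV_cong_ev[OF refl _ refl])
qed

text \<open>A square of side \<open>h\<close> has area \<open>h^2\<close> and its points are close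
  to \<open>(x, x)\<close>. This recovers the squared norm at a single time from the
  averages.\<close>

lemma steklov_square_near_diagonal:
  fixes \<phi> :: "real \<Rightarrow> real \<Rightarrow> real"
  assumes cont: "continuous_on UNIV (\<lambda>p. \<phi> (fst p) (snd p))" and "0 < \<epsilon>"
  shows "\<exists>d>0. \<forall>h. 0 < h \<and> h < d \<longrightarrow>
    \<bar>integral {x..x + h} (\<lambda>t. integral {x..x + h} (\<phi> t)) - h\<^sup>2 * \<phi> x x\<bar> \<le> \<epsilon> * h\<^sup>2"
proof -
  have "isCont (\<lambda>p. \<phi> (fst p) (snd p)) (x, x)"
    using cont by (simp add: continuous_on_eq_continuous_at)
  then obtain d where d: "d > 0" "\<And>p. dist p (x, x) < d \<Longrightarrow> \<bar>\<phi> (fst p) (snd p) - \<phi> x x\<bar> < \<epsilon>"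
    using \<open>0 < \<epsilon>\<close> unfolding continuous_at_eps_delta by (fastforce simp: dist_real_def)
  note s1 = continuous_on_section[OF cont] and s2 = continuous_on_integral_section[OF cont]
  \<comment> \<open>Applied twice: to the inner integral with \<open>B = \<epsilon>\<close> and to
    the outer one with \<open>B = \<epsilon> * h\<close>.\<close>
  have *: "\<bar>integral {x..x + h} f - h * c\<bar> \<le> B * h"
    if "0 < h" "continuous_on UNIV f" "\<And>t. t \<in> {x..x + h} \<Longrightarrow> \<bar>f t - c\<bar> \<le> B" for h B c and f :: "real \<Rightarrow> real"
  proof -
    have "integral {x..x + h} f - h * c = integral {x..x + h} (\<lambda>t. f t - c)"
      using that(1) Henstock_Kurzweil_Integration.integral_diff[of f "{x..x + h}" "\<lambda>_. c"]
        integrable_continuous_real[OF continuous_on_subset[OF that(2)], of x "x + h"]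
      by (simp add: integrable_const_ivl)
    moreover have "norm (integral {x..x + h} (\<lambda>t. f t - c)) \<le> B * (x + h - x)"
      by (rule integral_bound) (use that in \<open>auto intro!: continuous_intros intro: continuous_on_subset\<close>)
    ultimately show ?thesis by simp
  qed
  have "\<bar>integral {x..x + h} (\<lambda>t. integral {x..x + h} (\<phi> t)) - h * (h * \<phi> x x)\<bar> \<le> (\<epsilon> * h) * h"
    if "0 < h" "h < d / 2" for h
  proof (intro * that s2 s1)
    fix t s assume "t \<in> {x..x + h}" "s \<in> {x..x + h}"
    then have "dist (t, s) (x, x) < d"
      using that dist_triangle[of "(t, s)" "(x, x)" "(x, s)"] by (auto simp: dist_Pair_Pair dist_real_def)
    from d(2)[OF this] show "\<bar>\<phi> t s - \<phi> x x\<bar> \<le> \<epsilon>" by simp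
  qed
  then show ?thesis using d(1) by (intro exI[of _ "d / 2"]) (auto simp: power2_eq_square mult_ac)
qed

text \<open>The difference of two inner products splits into three pairings, each containing a
  difference \<open>u(t) - u(a)\<close> or \<open>u(s) - u(b)\<close> that is small in L2;
  Cauchy-Schwarz bounds them.\<close>

lemma sq_int_continuous_inner:
  fixes u :: "'a \<Rightarrow> 'b :: metric_space \<Rightarrow> real"
  assumes u: "\<And>t. t \<in> S \<Longrightarrow> sq_int M (\<lambda>x. u x t)"
    and cont: "\<And>t. t \<in> S \<Longrightarrow> ((\<lambda>s. \<integral>x. (u x s - u x t)\<^sup>2 \<partial>M) \<longlongrightarrow> 0) (at t within S)"
  shows "continuous_on (S \<times> S) (\<lambda>p. \<integral>x. u x (fst p) * u x (snd p) \<partial>M)"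
  unfolding continuous_on_sequentially comp_def
proof (intro allI ballI impI)
  fix X :: "nat \<Rightarrow> 'b \<times> 'b" and z
  assume "z \<in> S \<times> S" and "(\<forall>n. X n \<in> S \<times> S) \<and> X \<longlonglongrightarrow> z"
  then have z: "fst z \<in> S" "snd z \<in> S" and X: "\<And>n. fst (X n) \<in> S" "\<And>n. snd (X n) \<in> S"
    and lim: "(\<lambda>n. fst (X n)) \<longlonglongrightarrow> fst z" "(\<lambda>n. snd (X n)) \<longlonglongrightarrow> snd z"
    by (auto simp: mem_Times_iff intro: tendsto_fst tendsto_snd)
  define N where "N s t = sqrt (\<integral>x. (u x s - u x t)\<^sup>2 \<partial>M)" for s t
  have N: "(\<lambda>n. N (Y n) t) \<longlonglongrightarrow> 0" if "t \<in> S" "\<And>n. Y n \<in> S" "Y \<longlonglongrightarrow> t" for Y t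
  proof -
    have "continuous (at t within S) (\<lambda>s. \<integral>x. (u x s - u x t)\<^sup>2 \<partial>M)"
      using cont[OF that(1)] by (simp add: continuous_within)
    then have "(\<lambda>n. \<integral>x. (u x (Y n) - u x t)\<^sup>2 \<partial>M) \<longlonglongrightarrow> 0"
      unfolding continuous_within_sequentially using that by (auto simp: comp_def)
    from tendsto_real_sqrt[OF this] show ?thesis by (simp add: N_def)
  qed
  let ?E = "\<lambda>t. sqrt (\<integral>x. (u x t)\<^sup>2 \<partial>M)"
  have b: "\<bar>(\<integral>x. u x t * u x s \<partial>M) - (\<integral>x. u x a * u x b \<partial>M)\<bar> \<le> N t a * N s b + N t a * ?E b + ?E a * N s b"
    if "t \<in> S" "s \<in> S" "a \<in> S" "b \<in> S" for t s a b
  proof -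
    note sq = u[OF that(1)] u[OF that(2)] u[OF that(3)] u[OF that(4)]
    note d = sq_int_diff[OF sq(1,3)] sq_int_diff[OF sq(2,4)]
    note i = sq_int_integrable_mult[OF d] sq_int_integrable_mult[OF d(1) sq(4)] sq_int_integrable_mult[OF sq(3) d(2)]
    have "(\<integral>x. u x t * u x s \<partial>M) - (\<integral>x. u x a * u x b \<partial>M) = (\<integral>x. u x t * u x s - u x a * u x b \<partial>M)"
      by (rule Bochner_Integration.integral_diff[symmetric]; rule sq_int_integrable_mult; rule sq)
    also have "\<dots> = (\<integral>x. (u x t - u x a) * (u x s - u x b) + (u x t - u x a) * u x b + u x a * (u x s - u x b) \<partial>M)"
      by (rule arg_cong[where f="integral\<^sup>L M"]) (auto simp: algebra_simps)
    also have "\<dots> = (\<integral>x. (u x t - u x a) * (u x s - u x b) \<partial>M) + (\<integral>x. (u x t - u x a) * u x b \<partial>M) + (\<integral>x. u x a * (u x s - u x b) \<partial>M)"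
      using i by simp
    finally show ?thesis
      using abs_integral_Cauchy_Schwarz[OF d] abs_integral_Cauchy_Schwarz[OF d(1) sq(4)] abs_integral_Cauchy_Schwarz[OF sq(3) d(2)]
      unfolding N_def by linarith
  qed
  have "(\<lambda>n. N (fst (X n)) (fst z) * N (snd (X n)) (snd z) + N (fst (X n)) (fst z) * ?E (snd z) + ?E (fst z) * N (snd (X n)) (snd z)) \<longlonglongrightarrow> 0 * 0 + 0 * ?E (snd z) + ?E (fst z) * 0"
    by (intro tendsto_intros N z X lim)
  then have lim0: "(\<lambda>n. N (fst (X n)) (fst z) * N (snd (X n)) (snd z) + N (fst (X n)) (fst z) * ?E (snd z) + ?E (fst z) * N (snd (X n)) (snd z)) \<longlonglongrightarrow> 0"
    by simp
  have "(\<lambda>n. (\<integral>x. u x (fst (X n)) * u x (snd (X n)) \<partial>M) - (\<integral>x. u x (fst z) * u x (snd z) \<partial>M)) \<longlonglongrightarrow> 0"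
    by (rule Lim_null_comparison[OF always_eventually lim0]) (use b[OF X z] in simp)
  then show "(\<lambda>n. \<integral>x. u x (fst (X n)) * u x (snd (X n)) \<partial>M) \<longlonglongrightarrow> (\<integral>x. u x (fst z) * u x (snd z) \<partial>M)"
    by (rule LIM_zero_cancel)
qed

subsection \<open>Energy inequality\<close>

lemma set_integral_Icc_diff:
  fixes f :: "real \<Rightarrow> real"
  assumes "set_integrable lborel {a..c} f" "a \<le> b" "b \<le> c"
  shows "(LINT r:{a..c}|lborel. f r) - (LINT r:{a..b}|lborel. f r) = (LINT r:{b..c}|lborel. f r)"
proof -
  have i: "set_integrable lborel {a..b} f" "set_integrable lborel {b..c} f"
    using assms by (auto intro: set_integrable_subset)
  have "integral {a..b} f + integral {b..c} f = integral {a..c} f"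
    using assms by (intro Henstock_Kurzweil_Integration.integral_combine set_borel_integral_eq_integral)
  with assms i show ?thesis by (simp add: set_borel_integral_eq_integral)
qed

text \<open>The Steklov average over a short time interval is an admissible test function, and the
  cross term with \<open>F\<close> is absorbed by completing the square.\<close>

lemma steklov_energy_bound:
  fixes u G F F0 :: "'a \<Rightarrow> real \<Rightarrow> real"
  assumes sf: "sigma_finite_measure M"
    and u: "sq_int (M \<Otimes>\<^sub>M lborel) (case_prod u)" and G: "sq_int (M \<Otimes>\<^sub>M lborel) (case_prod G)"
    and F: "sq_int (M \<Otimes>\<^sub>M lborel) (case_prod F)" and F0: "sq_int (M \<Otimes>\<^sub>M lborel) (case_prod F0)"
    and ut: "\<And>t. t \<in> {0..T} \<Longrightarrow> sq_int M (\<lambda>x. u x t)"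
    and weak: "AE \<sigma> in lborel. \<sigma> \<in> {0..T} \<longrightarrow> (\<forall>t\<in>{0..T}. (\<integral>x. u x t * u x \<sigma> \<partial>M) =
        (LINT r:{0..t}|lborel. (\<integral>x. u x \<sigma> * F0 x r \<partial>M) - (\<integral>x. G x \<sigma> * (G x r + F x r) \<partial>M)))"
    and s: "0 \<le> s" "0 < h" "s + h \<le> T"
  shows "2 * (LINT \<sigma>:{s..s + h}|lborel. (\<integral>x. u x (s + h) * u x \<sigma> \<partial>M) - (\<integral>x. u x s * u x \<sigma> \<partial>M)) \<le>
     h * (LINT r:{s..s + h}|lborel. (\<integral>x. (F x r)\<^sup>2 \<partial>M) / 2 + (\<integral>x. (F0 x r)\<^sup>2 \<partial>M) + (\<integral>x. (u x r)\<^sup>2 \<partial>M))"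
proof -
  interpret sigma_finite_measure M by fact
  interpret P: pair_sigma_finite M "lborel :: real measure" ..
  define I where "I = {s..s + h}"
  define H where "H A x = (LINT r:I|lborel. A x r)" for A :: "'a \<Rightarrow> real \<Rightarrow> real" and x
  have GF: "sq_int (M \<Otimes>\<^sub>M lborel) (\<lambda>(x, r). G x r + F x r)"
    using sq_int_add[OF G F] by (simp add: case_prod_beta')
  have sh: "s \<le> s + h" using s by simp
  have sqH: "sq_int M (H A)" "(\<integral>x. (H A x)\<^sup>2 \<partial>M) \<le> h * (LINT r:I|lborel. \<integral>x. (A x r)\<^sup>2 \<partial>M)"
    if "sq_int (M \<Otimes>\<^sub>M lborel) (case_prod A)" for A
    using sq_int_time_integral[OF sf that sh] by (simp_all add: H_def[abs_def] I_def)
  have pair: "set_integrable lborel I (\<lambda>r. \<integral>x. a x * A x r \<partial>M)"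
       "(LINT r:I|lborel. \<integral>x. a x * A x r \<partial>M) = (\<integral>x. a x * H A x \<partial>M)"
    if "sq_int (M \<Otimes>\<^sub>M lborel) (case_prod A)" "sq_int M a" for A a
    using time_integral_pairing[OF sf that, of s "s + h"] by (simp_all add: H_def I_def)
  let ?d = "\<lambda>\<sigma>. (\<integral>x. u x (s + h) * u x \<sigma> \<partial>M) - (\<integral>x. u x s * u x \<sigma> \<partial>M)"
  \<comment> \<open>The weak identities at times \<open>s + h\<close> and \<open>s\<close> are
    subtracted, with \<open>u\<close> frozen at time \<open>\<sigma>\<close> as test function. The
    identity and the square-integrability of the spatial sections hold for almost every
    \<open>\<sigma>\<close> only.\<close>
  have diff: "AE \<sigma> in lborel. \<sigma> \<in> I \<longrightarrow> ?d \<sigma> = (\<integral>x. H F0 x * u x \<sigma> \<partial>M) - (\<integral>x. H (\<lambda>x r. G x r + F x r) x * G x \<sigma> \<partial>M)"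
    using weak P.sq_int_section_snd[OF u] P.sq_int_section_snd[OF G]
  proof eventually_elim
    case (elim \<sigma>)
    show ?case
    proof
      assume "\<sigma> \<in> I"
      then have \<sigma>: "\<sigma> \<in> {0..T}" using s by (auto simp: I_def)
      let ?k = "\<lambda>r. (\<integral>x. u x \<sigma> * F0 x r \<partial>M) - (\<integral>x. G x \<sigma> * (G x r + F x r) \<partial>M)"
      have i: "set_integrable lborel {0..s + h} ?k"
        by (intro set_integral_diff time_integral_pairing[OF sf F0 elim(2)] time_integral_pairing[OF sf GF elim(3)])
      have "?d \<sigma> = (LINT r:{0..s + h}|lborel. ?k r) - (LINT r:{0..s}|lborel. ?k r)"
        using elim(1) \<sigma> s by simp
      also have "\<dots> = (LINT r:I|lborel. ?k r)"
        unfolding I_def by (rule set_integral_Icc_diff[OF i]) (use s in auto)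
      also have "\<dots> = (LINT r:I|lborel. \<integral>x. u x \<sigma> * F0 x r \<partial>M) - (LINT r:I|lborel. \<integral>x. G x \<sigma> * (G x r + F x r) \<partial>M)"
        by (rule set_integral_diff[OF pair(1)[OF F0 elim(2)] pair(1)[OF GF elim(3)]])
      also have "\<dots> = (\<integral>x. u x \<sigma> * H F0 x \<partial>M) - (\<integral>x. G x \<sigma> * H (\<lambda>x r. G x r + F x r) x \<partial>M)"
        by (simp only: pair(2)[OF F0 elim(2)] pair(2)[OF GF elim(3)])
      finally show "?d \<sigma> = (\<integral>x. H F0 x * u x \<sigma> \<partial>M) - (\<integral>x. H (\<lambda>x r. G x r + F x r) x * G x \<sigma> \<partial>M)"
        by (simp add: mult.commute)
    qed
  qed
  have um: "sq_int M (\<lambda>x. u x s)" "sq_int M (\<lambda>x. u x (s + h))"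
    using s by (auto intro: ut)
  note p1 = pair[OF u sqH(1)[OF F0]] and p2 = pair[OF G sqH(1)[OF GF]]
  have 1: "set_integrable lborel I ?d"
    by (intro set_integral_diff pair u um)
  have 2: "set_integrable lborel I (\<lambda>\<sigma>. (\<integral>x. H F0 x * u x \<sigma> \<partial>M) - (\<integral>x. H (\<lambda>x r. G x r + F x r) x * G x \<sigma> \<partial>M))"
    by (intro set_integral_diff p1 p2)
  have "(LINT \<sigma>:I|lborel. ?d \<sigma>) = (LINT \<sigma>:I|lborel. (\<integral>x. H F0 x * u x \<sigma> \<partial>M) - (\<integral>x. H (\<lambda>x r. G x r + F x r) x * G x \<sigma> \<partial>M))"
    unfolding set_lebesgue_integral_def
  proof (rule integral_cong_AE)
    show "AE \<sigma> in lborel. indicator I \<sigma> *\<^sub>R ?d \<sigma> = indicator I \<sigma> *\<^sub>R ((\<integral>x. H F0 x * u x \<sigma> \<partial>M) - (\<integral>x. H (\<lambda>x r. G x r + F x r) x * G x \<sigma> \<partial>M))"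
      using diff by eventually_elim (auto split: split_indicator)
  qed (use 1 2 in \<open>auto simp: set_integrable_def dest: borel_measurable_integrable\<close>)
  also have "\<dots> = (\<integral>x. H F0 x * H u x \<partial>M) - (\<integral>x. H (\<lambda>x r. G x r + F x r) x * H G x \<partial>M)"
    by (subst set_integral_diff[OF p1(1) p2(1)]) (simp only: p1(2) p2(2))
  finally have key: "(LINT \<sigma>:I|lborel. ?d \<sigma>) = (\<integral>x. H F0 x * H u x \<partial>M) - (\<integral>x. H (\<lambda>x r. G x r + F x r) x * H G x \<partial>M)" .
  note sq = sqH(1)[OF u] sqH(1)[OF F0] sqH(1)[OF F] sqH(1)[OF G] sqH(1)[OF GF]
  have "(\<integral>x. 2 * (H F0 x * H u x) \<partial>M) \<le> (\<integral>x. (H F0 x)\<^sup>2 + (H u x)\<^sup>2 \<partial>M)"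
  proof (rule integral_mono)
    show "2 * (H F0 x * H u x) \<le> (H F0 x)\<^sup>2 + (H u x)\<^sup>2" for x
      using sum_squares_bound[of "H F0 x" "H u x"] by (simp add: mult.assoc)
  qed (use sq sq_int_integrable_mult in \<open>auto intro: sq_int_integrable_square\<close>)
  then have A: "2 * (\<integral>x. H F0 x * H u x \<partial>M) \<le> (\<integral>x. (H F0 x)\<^sup>2 \<partial>M) + (\<integral>x. (H u x)\<^sup>2 \<partial>M)"
    using sq by (simp add: sq_int_integrable_square)
  \<comment> \<open>Additivity of the time integral requires integrable time sections, which exist
    for almost every point of space.\<close>
  have ae: "AE x in M. H (\<lambda>x r. G x r + F x r) x = H G x + H F x"
    using P.sq_int_section_fst[OF G] P.sq_int_section_fst[OF F]
  proof eventually_elim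
    case (elim x)
    have *: "set_integrable lborel I f" if "sq_int lborel f" for f
      using sq_int_integrable_mult[OF sq_int_indicator_Icc that] by (simp add: set_integrable_def I_def)
    show ?case unfolding H_def by (rule set_integral_add[OF *[OF elim(1)] *[OF elim(2)]])
  qed
  have "(\<integral>x. - 2 * (H (\<lambda>x r. G x r + F x r) x * H G x) \<partial>M) \<le> (\<integral>x. (H F x)\<^sup>2 / 2 \<partial>M)"
  proof (rule integral_mono_AE)
    show "AE x in M. - 2 * (H (\<lambda>x r. G x r + F x r) x * H G x) \<le> (H F x)\<^sup>2 / 2"
      using ae
    proof eventually_elim
      case (elim x)
      \<comment> \<open>Half of this square is the difference of the two sides, which is the source
        of the factor 1/2 in front of the norm of \<open>F\<close>.\<close>
      have "0 \<le> (2 * H G x + H F x)\<^sup>2" by simp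
      then show ?case unfolding elim by (simp add: power2_eq_square algebra_simps)
    qed
  qed (use sq sq_int_integrable_mult in \<open>auto intro: sq_int_integrable_square\<close>)
  then have B: "- 2 * (\<integral>x. H (\<lambda>x r. G x r + F x r) x * H G x \<partial>M) \<le> (\<integral>x. (H F x)\<^sup>2 \<partial>M) / 2"
    by simp
  have sI: "set_integrable lborel I f" if "integrable lborel f" for f :: "real \<Rightarrow> real"
    using integrable_mult_indicator[OF _ that, of I] by (simp add: set_integrable_def I_def)
  note n = P.integrable_square_section[OF F] P.integrable_square_section[OF F0] P.integrable_square_section[OF u]
  have "(LINT r:I|lborel. (\<integral>x. (F x r)\<^sup>2 \<partial>M) / 2 + (\<integral>x. (F0 x r)\<^sup>2 \<partial>M) + (\<integral>x. (u x r)\<^sup>2 \<partial>M)) =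
     (LINT r:I|lborel. (\<integral>x. (F x r)\<^sup>2 \<partial>M)) / 2 + (LINT r:I|lborel. (\<integral>x. (F0 x r)\<^sup>2 \<partial>M)) + (LINT r:I|lborel. (\<integral>x. (u x r)\<^sup>2 \<partial>M))"
    using n by (simp add: set_integral_add sI)
  then have "h * (LINT r:I|lborel. (\<integral>x. (F x r)\<^sup>2 \<partial>M) / 2 + (\<integral>x. (F0 x r)\<^sup>2 \<partial>M) + (\<integral>x. (u x r)\<^sup>2 \<partial>M)) =
     h * (LINT r:I|lborel. (\<integral>x. (F x r)\<^sup>2 \<partial>M)) / 2 + h * (LINT r:I|lborel. (\<integral>x. (F0 x r)\<^sup>2 \<partial>M)) + h * (LINT r:I|lborel. (\<integral>x. (u x r)\<^sup>2 \<partial>M))"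
    by (simp add: algebra_simps)
  then show ?thesis
    using A B key sqH(2)[OF u] sqH(2)[OF F0] sqH(2)[OF F] unfolding I_def[symmetric] by linarith
qed

text \<open>The derivative of the Steklov square \<open>\<Phi> h\<close> is at most that of
  \<open>h * (NN (s + h) - NN s)\<close>, where \<open>N\<close> is a primitive of the right-hand
  density \<open>e\<close> and \<open>NN\<close> a primitive of \<open>N\<close>. Dividing the
  integrated inequality by \<open>h^2\<close> and letting \<open>h\<close> tend to 0 turns averages
  back into values of \<open>u\<close>.\<close>

lemma energy_inequality:
  fixes u G F F0 :: "'a \<Rightarrow> real \<Rightarrow> real"
  assumes sf: "sigma_finite_measure M" and T: "0 < T"
    and u: "sq_int (M \<Otimes>\<^sub>M lborel) (case_prod u)" and G: "sq_int (M \<Otimes>\<^sub>M lborel) (case_prod G)"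
    and F: "sq_int (M \<Otimes>\<^sub>M lborel) (case_prod F)" and F0: "sq_int (M \<Otimes>\<^sub>M lborel) (case_prod F0)"
    and ut: "\<And>t. t \<in> {0..T} \<Longrightarrow> sq_int M (\<lambda>x. u x t)"
    and cont: "\<And>t. t \<in> {0..T} \<Longrightarrow> ((\<lambda>s. \<integral>x. (u x s - u x t)\<^sup>2 \<partial>M) \<longlongrightarrow> 0) (at t within {0..T})"
    and init: "(\<integral>x. (u x 0)\<^sup>2 \<partial>M) = 0"
    and weak: "AE \<sigma> in lborel. \<sigma> \<in> {0..T} \<longrightarrow> (\<forall>t\<in>{0..T}. (\<integral>x. u x t * u x \<sigma> \<partial>M) =
        (LINT r:{0..t}|lborel. (\<integral>x. u x \<sigma> * F0 x r \<partial>M) - (\<integral>x. G x \<sigma> * (G x r + F x r) \<partial>M)))"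
    and t: "t \<in> {0..T}"
  shows "(\<integral>x. (u x t)\<^sup>2 \<partial>M) \<le>
     (LINT r:{0..t}|lborel. (\<integral>x. (F x r)\<^sup>2 \<partial>M) / 2 + (\<integral>x. (F0 x r)\<^sup>2 \<partial>M) + (\<integral>x. (u x r)\<^sup>2 \<partial>M))"
proof -
  interpret sigma_finite_measure M by fact
  interpret P: pair_sigma_finite M "lborel :: real measure" ..
  define e where "e r = (\<integral>x. (F x r)\<^sup>2 \<partial>M) / 2 + (\<integral>x. (F0 x r)\<^sup>2 \<partial>M) + (\<integral>x. (u x r)\<^sup>2 \<partial>M)" for r
  have e0: "0 \<le> e r" for r by (simp add: e_def)
  have e: "integrable lborel e"
    using P.integrable_square_section[OF F] P.integrable_square_section[OF F0] P.integrable_square_section[OF u]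
    by (simp add: e_def[abs_def])
  have sI: "set_integrable lborel {a..b} e" for a b
    using integrable_mult_indicator[OF _ e, of "{a..b}"] by (simp add: set_integrable_def)
  have eI: "e integrable_on {a..b}" "(LINT r:{a..b}|lborel. e r) = integral {a..b} e" for a b
    using set_borel_integral_eq_integral[OF sI] by auto
  \<comment> \<open>The base point -1 and the range up to \<open>T + 1\<close> make every time in
    \<open>{0..T}\<close> interior, so that \<open>NN\<close> has two-sided derivatives
    there.\<close>
  define N where "N t = integral {-1..t} e" for t
  define NN where "NN t = integral {-1..t} N" for t
  have N_diff: "N b - N a = (LINT r:{a..b}|lborel. e r)" if "-1 \<le> a" "a \<le> b" for a b
    using set_integral_Icc_diff[OF sI that] by (simp add: N_def eI)
  have N_mono: "N a \<le> N b" if "-1 \<le> a" "a \<le> b" for a b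
  proof -
    have "0 \<le> (LINT r:{a..b}|lborel. e r)"
      unfolding set_lebesgue_integral_def by (intro integral_nonneg_AE) (simp add: e0)
    with N_diff[OF that] show ?thesis by simp
  qed
  have N_cont: "continuous_on {-1..T + 1} N"
    unfolding N_def by (intro indefinite_integral_continuous_1 eI)
  have N_int: "N integrable_on {a..b}" if "-1 \<le> a" "b \<le> T + 1" for a b
    using that by (intro integrable_continuous_real continuous_on_subset[OF N_cont]) auto
  have NN_D: "(NN has_real_derivative N x) (at x)" if "-1 < x" "x < T + 1" for x
  proof -
    have "(NN has_real_derivative N x) (at x within {-1..T + 1})"
      unfolding NN_def by (rule integral_has_real_derivative[OF N_cont]) (use that in auto)
    moreover have "at x within {-1..T + 1} = at x"
      using that by (intro at_within_interior) auto
    ultimately show ?thesis by simp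
  qed
  \<comment> \<open>Since \<open>N\<close> is nondecreasing, increments of \<open>NN\<close> are
    squeezed between the end values of \<open>N\<close> times the step; this later supplies the
    second factor \<open>h\<close>.\<close>
  have NN_diff: "h * N a \<le> NN (a + h) - NN a" "NN (a + h) - NN a \<le> h * N (a + h)"
    if "0 \<le> a" "0 < h" "a + h \<le> T" for a h
  proof -
    have eq: "NN (a + h) - NN a = integral {a..a + h} N"
      using Henstock_Kurzweil_Integration.integral_combine[of "-1" a "a + h" N] N_int[of "-1" "a + h"] that
      by (simp add: NN_def)
    have "integral {a..a + h} (\<lambda>_. N a) \<le> integral {a..a + h} N"
      using that by (intro integral_le N_int N_mono integrable_const_ivl) auto
    moreover have "integral {a..a + h} N \<le> integral {a..a + h} (\<lambda>_. N (a + h))"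
      using that by (intro integral_le N_int N_mono integrable_const_ivl) auto
    ultimately show "h * N a \<le> NN (a + h) - NN a" "NN (a + h) - NN a \<le> h * N (a + h)"
      using that eq by auto
  qed
  \<comment> \<open>Clamping times to \<open>{0..T}\<close> extends the kernel continuously to the
    whole plane, as the lemmas on Steklov squares require.\<close>
  define cl where "cl y = max 0 (min T y)" for y
  have cl: "cl y \<in> {0..T}" for y using T by (auto simp: cl_def)
  have cl_id: "y \<in> {0..T} \<Longrightarrow> cl y = y" for y by (auto simp: cl_def)
  define \<phi> where "\<phi> a b = (\<integral>x. u x (cl a) * u x (cl b) \<partial>M)" for a b
  have ccl: "continuous_on S (\<lambda>z. cl (f z))" if "continuous_on S f" for S :: "'z::topological_space set" and f
    unfolding cl_def by (intro continuous_intros that)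
  have \<phi>_cont: "continuous_on UNIV (\<lambda>p. \<phi> (fst p) (snd p))"
  proof -
    have "continuous_on UNIV (\<lambda>p. (cl (fst p), cl (snd p)))"
      by (intro continuous_on_Pair ccl continuous_intros)
    from continuous_on_compose2[OF sq_int_continuous_inner[OF ut cont] this] show ?thesis
      using cl by (simp add: \<phi>_def image_subset_iff)
  qed
  have \<phi>_cont2: "continuous_on S (\<lambda>z. \<phi> (f z) (g z))" if "continuous_on S f" "continuous_on S g"
    for S :: "real set" and f g
    using continuous_on_compose2[OF \<phi>_cont continuous_on_Pair[OF that]] by simp
  have \<phi>_sym: "\<phi> a b = \<phi> b a" for a b by (simp add: \<phi>_def mult.commute)
  define \<Phi> where "\<Phi> h y = integral {y..y + h} (\<lambda>t. integral {y..y + h} (\<phi> t))" for h y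
  have step: "\<Phi> h \<tau> \<le> \<Phi> h 0 + h\<^sup>2 * (N (\<tau> + h) - N 0)" if \<tau>: "0 \<le> \<tau>" "0 < h" "\<tau> + h \<le> T" for h \<tau>
  proof -
    let ?q = "\<lambda>s. \<Phi> h s - h * (NN (s + h) - NN s)"
    have "?q \<tau> \<le> ?q 0"
    proof (rule DERIV_nonpos_imp_nonincreasing[OF \<tau>(1)])
      fix s assume s: "0 \<le> s" "s \<le> \<tau>"
      have D1: "(\<Phi> h has_real_derivative 2 * integral {s..s + h} (\<lambda>r. \<phi> (s + h) r - \<phi> s r)) (at s)"
        unfolding \<Phi>_def by (rule steklov_square_DERIV[OF \<phi>_cont \<phi>_sym \<tau>(2)])
      have D2: "((\<lambda>s. NN (s + h)) has_real_derivative N (s + h)) (at s)"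
        using DERIV_shift[of NN "N (s + h)" s h] NN_D[of "s + h"] s \<tau> by auto
      have D: "(?q has_real_derivative 2 * integral {s..s + h} (\<lambda>r. \<phi> (s + h) r - \<phi> s r) - h * (N (s + h) - N s)) (at s)"
        using s \<tau> by (intro DERIV_diff DERIV_cmult D1 D2 NN_D) auto
      have c: "continuous_on {s..s + h} (\<lambda>r. \<phi> (s + h) r - \<phi> s r)"
        by (intro continuous_intros \<phi>_cont2)
      have "integral {s..s + h} (\<lambda>r. \<phi> (s + h) r - \<phi> s r) = (LINT r:{s..s + h}|lborel. \<phi> (s + h) r - \<phi> s r)"
        by (intro set_borel_integral_eq_integral(2)[symmetric] borel_integrable_atLeastAtMost' c)
      also have "\<dots> = (LINT \<sigma>:{s..s + h}|lborel. (\<integral>x. u x (s + h) * u x \<sigma> \<partial>M) - (\<integral>x. u x s * u x \<sigma> \<partial>M))"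
        using s \<tau> by (intro set_lebesgue_integral_cong) (auto simp: \<phi>_def cl_id)
      finally have "2 * integral {s..s + h} (\<lambda>r. \<phi> (s + h) r - \<phi> s r) \<le> h * (N (s + h) - N s)"
        using steklov_energy_bound[OF sf u G F F0 ut weak s(1) \<tau>(2)] N_diff[of s "s + h"] s \<tau>
        by (simp add: e_def[symmetric])
      then have "2 * integral {s..s + h} (\<lambda>r. \<phi> (s + h) r - \<phi> s r) - h * (N (s + h) - N s) \<le> 0" by simp
      with D show "\<exists>y. DERIV ?q s :> y \<and> y \<le> 0" by blast
    qed
    moreover have "h * (NN (\<tau> + h) - NN \<tau>) - h * (NN h - NN 0) \<le> h\<^sup>2 * (N (\<tau> + h) - N 0)"
      using NN_diff(2)[OF \<tau>] NN_diff(1)[of 0 h] \<tau>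
        mult_left_mono[of "(NN (\<tau> + h) - NN \<tau>) - (NN h - NN 0)" "h * N (\<tau> + h) - h * N 0" h]
      by (simp add: power2_eq_square algebra_simps)
    ultimately show ?thesis by simp
  qed
  have main: "\<phi> \<tau> \<tau> \<le> N \<tau> - N 0" if \<tau>: "0 \<le> \<tau>" "\<tau> < T" for \<tau>
  proof (rule field_le_epsilon)
    fix \<epsilon> :: real assume "0 < \<epsilon>"
    \<comment> \<open>One third each for the diagonal approximation at \<open>\<tau>\<close>, the
      one at 0, and the continuity of \<open>N\<close> at \<open>\<tau>\<close>.\<close>
    then have e3: "0 < \<epsilon> / 3" by simp
    obtain d1 where d1: "d1 > 0" "\<And>h. 0 < h \<Longrightarrow> h < d1 \<Longrightarrow> \<bar>\<Phi> h \<tau> - h\<^sup>2 * \<phi> \<tau> \<tau>\<bar> \<le> \<epsilon> / 3 * h\<^sup>2"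
      using steklov_square_near_diagonal[OF \<phi>_cont e3, of \<tau>] unfolding \<Phi>_def by blast
    obtain d2 where d2: "d2 > 0" "\<And>h. 0 < h \<Longrightarrow> h < d2 \<Longrightarrow> \<bar>\<Phi> h 0 - h\<^sup>2 * \<phi> 0 0\<bar> \<le> \<epsilon> / 3 * h\<^sup>2"
      using steklov_square_near_diagonal[OF \<phi>_cont e3, of 0] unfolding \<Phi>_def by blast
    have "continuous (at \<tau> within {-1..T + 1}) N"
      using N_cont \<tau> by (simp add: continuous_on_eq_continuous_within)
    then obtain d3 where d3: "d3 > 0" "\<And>y. y \<in> {-1..T + 1} \<Longrightarrow> \<bar>y - \<tau>\<bar> < d3 \<Longrightarrow> \<bar>N y - N \<tau>\<bar> < \<epsilon> / 3"
      using e3 unfolding continuous_within_eps_delta dist_real_def by blast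
    define h where "h = min (min d1 d2) (min d3 (T - \<tau>)) / 2"
    have h: "0 < h" "h < d1" "h < d2" "h < d3" "\<tau> + h \<le> T"
      using d1(1) d2(1) d3(1) \<tau> by (auto simp: h_def min_def field_simps)
    have z0: "\<phi> 0 0 = 0" using init T by (simp add: \<phi>_def cl_id power2_eq_square)
    have "h\<^sup>2 * \<phi> \<tau> \<tau> \<le> \<epsilon> / 3 * h\<^sup>2 + \<epsilon> / 3 * h\<^sup>2 + h\<^sup>2 * (N (\<tau> + h) - N 0)"
      using d1(2)[OF h(1,2)] d2(2)[OF h(1,3), unfolded z0 mult_zero_right diff_zero] step[OF \<tau>(1) h(1,5)] unfolding abs_le_iff by linarith
    also have "\<dots> = h\<^sup>2 * (\<epsilon> / 3 + \<epsilon> / 3 + (N (\<tau> + h) - N 0))" by (simp add: algebra_simps)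
    finally have "\<phi> \<tau> \<tau> \<le> \<epsilon> / 3 + \<epsilon> / 3 + (N (\<tau> + h) - N 0)"
      using h by (simp add: mult_le_cancel_left)
    moreover have "N (\<tau> + h) - N \<tau> < \<epsilon> / 3"
      using order_le_less_trans[OF abs_ge_self d3(2)[of "\<tau> + h"]] h \<tau> by simp
    ultimately show "\<phi> \<tau> \<tau> \<le> N \<tau> - N 0 + \<epsilon>" by simp
  qed
  \<comment> \<open>At the final time the averaging interval would leave \<open>{0..T}\<close>; this
    case is reached by continuity of both sides.\<close>
  have "\<phi> t t - N t \<le> - N 0"
  proof (rule continuous_le_on_closure[of "{0..<T}" "\<lambda>\<tau>. \<phi> \<tau> \<tau> - N \<tau>"])
    show "continuous_on (closure {0..<T}) (\<lambda>\<tau>. \<phi> \<tau> \<tau> - N \<tau>)"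
      using T by (intro continuous_intros \<phi>_cont2 continuous_on_subset[OF N_cont]) auto
    show "t \<in> closure {0..<T}" using t T by simp
    show "\<phi> \<tau> \<tau> - N \<tau> \<le> - N 0" if "\<tau> \<in> {0..<T}" for \<tau>
      using main[of \<tau>] that by simp
  qed
  moreover have "\<phi> t t = (\<integral>x. (u x t)\<^sup>2 \<partial>M)"
    using t by (simp add: \<phi>_def cl_id power2_eq_square)
  ultimately show ?thesis using N_diff[of 0 t] t by (simp add: e_def)
qed

text \<open>Summing the unweighted inequality at the final time and, with weight \<open>k exp (- k s)\<close>,
  at all earlier times \<open>s\<close> avoids Gronwall's lemma and any differentiability of the energy.\<close>

lemma exponential_weight_integral:
  fixes e E :: "real \<Rightarrow> real"
  assumes e: "integrable lborel e" and k: "0 \<le> k" and t: "0 \<le> t"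
    and E: "integrable lborel E"
    and le: "\<And>s. s \<in> {0..t} \<Longrightarrow> E s \<le> (LINT r:{0..s}|lborel. e r)"
  shows "exp (- k * t) * E t + k * (LINT s:{0..t}|lborel. exp (- k * s) * E s) \<le> (LINT s:{0..t}|lborel. exp (- k * s) * e s)"
proof -
  have [measurable]: "e \<in> borel_measurable lborel" "E \<in> borel_measurable lborel" using e E by auto
  have iw: "set_integrable lborel {0..t} (\<lambda>s. exp (- k * s) * f s)" if "integrable lborel f" for f
    unfolding set_integrable_def
  proof (rule Bochner_Integration.integrable_bound[OF that])
    have [measurable]: "f \<in> borel_measurable lborel" using that by auto
    show "(\<lambda>s. indicator {0..t} s *\<^sub>R (exp (- k * s) * f s)) \<in> borel_measurable lborel" by measurable
    show "AE s in lborel. norm (indicator {0..t} s *\<^sub>R (exp (- k * s) * f s)) \<le> norm (f s)"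
      using k by (auto simp: abs_mult mult_left_le_one_le split: split_indicator)
  qed
  have set_i: "set_integrable lborel {a..b} e" for a b
    using integrable_mult_indicator[OF _ e, of "{a..b}"] by (simp add: set_integrable_def)
  define N where "N s = (LINT r:{0..s}|lborel. e r)" for s
  \<comment> \<open>Together with the weight \<open>exp (- k * t)\<close> of the inequality at the
    final time, these weights add up to exactly \<open>exp (- k * r)\<close>.\<close>
  have kint: "(LINT s:{r..t}|lborel. k * exp (- k * s)) = exp (- k * r) - exp (- k * t)" if "r \<le> t" for r
    unfolding set_lebesgue_integral_def real_scaleR_def
    by (subst mult.commute, rule integral_FTC_Icc_real[where F="\<lambda>s. - exp (- k * s)", THEN trans])
      (use that in \<open>auto intro!: derivative_eq_intros continuous_intros\<close>)
  \<comment> \<open>The integrand on the triangle where r is at most s; its two iterated integrals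
    are computed in \<open>A\<close> and \<open>B\<close>.\<close>
  define f where "f s r = indicator {0..t} s * (indicator {0..s} r * (k * exp (- k * s) * e r))" for s r
  have [measurable]: "case_prod f \<in> borel_measurable (lborel \<Otimes>\<^sub>M lborel)"
  proof -
    \<comment> \<open>The indicator of \<open>{0..s}\<close> has a varying endpoint; written as a
      case distinction it is visibly jointly measurable.\<close>
    have "(\<lambda>(s, r). indicator {0..t} s * ((if 0 \<le> r \<and> r \<le> s then 1 else 0) * (k * exp (- k * s) * e r))) \<in> borel_measurable (lborel \<Otimes>\<^sub>M lborel)"
      by measurable
    then show ?thesis by (rule measurable_cong[THEN iffD1, rotated]) (auto simp: f_def split: split_indicator)
  qed
  have fi: "integrable (lborel \<Otimes>\<^sub>M lborel) (case_prod f)"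
  proof (rule Bochner_Integration.integrable_bound)
    \<comment> \<open>A majorant of product form: the constraint between r and s is dropped and the
      exponential is bounded by 1.\<close>
    have "integrable (lborel \<Otimes>\<^sub>M lborel) (\<lambda>(s, r). indicator {0..t} s * (k * \<bar>e r\<bar>))"
    proof (rule lborel_pair.Fubini_integrable)
      show "integrable lborel (\<lambda>s. LBINT r. norm (case (s, r) of (s, r) \<Rightarrow> indicator {0..t} s * (k * \<bar>e r\<bar>)))"
        using k integrable_real_indicator[of "{0..t}" lborel] by (simp add: abs_mult emeasure_lborel_Icc_eq)
      show "AE s in lborel. integrable lborel (\<lambda>r. case (s, r) of (s, r) \<Rightarrow> indicator {0..t} s * (k * \<bar>e r\<bar>))"
        using e by simp
    qed measurable
    then show "integrable (lborel \<Otimes>\<^sub>M lborel) (\<lambda>(s, r). indicator {0..t} s * (k * \<bar>e r\<bar>))" .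
    show "AE z in lborel \<Otimes>\<^sub>M lborel. norm (case_prod f z) \<le> norm (case z of (s, r) \<Rightarrow> indicator {0..t} s * (k * \<bar>e r\<bar>))"
      using k by (intro AE_I2) (auto simp: f_def abs_mult split: split_indicator intro!: mult_right_mono mult_left_le)
  qed measurable
  have A: "(LINT r|lborel. LINT s|lborel. f s r) = (LINT r:{0..t}|lborel. (exp (- k * r) - exp (- k * t)) * e r)"
    unfolding set_lebesgue_integral_def
  proof (rule Bochner_Integration.integral_cong[OF refl])
    fix r
    have "f s r = indicator {0..t} r * (indicator {r..t} s * (k * exp (- k * s))) * e r" for s
      by (auto simp: f_def split: split_indicator)
    then have "(LINT s|lborel. f s r) = indicator {0..t} r * (LINT s:{r..t}|lborel. k * exp (- k * s)) * e r"
      unfolding set_lebesgue_integral_def real_scaleR_def by (simp only: integral_mult_left_zero integral_mult_right_zero)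
    also have "\<dots> = indicator {0..t} r *\<^sub>R ((exp (- k * r) - exp (- k * t)) * e r)"
      using kint[of r] by (auto split: split_indicator)
    finally show "(LINT s|lborel. f s r) = \<dots>" .
  qed
  have B: "(LINT r|lborel. f s r) = indicator {0..t} s *\<^sub>R (k * exp (- k * s) * N s)" for s
  proof -
    have "f s r = indicator {0..t} s * (k * exp (- k * s)) * (indicator {0..s} r * e r)" for r
      by (simp add: f_def)
    then show ?thesis
      unfolding N_def set_lebesgue_integral_def real_scaleR_def
      by (simp only: integral_mult_right_zero mult.assoc)
  qed
  have iN: "set_integrable lborel {0..t} (\<lambda>s. k * exp (- k * s) * N s)"
    using lborel_pair.integrable_fst[OF fi] by (simp add: B set_integrable_def)
  have iE: "set_integrable lborel {0..t} (\<lambda>s. k * exp (- k * s) * E s)"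
    using set_integrable_mult_right[OF iw[OF E], of k] by (simp add: mult_ac)
  have "k * (LINT s:{0..t}|lborel. exp (- k * s) * E s) = (LINT s:{0..t}|lborel. k * exp (- k * s) * E s)"
    by (simp add: mult.assoc)
  also have "\<dots> \<le> (LINT s:{0..t}|lborel. k * exp (- k * s) * N s)"
    using le k by (intro set_integral_mono iN iE mult_left_mono) (auto simp: N_def)
  also have "\<dots> = (LINT r:{0..t}|lborel. (exp (- k * r) - exp (- k * t)) * e r)"
    using lborel_pair.integral_fst[OF fi] lborel_pair.integral_snd[OF fi] by (simp add: A B set_lebesgue_integral_def)
  also have "\<dots> = (LINT r:{0..t}|lborel. exp (- k * r) * e r) - exp (- k * t) * N t"
    using set_i[of 0 t] iw[OF e] by (simp add: left_diff_distrib set_integral_diff N_def)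
  finally have "exp (- k * t) * N t + k * (LINT s:{0..t}|lborel. exp (- k * s) * E s) \<le> (LINT s:{0..t}|lborel. exp (- k * s) * e s)"
    by simp
  moreover have "exp (- k * t) * E t \<le> exp (- k * t) * N t"
    using le[of t] t by (simp add: N_def)
  ultimately show ?thesis by linarith
qed

subsection \<open>Functions of one spatial variable\<close>

text \<open>Keeps the dimension in the form \<open>1\<close>, so that facts about
  \<open>Rn 1\<close>, \<open>lebn 1\<close> and \<open>{..<1}\<close> go on matching after
  simplification.\<close>

declare One_nat_def [simp del]

lemma lessThan_1_nat: "{..<1} = {0::nat}"
  by auto

text \<open>Points of \<open>Rn 1\<close> are extensional functions, so a real number corresponds to
  the constant function restricted to the single index 0.\<close>

abbreviation emb :: "real \<Rightarrow> nat \<Rightarrow> real" where "emb s \<equiv> (\<lambda>i\<in>{..<1}. s)"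

lemma space_lebn: "space (lebn n) = Rn n"
  by (simp add: lebn_def Rn_def space_PiM)

lemma sigma_finite_lebn: "sigma_finite_measure (lebn n)"
proof -
  interpret finite_product_sigma_finite "\<lambda>_. lborel :: real measure" "{..<n}" by standard simp
  show ?thesis unfolding lebn_def ..
qed

lemma emb_Rn: "emb s \<in> Rn 1"
  by (auto simp: Rn_def)

lemma Rn1_eq_emb: "x \<in> Rn 1 \<Longrightarrow> x = emb (x 0)"
  by (auto simp: Rn_def PiE_def extensional_def restrict_def fun_eq_iff)

lemma distn_1: "distn 1 x y = \<bar>x 0 - y 0\<bar>"
  by (simp add: distn_def lessThan_1_nat)

lemma measurable_lebn_component: "(\<lambda>x. x 0) \<in> borel_measurable (lebn 1)"
proof -
  have "(\<lambda>x. x (0::nat)) \<in> measurable (PiM {..<1} (\<lambda>_. lborel :: real measure)) lborel"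
    by (rule measurable_component_singleton) simp
  then show ?thesis by (simp add: lebn_def)
qed

lemma distr_lebn_1: "distr (lebn 1) lborel (\<lambda>x. x 0) = lborel"
proof -
  interpret product_sigma_finite "\<lambda>_. lborel :: real measure" ..
  have "distr (PiM {0::nat} (\<lambda>_. lborel :: real measure)) lborel (\<lambda>x. x 0) = lborel"
    by (rule distr_singleton)
  then show ?thesis by (simp add: lebn_def lessThan_1_nat)
qed

text \<open>Reading off coordinate 0 carries the one-fold product measure to Lebesgue measure on the
  reals; this transfers all spatial integrals to one real variable.\<close>

lemma lebn_1_integral:
  fixes h :: "real \<Rightarrow> real"
  assumes "h \<in> borel_measurable borel"
  shows "integrable (lebn 1) (\<lambda>x. h (x 0)) \<longleftrightarrow> integrable lborel h"
    and "(\<integral>x. h (x 0) \<partial>lebn 1) = (\<integral>s. h s \<partial>lborel)"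
  using measurable_lebn_component integrable_distr_eq[of "\<lambda>x. x 0" "lebn 1" lborel h] integral_distr[of "\<lambda>x. x 0" "lebn 1" lborel h] assms
  by (simp_all add: distr_lebn_1)

lemma set_integral_Rn: "(LINT x:Rn n|lebn n. f x) = (\<integral>x. f x \<partial>lebn n)" for f :: "_ \<Rightarrow> real"
  unfolding set_lebesgue_integral_def
  by (intro Bochner_Integration.integral_cong) (auto simp: space_lebn)

lemma sqn_Rn: "sqn n (Rn n) g = (\<integral>x. (g x)\<^sup>2 \<partial>lebn n)"
  by (simp add: sqn_def set_integral_Rn)

lemma ipD_Rn: "ipD n (Rn n) g h = (\<integral>x. g x * h x \<partial>lebn n)"
  by (simp add: ipD_def set_integral_Rn)

lemma L2D_Rn: "L2D n (Rn n) g \<longleftrightarrow> sq_int (lebn n) g"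
proof -
  have "integrable (lebn n) (\<lambda>x. indicator (Rn n) x *\<^sub>R (g x)\<^sup>2) \<longleftrightarrow> integrable (lebn n) (\<lambda>x. (g x)\<^sup>2)"
    by (intro Bochner_Integration.integrable_cong) (auto simp: space_lebn)
  then show ?thesis by (simp add: L2D_def sq_int_def set_integrable_def)
qed

text \<open>Passing from the open to the closed time interval changes a null set only. Measurability
  of \<open>g\<close> stays a separate conjunct because that of the truncated function does not
  imply it.\<close>

lemma L2Q_Rn:
  "L2Q n (Rn n) T g \<longleftrightarrow> (\<lambda>(x, s). g x s) \<in> borel_measurable (lebn n \<Otimes>\<^sub>M lborel) \<and>
     sq_int (lebn n \<Otimes>\<^sub>M lborel) (\<lambda>(x, s). indicator {0..T} s * g x s)"
proof (cases "(\<lambda>(x, s). g x s) \<in> borel_measurable (lebn n \<Otimes>\<^sub>M lborel)")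
  case True
  interpret sigma_finite_measure "lebn n" by (rule sigma_finite_lebn)
  interpret P: pair_sigma_finite "lebn n" "lborel :: real measure" ..
  note [measurable] = True
  have ae: "AE z in lebn n \<Otimes>\<^sub>M lborel. snd z \<noteq> 0 \<and> snd z \<noteq> T"
  proof (rule P.AE_pair_measure)
    show "{x \<in> space (lebn n \<Otimes>\<^sub>M lborel). snd x \<noteq> 0 \<and> snd x \<noteq> T} \<in> sets (lebn n \<Otimes>\<^sub>M lborel)"
      by measurable
    show "AE x in lebn n. AE y in lborel. snd (x, y) \<noteq> 0 \<and> snd (x, y) \<noteq> T"
      by (rule AE_I2) (simp add: AE_lborel_singleton)
  qed
  have "integrable (lebn n \<Otimes>\<^sub>M lborel) (\<lambda>z. indicator (Rn n \<times> {0<..<T}) z *\<^sub>R (g (fst z) (snd z))\<^sup>2) \<longleftrightarrow>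
    integrable (lebn n \<Otimes>\<^sub>M lborel) (\<lambda>z. (case z of (x, s) \<Rightarrow> indicator {0..T} s * g x s)\<^sup>2)"
  proof (rule integrable_cong_AE)
    have "(\<lambda>z. indicator {0<..<T} (snd z) *\<^sub>R (g (fst z) (snd z))\<^sup>2) \<in> borel_measurable (lebn n \<Otimes>\<^sub>M lborel)"
      using True by (simp add: case_prod_beta')
    then show "(\<lambda>z. indicator (Rn n \<times> {0<..<T}) z *\<^sub>R (g (fst z) (snd z))\<^sup>2) \<in> borel_measurable (lebn n \<Otimes>\<^sub>M lborel)"
      by (rule measurable_cong[THEN iffD1, rotated]) (auto simp: space_pair_measure space_lebn split: split_indicator)
    show "AE z in lebn n \<Otimes>\<^sub>M lborel. indicator (Rn n \<times> {0<..<T}) z *\<^sub>R (g (fst z) (snd z))\<^sup>2 =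
      (case z of (x, s) \<Rightarrow> indicator {0..T} s * g x s)\<^sup>2"
      using ae AE_space by eventually_elim (auto simp: space_pair_measure space_lebn indicator_def)
  qed measurable
  moreover have "(\<lambda>(x, s). indicator {0..T} s * g x s) \<in> borel_measurable (lebn n \<Otimes>\<^sub>M lborel)"
    by measurable
  ultimately show ?thesis
    using True by (simp add: L2Q_def set_integrable_def sq_int_def case_prod_beta')
qed (simp add: L2Q_def case_prod_beta')

lemma integrable_continuous_support:
  fixes f :: "real \<Rightarrow> real"
  assumes "continuous_on UNIV f" "\<And>s. \<bar>s\<bar> > R \<Longrightarrow> f s = 0"
  shows "integrable lborel f"
proof -
  have "set_integrable lborel {-R..R} f"
    by (intro borel_integrable_atLeastAtMost' continuous_on_subset[OF assms(1)]) auto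
  moreover have "(\<lambda>s. indicator {-R..R} s *\<^sub>R f s) = f"
    using assms(2) by (auto simp: fun_eq_iff abs_le_iff not_le[symmetric] split: split_indicator)
  ultimately show ?thesis by (simp only: set_integrable_def)
qed

lemma pdiff_emb: "x \<in> Rn 1 \<Longrightarrow> pdiff 0 \<psi> x = deriv (\<lambda>s. \<psi> (emb s)) (x 0)"
proof -
  assume "x \<in> Rn 1"
  then have "x(0 := s) = emb s" for s
    by (auto simp: Rn_def PiE_def extensional_def restrict_def fun_eq_iff)
  then show ?thesis by (simp add: pdiff_def)
qed

lemma cont_Rn_1: "cont_Rn 1 g \<longleftrightarrow> continuous_on UNIV (\<lambda>s. g (emb s))"
proof -
  have "(\<forall>x\<in>Rn 1. P x) \<longleftrightarrow> (\<forall>s. P (emb s))" for P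
    using Rn1_eq_emb emb_Rn by metis
  then show ?thesis
    by (simp add: cont_Rn_def continuous_on_iff distn_1 dist_real_def abs_minus_commute)
qed

section \<open>Test functions as functions of one real variable\<close>

lemma DERIV_zero_outside:
  fixes g g' :: "real \<Rightarrow> real"
  assumes "\<And>s. (g has_real_derivative g' s) (at s)" "\<And>s. \<bar>s\<bar> > R \<Longrightarrow> g s = 0" "\<bar>s\<bar> > R"
  shows "g' s = 0"
proof -
  have "open {s::real. \<bar>s\<bar> > R}" by (intro open_Collect_less continuous_intros)
  then have "((\<lambda>_. 0) has_real_derivative g' s) (at s)"
    using assms by (subst DERIV_cong_ev[OF refl _ refl, of _ g]) (auto intro!: eventually_mono[OF eventually_nhds_in_open])
  then show ?thesis using DERIV_const DERIV_unique by blast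
qed

text \<open>What the energy argument and integration by parts ask of a test function: it is
  continuously differentiable and vanishes, together with its derivative, outside a bounded
  interval.\<close>

lemma test_fun_real:
  assumes "test_fun 1 D \<psi>"
  obtains R where "continuous_on UNIV (\<lambda>s. \<psi> (emb s))"
    "\<And>s. ((\<lambda>s. \<psi> (emb s)) has_real_derivative deriv (\<lambda>s. \<psi> (emb s)) s) (at s)"
    "continuous_on UNIV (deriv (\<lambda>s. \<psi> (emb s)))"
    "\<And>s. \<bar>s\<bar> > R \<Longrightarrow> \<psi> (emb s) = 0" "\<And>s. \<bar>s\<bar> > R \<Longrightarrow> deriv (\<lambda>s. \<psi> (emb s)) s = 0"
proof -
  let ?g = "\<lambda>s. \<psi> (emb s)"
  have C1: "Ck_Rn 1 1 \<psi>" using assms by (simp add: test_fun_def)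
  have C1': "cont_Rn 1 (pdiffs is \<psi>)" if "set is \<subseteq> {..<1}" "length is \<le> 1" for "is"
    using C1 that unfolding Ck_Rn_def by blast
  have c: "continuous_on UNIV ?g" "continuous_on UNIV (deriv ?g)"
    using C1'[of "[]"] C1'[of "[0]"]
    by (simp_all add: cont_Rn_1 pdiff_emb emb_Rn)
  have "\<forall>x\<in>Rn 1. (\<lambda>s. pdiffs [] \<psi> (x(0 := s))) differentiable (at (x 0))"
    using C1 unfolding Ck_Rn_def by force
  then have "(\<lambda>s. \<psi> ((emb a)(0 := s))) differentiable (at a)" for a
    using emb_Rn[of a] by force
  moreover have "(emb a)(0 := s) = emb s" for a s by (auto simp: restrict_def)
  ultimately have "?g differentiable (at a)" for a by simp
  then have d: "(?g has_real_derivative deriv ?g s) (at s)" for s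
    by (simp add: DERIV_deriv_iff_real_differentiable)
  obtain R where R: "\<And>x i. x \<in> closure_Rn 1 {x \<in> Rn 1. \<psi> x \<noteq> 0} \<Longrightarrow> i < 1 \<Longrightarrow> \<bar>x i\<bar> \<le> R"
    using assms unfolding test_fun_def bounded_Rn_def by blast
  have z: "?g s = 0" if "\<bar>s\<bar> > R" for s
  proof (rule ccontr)
    assume "?g s \<noteq> 0"
    then have "emb s \<in> closure_Rn 1 {x \<in> Rn 1. \<psi> x \<noteq> 0}"
      using emb_Rn[of s] by (auto simp: closure_Rn_def distn_1 intro!: bexI[of _ "emb s"])
    from R[OF this, of 0] that show False by simp
  qed
  have z': "deriv ?g s = 0" if "\<bar>s\<bar> > R" for s
    by (rule DERIV_zero_outside[OF d z that])
  show ?thesis using that[OF c(1) d c(2) z z'] .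
qed

lemma sq_int_lebn_1:
  assumes "continuous_on UNIV g" "\<And>s. \<bar>s\<bar> > R \<Longrightarrow> g s = 0" "\<And>x. x \<in> Rn 1 \<Longrightarrow> \<psi> x = g (x 0)"
  shows "sq_int (lebn 1) \<psi>"
proof -
  note [measurable] = measurable_lebn_component borel_measurable_continuous_onI[OF assms(1)]
  have "integrable lborel (\<lambda>s. (g s)\<^sup>2)"
    using assms by (intro integrable_continuous_support[of _ R] continuous_intros) auto
  then have "sq_int (lebn 1) (\<lambda>x. g (x 0))"
    using lebn_1_integral(1)[of "\<lambda>s. (g s)\<^sup>2"] by (auto simp: sq_int_def)
  moreover have eq: "\<psi> x = g (x 0)" if "x \<in> space (lebn 1)" for x
    using assms(3) that by (simp add: space_lebn)
  ultimately show ?thesis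
    unfolding sq_int_def using measurable_cong[of "lebn 1" \<psi> "\<lambda>x. g (x 0)" borel]
      Bochner_Integration.integrable_cong[of "lebn 1" "lebn 1" "\<lambda>x. (\<psi> x)\<^sup>2" "\<lambda>x. (g (x 0))\<^sup>2"]
    by (simp add: eq)
qed

lemma test_fun_sq_int:
  assumes "test_fun 1 D \<psi>"
  shows "sq_int (lebn 1) \<psi>" "sq_int (lebn 1) (pdiff 0 \<psi>)"
proof -
  from test_fun_real[OF assms] obtain R where R: "continuous_on UNIV (\<lambda>s. \<psi> (emb s))"
    "continuous_on UNIV (deriv (\<lambda>s. \<psi> (emb s)))"
    "\<And>s. \<bar>s\<bar> > R \<Longrightarrow> \<psi> (emb s) = 0" "\<And>s. \<bar>s\<bar> > R \<Longrightarrow> deriv (\<lambda>s. \<psi> (emb s)) s = 0" by metis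
  show "sq_int (lebn 1) \<psi>"
    using R by (intro sq_int_lebn_1[where g="\<lambda>s. \<psi> (emb s)" and R=R]) (auto dest: Rn1_eq_emb)
  show "sq_int (lebn 1) (pdiff 0 \<psi>)"
    using R by (intro sq_int_lebn_1[where g="deriv (\<lambda>s. \<psi> (emb s))" and R=R]) (auto simp: pdiff_emb)
qed

text \<open>By Cauchy-Schwarz, pairings converge under L2 convergence of one factor; this passes the
  weak identity from test functions to \<open>u\<close> at a fixed time.\<close>

lemma tendsto_integral_mult:
  assumes a: "sq_int M a" and v: "\<And>k. sq_int M (v k)" and w: "sq_int M w"
    and lim: "(\<lambda>k. \<integral>x. (v k x - w x)\<^sup>2 \<partial>M) \<longlonglongrightarrow> 0"
  shows "(\<lambda>k. \<integral>x. a x * v k x \<partial>M) \<longlonglongrightarrow> (\<integral>x. a x * w x \<partial>M)"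
proof (rule LIM_zero_cancel, rule Lim_null_comparison[OF always_eventually])
  show "\<forall>k. norm ((\<integral>x. a x * v k x \<partial>M) - (\<integral>x. a x * w x \<partial>M)) \<le>
     sqrt (\<integral>x. (a x)\<^sup>2 \<partial>M) * sqrt (\<integral>x. (v k x - w x)\<^sup>2 \<partial>M)"
  proof
    fix k
    have "(\<integral>x. a x * v k x \<partial>M) - (\<integral>x. a x * w x \<partial>M) = (\<integral>x. a x * (v k x - w x) \<partial>M)"
      using sq_int_integrable_mult[OF a v[of k]] sq_int_integrable_mult[OF a w] by (simp add: right_diff_distrib)
    with abs_integral_Cauchy_Schwarz[OF a sq_int_diff[OF v[of k] w]]
    show "norm ((\<integral>x. a x * v k x \<partial>M) - (\<integral>x. a x * w x \<partial>M)) \<le>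
     sqrt (\<integral>x. (a x)\<^sup>2 \<partial>M) * sqrt (\<integral>x. (v k x - w x)\<^sup>2 \<partial>M)" by simp
  qed
  show "(\<lambda>k. sqrt (\<integral>x. (a x)\<^sup>2 \<partial>M) * sqrt (\<integral>x. (v k x - w x)\<^sup>2 \<partial>M)) \<longlonglongrightarrow> 0"
    using tendsto_mult[OF tendsto_const tendsto_real_sqrt[OF lim]] by simp
qed

subsection \<open>Upper bound\<close>

text \<open>\<open>minv\<close> is a Hilbert choice and determined only on indices below the
  dimension; there the defining equation fixes its single entry.\<close>

lemma minv_1: "minv 1 (\<lambda>_ _. 1) 0 0 = 1"
proof -
  have "\<forall>i<1. \<forall>j<1. (\<Sum>k<1. minv 1 (\<lambda>_ _. 1) i k * 1) = (if i = j then 1 else 0)"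
    unfolding minv_def by (rule someI[of _ "\<lambda>_ _. 1"]) (simp add: lessThan_1_nat)
  then show ?thesis by (simp add: lessThan_1_nat)
qed

text \<open>Reduces to \<open>energy_inequality\<close>. The substantial hypothesis is that
  \<open>u\<close> at almost every time may serve as its own test function; this follows from the
  approximating test functions contained in \<open>H10\<close>.\<close>

lemma heat_energy_estimate:
  assumes T: "0 < T" and F: "L2Q 1 (Rn 1) T F" and F0: "L2Q 1 (Rn 1) T F0"
    and sol: "weak_sol 1 (Rn 1) T (\<lambda>_ _ _ _. 1) (\<lambda>_ _ _. 0) (\<lambda>_ _. 0) (\<lambda>_. F) F0 u"
    and t: "t \<in> {0..T}"
  shows "(\<integral>x. (u x t)\<^sup>2 \<partial>lebn 1) \<le>
     (LINT r:{0..t}|lborel. (\<integral>x. (F x r)\<^sup>2 \<partial>lebn 1) / 2 + (\<integral>x. (F0 x r)\<^sup>2 \<partial>lebn 1) + (\<integral>x. (u x r)\<^sup>2 \<partial>lebn 1))"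
proof -
  note sf = sigma_finite_lebn[of 1]
  interpret sigma_finite_measure "lebn 1" by (rule sf)
  interpret P: pair_sigma_finite "lebn 1" "lborel :: real measure" ..
  \<comment> \<open>The hypotheses control the functions on the time interval only; truncation makes
    them square-integrable over all times.\<close>
  define cut where "cut A x s = indicator {0..T} s * A x s" for A :: "(nat \<Rightarrow> real) \<Rightarrow> real \<Rightarrow> real" and x s
  have cut_eq: "cut A x s = A x s" if "s \<in> {0..T}" for A x s using that by (simp add: cut_def)
  have cutQ: "sq_int (lebn 1 \<Otimes>\<^sub>M lborel) (case_prod (cut A))" if "L2Q 1 (Rn 1) T A" for A
    using that unfolding L2Q_Rn cut_def by (simp add: case_prod_beta')
  obtain G where u: "L2Q 1 (Rn 1) T u" and G: "L2Q 1 (Rn 1) T (G 0)"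
    and H: "AE t in lborel. t \<in> {0<..<T} \<longrightarrow> H10 1 (Rn 1) (\<lambda>x. u x t) (\<lambda>i x. G i x t)"
    and c: "\<And>t. t \<in> {0..T} \<Longrightarrow> L2D 1 (Rn 1) (\<lambda>x. u x t)"
      "\<And>t. t \<in> {0..T} \<Longrightarrow> ((\<lambda>s. sqn 1 (Rn 1) (\<lambda>x. u x s - u x t)) \<longlongrightarrow> 0) (at t within {0..T})"
    and i: "sqn 1 (Rn 1) (\<lambda>x. u x 0) = 0"
    and w: "\<And>\<psi> t. test_fun 1 (Rn 1) \<psi> \<Longrightarrow> t \<in> {0..T} \<Longrightarrow> (\<integral>x. u x t * \<psi> x \<partial>lebn 1) =
       (LINT s:{0..t}|lborel. \<integral>x. - (G 0 x s * pdiff 0 \<psi> x) - F x s * pdiff 0 \<psi> x + F0 x s * \<psi> x \<partial>lebn 1)"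
    using sol unfolding weak_sol_def ipD_Rn set_integral_Rn by (auto simp: lessThan_1_nat)
  note cu = cutQ[OF u] and cG = cutQ[OF G] and cF = cutQ[OF F] and cF0 = cutQ[OF F0]
  have cGF: "sq_int (lebn 1 \<Otimes>\<^sub>M lborel) (\<lambda>(x, r). cut (G 0) x r + cut F x r)"
    using sq_int_add[OF cG cF] by (simp add: case_prod_beta')
  \<comment> \<open>With the time integral moved inside the pairing, both sides are continuous in
    \<open>\<psi>\<close> and its derivative with respect to L2 convergence.\<close>
  have wt: "(\<integral>x. u x t * \<psi> x \<partial>lebn 1) =
      (\<integral>x. \<psi> x * (LINT r:{0..t}|lborel. cut F0 x r) \<partial>lebn 1)
      - (\<integral>x. pdiff 0 \<psi> x * (LINT r:{0..t}|lborel. cut (G 0) x r + cut F x r) \<partial>lebn 1)"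
    if \<psi>: "test_fun 1 (Rn 1) \<psi>" and t: "t \<in> {0..T}" for \<psi> t
  proof -
    note sq = test_fun_sq_int[OF \<psi>]
    note p0 = time_integral_pairing[OF sf cF0 sq(1), of 0 t] and p1 = time_integral_pairing[OF sf cGF sq(2), of 0 t]
    have "(LINT s:{0..t}|lborel. \<integral>x. - (G 0 x s * pdiff 0 \<psi> x) - F x s * pdiff 0 \<psi> x + F0 x s * \<psi> x \<partial>lebn 1)
      = (LINT r:{0..t}|lborel. (\<integral>x. \<psi> x * cut F0 x r \<partial>lebn 1) - (\<integral>x. pdiff 0 \<psi> x * (cut (G 0) x r + cut F x r) \<partial>lebn 1))"
      unfolding set_lebesgue_integral_def
    proof (rule integral_cong_AE)
      have [measurable]: "(\<lambda>(x, s). G 0 x s) \<in> borel_measurable (lebn 1 \<Otimes>\<^sub>M lborel)"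
        "(\<lambda>(x, s). F x s) \<in> borel_measurable (lebn 1 \<Otimes>\<^sub>M lborel)"
        "(\<lambda>(x, s). F0 x s) \<in> borel_measurable (lebn 1 \<Otimes>\<^sub>M lborel)"
        "\<psi> \<in> borel_measurable (lebn 1)" "pdiff 0 \<psi> \<in> borel_measurable (lebn 1)"
        using G F F0 sq by (auto simp: L2Q_Rn sq_int_def)
      show "(\<lambda>s. indicator {0..t} s *\<^sub>R (\<integral>x. - (G 0 x s * pdiff 0 \<psi> x) - F x s * pdiff 0 \<psi> x + F0 x s * \<psi> x \<partial>lebn 1)) \<in> borel_measurable lborel"
        by measurable
      show "(\<lambda>r. indicator {0..t} r *\<^sub>R ((\<integral>x. \<psi> x * cut F0 x r \<partial>lebn 1) - (\<integral>x. pdiff 0 \<psi> x * (cut (G 0) x r + cut F x r) \<partial>lebn 1))) \<in> borel_measurable lborel"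
        using set_integral_diff(1)[OF p0(1) p1(1)] by (auto simp: set_integrable_def dest: borel_measurable_integrable)
      show "AE s in lborel. indicator {0..t} s *\<^sub>R (\<integral>x. - (G 0 x s * pdiff 0 \<psi> x) - F x s * pdiff 0 \<psi> x + F0 x s * \<psi> x \<partial>lebn 1)
        = indicator {0..t} s *\<^sub>R ((\<integral>x. \<psi> x * cut F0 x s \<partial>lebn 1) - (\<integral>x. pdiff 0 \<psi> x * (cut (G 0) x s + cut F x s) \<partial>lebn 1))"
        using P.sq_int_section_snd[OF cG] P.sq_int_section_snd[OF cF] P.sq_int_section_snd[OF cF0]
      proof eventually_elim
        case (elim s)
        show ?case
        proof (cases "s \<in> {0..t}")
          case True
          with t have s: "s \<in> {0..T}" by auto
          note eq = cut_eq[OF s]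
          have "(\<integral>x. - (G 0 x s * pdiff 0 \<psi> x) - F x s * pdiff 0 \<psi> x + F0 x s * \<psi> x \<partial>lebn 1)
            = (\<integral>x. \<psi> x * F0 x s - pdiff 0 \<psi> x * (G 0 x s + F x s) \<partial>lebn 1)"
            by (rule arg_cong[where f="integral\<^sup>L _"]) (auto simp: algebra_simps)
          also have "\<dots> = (\<integral>x. \<psi> x * F0 x s \<partial>lebn 1) - (\<integral>x. pdiff 0 \<psi> x * (G 0 x s + F x s) \<partial>lebn 1)"
            using elim unfolding eq by (intro Bochner_Integration.integral_diff sq_int_integrable_mult sq sq_int_add)
          finally show ?thesis by (simp add: eq)
        qed simp
      qed
    qed
    also have "\<dots> = (LINT r:{0..t}|lborel. \<integral>x. \<psi> x * cut F0 x r \<partial>lebn 1) - (LINT r:{0..t}|lborel. \<integral>x. pdiff 0 \<psi> x * (cut (G 0) x r + cut F x r) \<partial>lebn 1)"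
      by (rule set_integral_diff[OF p0(1) p1(1)])
    finally show ?thesis unfolding w[OF \<psi> t] by (simp only: p0(2) p1(2))
  qed
  \<comment> \<open>\<open>H10\<close> is given on the open interval, whereas the identity below is
    stated on the closed one; the two endpoints are null.\<close>
  have ae: "AE \<sigma> in lborel. \<sigma> \<noteq> 0 \<and> \<sigma> \<noteq> T"
    by (simp add: AE_lborel_singleton)
  have weak: "AE \<sigma> in lborel. \<sigma> \<in> {0..T} \<longrightarrow> (\<forall>t\<in>{0..T}. (\<integral>x. cut u x t * cut u x \<sigma> \<partial>lebn 1) =
      (LINT r:{0..t}|lborel. (\<integral>x. cut u x \<sigma> * cut F0 x r \<partial>lebn 1) - (\<integral>x. cut (G 0) x \<sigma> * (cut (G 0) x r + cut F x r) \<partial>lebn 1)))"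
    using H ae
  proof eventually_elim
    case (elim \<sigma>)
    show ?case
    proof (intro impI ballI)
      fix t assume \<sigma>: "\<sigma> \<in> {0..T}" and t: "t \<in> {0..T}"
      with elim have "H10 1 (Rn 1) (\<lambda>x. u x \<sigma>) (\<lambda>i x. G i x \<sigma>)" by auto
      then obtain \<psi> where sq: "sq_int (lebn 1) (\<lambda>x. u x \<sigma>)" "sq_int (lebn 1) (\<lambda>x. G 0 x \<sigma>)"
        and \<psi>: "\<And>k. test_fun 1 (Rn 1) (\<psi> k)"
        and l0: "(\<lambda>k. \<integral>x. (\<psi> k x - u x \<sigma>)\<^sup>2 \<partial>lebn 1) \<longlonglongrightarrow> 0"
        and l1: "(\<lambda>k. \<integral>x. (pdiff 0 (\<psi> k) x - G 0 x \<sigma>)\<^sup>2 \<partial>lebn 1) \<longlonglongrightarrow> 0"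
        unfolding H10_def L2D_Rn sqn_Rn by (auto simp: lessThan_1_nat)
      note tsq = test_fun_sq_int[OF \<psi>]
      have t0: "0 \<le> t" using t by simp
      note h0 = sq_int_time_integral(1)[OF sf cF0 t0] and h1 = sq_int_time_integral(1)[OF sf cGF t0]
      have ut: "sq_int (lebn 1) (\<lambda>x. u x t)" using c(1)[OF t] by (simp add: L2D_Rn)
      have L1: "(\<lambda>k. \<integral>x. u x t * \<psi> k x \<partial>lebn 1) \<longlonglongrightarrow> (\<integral>x. u x t * u x \<sigma> \<partial>lebn 1)"
        by (rule tendsto_integral_mult[OF ut tsq(1) sq(1) l0])
      have "(\<lambda>k. (\<integral>x. (LINT r:{0..t}|lborel. cut F0 x r) * \<psi> k x \<partial>lebn 1)
          - (\<integral>x. (LINT r:{0..t}|lborel. cut (G 0) x r + cut F x r) * pdiff 0 (\<psi> k) x \<partial>lebn 1))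
        \<longlonglongrightarrow> (\<integral>x. (LINT r:{0..t}|lborel. cut F0 x r) * u x \<sigma> \<partial>lebn 1)
          - (\<integral>x. (LINT r:{0..t}|lborel. cut (G 0) x r + cut F x r) * G 0 x \<sigma> \<partial>lebn 1)"
        by (intro tendsto_diff tendsto_integral_mult h0 h1 tsq sq l0 l1)
      then have L2: "(\<lambda>k. \<integral>x. u x t * \<psi> k x \<partial>lebn 1)
        \<longlonglongrightarrow> (\<integral>x. (LINT r:{0..t}|lborel. cut F0 x r) * u x \<sigma> \<partial>lebn 1)
          - (\<integral>x. (LINT r:{0..t}|lborel. cut (G 0) x r + cut F x r) * G 0 x \<sigma> \<partial>lebn 1)"
        unfolding wt[OF \<psi> t] by (simp only: mult.commute)
      note p0 = time_integral_pairing[OF sf cF0 sq(1), of 0 t] and p1 = time_integral_pairing[OF sf cGF sq(2), of 0 t]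
      have "(\<integral>x. u x t * u x \<sigma> \<partial>lebn 1) = (\<integral>x. u x \<sigma> * (LINT r:{0..t}|lborel. cut F0 x r) \<partial>lebn 1)
          - (\<integral>x. G 0 x \<sigma> * (LINT r:{0..t}|lborel. cut (G 0) x r + cut F x r) \<partial>lebn 1)"
        using LIMSEQ_unique[OF L1 L2] by (simp only: mult.commute)
      also have "\<dots> = (LINT r:{0..t}|lborel. (\<integral>x. u x \<sigma> * cut F0 x r \<partial>lebn 1) - (\<integral>x. G 0 x \<sigma> * (cut (G 0) x r + cut F x r) \<partial>lebn 1))"
        by (simp only: set_integral_diff[OF p0(1) p1(1)] p0(2) p1(2))
      finally show "(\<integral>x. cut u x t * cut u x \<sigma> \<partial>lebn 1) =
        (LINT r:{0..t}|lborel. (\<integral>x. cut u x \<sigma> * cut F0 x r \<partial>lebn 1) - (\<integral>x. cut (G 0) x \<sigma> * (cut (G 0) x r + cut F x r) \<partial>lebn 1))"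
        by (simp only: cut_eq[OF \<sigma>] cut_eq[OF t])
    qed
  qed
  have "(\<integral>x. (cut u x t)\<^sup>2 \<partial>lebn 1) \<le>
     (LINT r:{0..t}|lborel. (\<integral>x. (cut F x r)\<^sup>2 \<partial>lebn 1) / 2 + (\<integral>x. (cut F0 x r)\<^sup>2 \<partial>lebn 1) + (\<integral>x. (cut u x r)\<^sup>2 \<partial>lebn 1))"
  proof (rule energy_inequality[OF sf T cu cG cF cF0 _ _ _ weak t])
    show "sq_int (lebn 1) (\<lambda>x. cut u x t)" if "t \<in> {0..T}" for t
      using c(1)[OF that] that by (simp add: cut_eq L2D_Rn)
    show "((\<lambda>s. \<integral>x. (cut u x s - cut u x t)\<^sup>2 \<partial>lebn 1) \<longlongrightarrow> 0) (at t within {0..T})" if "t \<in> {0..T}" for t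
      using c(2)[OF that] unfolding sqn_Rn
    proof (rule Lim_transform_eventually)
      show "\<forall>\<^sub>F s in at t within {0..T}. (\<integral>x. (u x s - u x t)\<^sup>2 \<partial>lebn 1) = (\<integral>x. (cut u x s - cut u x t)\<^sup>2 \<partial>lebn 1)"
        using that by (auto simp: eventually_at_filter cut_eq)
    qed
    show "(\<integral>x. (cut u x 0)\<^sup>2 \<partial>lebn 1) = 0"
      using i T by (simp add: sqn_Rn cut_eq)
  qed
  also have "\<dots> = (LINT r:{0..t}|lborel. (\<integral>x. (F x r)\<^sup>2 \<partial>lebn 1) / 2 + (\<integral>x. (F0 x r)\<^sup>2 \<partial>lebn 1) + (\<integral>x. (u x r)\<^sup>2 \<partial>lebn 1))"
    using t by (intro set_lebesgue_integral_cong) (auto simp: cut_eq)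
  finally show ?thesis using t by (simp add: cut_eq)
qed

text \<open>With weight exponent \<open>k = 2 K = M + 1\<close>, the term with factor
  \<open>k\<close> on the left covers both the required \<open>M\<close>-term and the unit multiple
  of the norm of \<open>u\<close> produced by the pairing with \<open>F0\<close>. The constant
  \<open>c0\<close> is 1.\<close>

lemma C1_heat_le:
  assumes T: "0 < T" and M: "0 \<le> M"
  shows "C1 1 (Rn 1) T (\<lambda>_ _ _ _. 1) (\<lambda>_ _ _. 0) (\<lambda>_ _. 0) ((M + 1) / 2) M \<le> ereal (1 / 2)"
proof -
  have "exp (- 2 * ((M + 1) / 2) * t) * sqn 1 (Rn 1) (\<lambda>x. u x t)
        + M * (LINT s:{0..t}|lborel. exp (- 2 * ((M + 1) / 2) * s) * sqn 1 (Rn 1) (\<lambda>x. u x s))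
      \<le> 1 / 2 * (LINT s:{0..t}|lborel. exp (- 2 * ((M + 1) / 2) * s) *
          (LINT x:Rn 1|lebn 1. (\<Sum>i<1. \<Sum>j<1. F i x s * minv 1 (\<lambda>_ _. 1) i j * F j x s)))
        + 1 * (LINT s:{0..t}|lborel. exp (- 2 * ((M + 1) / 2) * s) * sqn 1 (Rn 1) (\<lambda>x. F0 x s))"
    if F: "\<forall>i<1. L2Q 1 (Rn 1) T (F i)" and F0: "L2Q 1 (Rn 1) T F0"
      and sol: "weak_sol 1 (Rn 1) T (\<lambda>_ _ _ _. 1) (\<lambda>_ _ _. 0) (\<lambda>_ _. 0) F F0 u" and t: "t \<in> {0<..T}"
    for F F0 u t
  proof -
    note sf = sigma_finite_lebn[of 1]
    interpret sigma_finite_measure "lebn 1" by (rule sf)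
    interpret P: pair_sigma_finite "lebn 1" "lborel :: real measure" ..
    have F': "L2Q 1 (Rn 1) T (F 0)" using F by simp
    have sol': "weak_sol 1 (Rn 1) T (\<lambda>_ _ _ _. 1) (\<lambda>_ _ _. 0) (\<lambda>_ _. 0) (\<lambda>_. F 0) F0 u"
      using sol unfolding weak_sol_def by (simp add: lessThan_1_nat)
    have u: "L2Q 1 (Rn 1) T u" using sol unfolding weak_sol_def by blast
    \<comment> \<open>The truncated squared norms are integrable on the whole line, as
      \<open>exponential_weight_integral\<close> expects.\<close>
    define n where "n A s = indicator {0..T} s * (\<integral>x. (A x s)\<^sup>2 \<partial>lebn 1)" for A :: "(nat \<Rightarrow> real) \<Rightarrow> real \<Rightarrow> real" and s
    have ind: "(indicator {0..T} s :: real)\<^sup>2 = indicator {0..T} s" for s by (simp split: split_indicator)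
    have n: "integrable lborel (n A)" if "L2Q 1 (Rn 1) T A" for A
      using P.integrable_square_section[of "\<lambda>x s. indicator {0..T} s * A x s"] that
      by (simp add: L2Q_Rn n_def[abs_def] power_mult_distrib ind)
    define k where "k = M + 1"
    have k: "0 \<le> k" using M by (simp add: k_def)
    have t': "t \<in> {0..T}" "0 \<le> t" using t by auto
    have neq: "n A s = (\<integral>x. (A x s)\<^sup>2 \<partial>lebn 1)" if "s \<in> {0..t}" for A s
      using that t' by (simp add: n_def)
    have "exp (- k * t) * n u t + k * (LINT s:{0..t}|lborel. exp (- k * s) * n u s) \<le>
       (LINT s:{0..t}|lborel. exp (- k * s) * (n (F 0) s / 2 + n F0 s + n u s))"
    proof (rule exponential_weight_integral[OF _ k t'(2) n[OF u]])
      show "integrable lborel (\<lambda>s. n (F 0) s / 2 + n F0 s + n u s)"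
        using n[OF F'] n[OF F0] n[OF u] by simp
      fix s assume s: "s \<in> {0..t}"
      then have sT: "s \<in> {0..T}" using t' by auto
      have "(LINT r:{0..s}|lborel. n (F 0) r / 2 + n F0 r + n u r) =
        (LINT r:{0..s}|lborel. (\<integral>x. (F 0 x r)\<^sup>2 \<partial>lebn 1) / 2 + (\<integral>x. (F0 x r)\<^sup>2 \<partial>lebn 1) + (\<integral>x. (u x r)\<^sup>2 \<partial>lebn 1))"
        using s by (intro set_lebesgue_integral_cong) (auto simp: neq)
      with heat_energy_estimate[OF T F' F0 sol' sT] s
      show "n u s \<le> (LINT r:{0..s}|lborel. n (F 0) r / 2 + n F0 r + n u r)" by (simp add: neq)
    qed
    moreover have iw: "set_integrable lborel {0..t} (\<lambda>s. exp (- k * s) * n A s)" if "L2Q 1 (Rn 1) T A" for A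
      unfolding set_integrable_def
    proof (rule Bochner_Integration.integrable_bound[OF n[OF that]])
      have [measurable]: "n A \<in> borel_measurable borel" using n[OF that] by auto
      show "(\<lambda>s. indicator {0..t} s *\<^sub>R (exp (- k * s) * n A s)) \<in> borel_measurable lborel" by measurable
      show "AE s in lborel. norm (indicator {0..t} s *\<^sub>R (exp (- k * s) * n A s)) \<le> norm (n A s)"
        using k by (auto simp: abs_mult mult_left_le_one_le split: split_indicator)
    qed
    have "(LINT s:{0..t}|lborel. exp (- k * s) * (n (F 0) s / 2 + n F0 s + n u s))
      = (LINT s:{0..t}|lborel. (1 / 2 * (exp (- k * s) * n (F 0) s) + exp (- k * s) * n F0 s) + exp (- k * s) * n u s)"
      by (rule set_lebesgue_integral_cong) (auto simp: algebra_simps)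
    also have "\<dots> = 1 / 2 * (LINT s:{0..t}|lborel. exp (- k * s) * n (F 0) s) + (LINT s:{0..t}|lborel. exp (- k * s) * n F0 s)
      + (LINT s:{0..t}|lborel. exp (- k * s) * n u s)"
      using set_integrable_mult_right[OF iw[OF F'], of "1 / 2"] iw[OF F0] iw[OF u]
      by (simp add: set_integral_add del: set_integrable_mult_right_iff)
    \<comment> \<open>One of the \<open>M + 1\<close> copies of the weighted integral of
      \<open>n u\<close> cancels against the right-hand side.\<close>
    ultimately have "exp (- k * t) * n u t + M * (LINT s:{0..t}|lborel. exp (- k * s) * n u s) \<le>
      1 / 2 * (LINT s:{0..t}|lborel. exp (- k * s) * n (F 0) s) + (LINT s:{0..t}|lborel. exp (- k * s) * n F0 s)"
      by (simp add: k_def algebra_simps)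
    moreover have "(LINT s:{0..t}|lborel. exp (- k * s) * n A s) = (LINT s:{0..t}|lborel. exp (- k * s) * (\<integral>x. (A x s)\<^sup>2 \<partial>lebn 1))" for A
      by (rule set_lebesgue_integral_cong) (auto simp: neq)
    moreover have "- 2 * ((M + 1) / 2) = - k" by (simp add: k_def)
    ultimately show ?thesis
      using t' by (simp add: neq sqn_Rn set_integral_Rn lessThan_1_nat minv_1 power2_eq_square)
  qed
  then show ?thesis
    unfolding C1_def by (intro Inf_lower CollectI exI[of _ "1/2"] exI[of _ 1]) blast
qed

subsection \<open>Smooth modulated bumps\<close>

text \<open>For \<open>j = 0\<close> the classical smooth function that is flat at 0; the extra
  powers of \<open>x\<close> in the denominator close the family under differentiation up to linear
  combinations.\<close>

definition flat :: "nat \<Rightarrow> real \<Rightarrow> real" where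
  "flat j x = (if 0 < x then exp (- 1 / x) / x ^ j else 0)"

lemma flat_tendsto_0: "(flat j \<longlongrightarrow> 0) (at 0)"
proof (rule filterlim_split_at)
  show "(flat j \<longlongrightarrow> 0) (at_left 0)"
    by (rule Lim_transform_eventually[OF tendsto_const])
      (auto simp: flat_def eventually_at_left_field intro!: exI[of _ "-1"])
  have "((\<lambda>x::real. inverse x ^ j / exp (inverse x)) \<longlongrightarrow> 0) (at_right 0)"
    by (rule filterlim_compose[OF tendsto_power_div_exp_0 filterlim_inverse_at_top_right])
  then show "(flat j \<longlongrightarrow> 0) (at_right 0)"
    by (rule Lim_transform_eventually)
      (auto simp: flat_def eventually_at_right_field exp_minus field_simps intro!: exI[of _ 1])
qed

text \<open>Only the origin is delicate: there the difference quotient of \<open>flat j\<close> is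
  \<open>flat (j + 1)\<close>, which tends to 0 since the exponential beats every power.\<close>

lemma flat_DERIV: "(flat j has_real_derivative flat (j + 2) x - real j * flat (j + 1) x) (at x)"
proof (rule linorder_cases[of x 0])
  assume "x < 0"
  then have "((\<lambda>_. 0) has_real_derivative 0) (at x)" "\<forall>\<^sub>F y in nhds x. 0 = flat j y"
    using eventually_nhds_in_open[of "{..<0}" x] by (auto simp: flat_def elim!: eventually_mono)
  then show ?thesis using \<open>x < 0\<close> by (subst (asm) DERIV_cong_ev[OF refl _ refl]) (auto simp: flat_def)
next
  assume "0 < x"
  have pw: "n = 0 \<or> x ^ n = x * x ^ (n - 1)" for n by (cases n) auto
  have "((\<lambda>y. exp (- 1 / y) / y ^ j) has_real_derivative flat (j + 2) x - real j * flat (j + 1) x) (at x)"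
    using \<open>0 < x\<close> pw[of "j - 1"]
    by (cases j) (auto intro!: derivative_eq_intros simp: flat_def field_simps power2_eq_square One_nat_def)
  moreover have "\<forall>\<^sub>F y in nhds x. exp (- 1 / y) / y ^ j = flat j y"
    using \<open>0 < x\<close> eventually_nhds_in_open[of "{0<..}" x] by (auto simp: flat_def elim!: eventually_mono)
  ultimately show ?thesis by (subst (asm) DERIV_cong_ev[OF refl _ refl])
next
  assume "x = 0"
  have "((\<lambda>h. (flat j (0 + h) - flat j 0) / h) \<longlongrightarrow> 0) (at 0)"
    by (rule Lim_transform_eventually[OF flat_tendsto_0[of "j + 1"]])
      (auto simp: flat_def eventually_at_filter field_simps power_add)
  then show ?thesis using \<open>x = 0\<close> by (simp add: DERIV_def flat_def)
qed

text \<open>A family of functions closed under differentiation consists of smooth functions; this one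
  contains bump functions and their modulations.\<close>

inductive_set modulated_bumps :: "(real \<Rightarrow> real) set" where
  flat: "(\<lambda>x. flat j (a * x + b)) \<in> modulated_bumps"
| sin: "(\<lambda>x. sin (k * x)) \<in> modulated_bumps"
| cos: "(\<lambda>x. cos (k * x)) \<in> modulated_bumps"
| const: "(\<lambda>x. c) \<in> modulated_bumps"
| add: "f \<in> modulated_bumps \<Longrightarrow> g \<in> modulated_bumps \<Longrightarrow> (\<lambda>x. f x + g x) \<in> modulated_bumps"
| mult: "f \<in> modulated_bumps \<Longrightarrow> g \<in> modulated_bumps \<Longrightarrow> (\<lambda>x. f x * g x) \<in> modulated_bumps"

lemma modulated_bumps_cmult: "f \<in> modulated_bumps \<Longrightarrow> (\<lambda>x. c * f x) \<in> modulated_bumps"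
  by (intro modulated_bumps.mult modulated_bumps.const)

lemma modulated_bumps_diff:
  "f \<in> modulated_bumps \<Longrightarrow> g \<in> modulated_bumps \<Longrightarrow> (\<lambda>x. f x - g x) \<in> modulated_bumps"
  using modulated_bumps.add[OF _ modulated_bumps_cmult[of g "-1"]] by simp

lemma modulated_bumps_scale: "f \<in> modulated_bumps \<Longrightarrow> (\<lambda>x. f (m * x)) \<in> modulated_bumps"
proof (induction rule: modulated_bumps.induct)
  case (flat j a b)
  show ?case using modulated_bumps.flat[of j "a * m" b] by (simp add: mult.assoc)
next
  case (sin k)
  show ?case using modulated_bumps.sin[of "k * m"] by (simp add: mult.assoc)
next
  case (cos k)
  show ?case using modulated_bumps.cos[of "k * m"] by (simp add: mult.assoc)
qed (auto intro: modulated_bumps.intros)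

lemma modulated_bumps_DERIV:
  "f \<in> modulated_bumps \<Longrightarrow> \<exists>f'\<in>modulated_bumps. \<forall>x. (f has_real_derivative f' x) (at x)"
proof (induction rule: modulated_bumps.induct)
  case (flat j a b)
  show ?case
  proof (intro bexI allI)
    show "(\<lambda>x. a * (flat (j + 2) (a * x + b) - real j * flat (j + 1) (a * x + b))) \<in> modulated_bumps"
      by (intro modulated_bumps_cmult modulated_bumps_diff modulated_bumps.flat)
    fix x
    have "((\<lambda>x. a * x + b) has_real_derivative a) (at x)" by (auto intro!: derivative_eq_intros)
    from DERIV_chain2[OF flat_DERIV this]
    show "((\<lambda>x. flat j (a * x + b)) has_real_derivative a * (flat (j + 2) (a * x + b) - real j * flat (j + 1) (a * x + b))) (at x)"
      by (simp add: mult.commute)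
  qed
next
  case (sin k)
  show ?case
    by (rule bexI[of _ "\<lambda>x. k * cos (k * x)"])
      (auto intro!: derivative_eq_intros modulated_bumps_cmult modulated_bumps.cos)
next
  case (cos k)
  show ?case
    by (rule bexI[OF _ modulated_bumps_cmult[OF modulated_bumps.sin, of "- k" k]])
      (auto intro!: derivative_eq_intros)
next
  case (const c)
  show ?case by (rule bexI[of _ "\<lambda>x. 0"]) (auto intro: modulated_bumps.const)
next
  case (add f g)
  then obtain f' g' where "f' \<in> modulated_bumps" "g' \<in> modulated_bumps"
    "\<And>x. (f has_real_derivative f' x) (at x)" "\<And>x. (g has_real_derivative g' x) (at x)" by blast
  then show ?case
    by (intro bexI[of _ "\<lambda>x. f' x + g' x"] allI DERIV_add modulated_bumps.add)
next
  case (mult f g)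
  then obtain f' g' where "f' \<in> modulated_bumps" "g' \<in> modulated_bumps"
    "\<And>x. (f has_real_derivative f' x) (at x)" "\<And>x. (g has_real_derivative g' x) (at x)" by blast
  then show ?case using mult.hyps
    by (intro bexI[of _ "\<lambda>x. f' x * g x + g' x * f x"] allI DERIV_mult modulated_bumps.add modulated_bumps.mult)
qed

lemma modulated_bumps_deriv: "f \<in> modulated_bumps \<Longrightarrow> deriv f \<in> modulated_bumps"
  using modulated_bumps_DERIV[of f] by (metis DERIV_imp_deriv ext)

lemma modulated_bumps_differentiable: "f \<in> modulated_bumps \<Longrightarrow> f differentiable (at x)"
  using modulated_bumps_DERIV[of f] real_differentiable_def by blast

lemma modulated_bumps_continuous: "f \<in> modulated_bumps \<Longrightarrow> continuous_on S f"
  by (meson modulated_bumps_differentiable differentiable_imp_continuous_within continuous_at_imp_continuous_on)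

text \<open>Every iterated partial derivative is an iterated \<open>deriv\<close> of
  \<open>g\<close>, which stays in the class and is therefore continuous and differentiable.\<close>

lemma modulated_bumps_test_fun:
  assumes g: "g \<in> modulated_bumps" and R: "\<And>s. \<bar>s\<bar> > R \<Longrightarrow> g s = 0"
  shows "test_fun 1 (Rn 1) (\<lambda>x. g (x 0))"
proof -
  let ?g = "\<lambda>x :: nat \<Rightarrow> real. g (x 0)"
  have p: "set is \<subseteq> {..<1} \<Longrightarrow> pdiffs is ?g = (\<lambda>x. (deriv ^^ length is) g (x 0))" for "is"
    by (induction "is") (auto simp: pdiff_def fun_eq_iff lessThan_1_nat)
  have d: "(deriv ^^ m) g \<in> modulated_bumps" for m
    by (induction m) (auto intro: g modulated_bumps_deriv)
  have "Ck_Rn 1 k ?g" for k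
    unfolding Ck_Rn_def
  proof (intro conjI allI impI ballI)
    fix "is" :: "nat list" assume "set is \<subseteq> {..<1} \<and> length is \<le> k"
    then show "cont_Rn 1 (pdiffs is ?g)"
      by (simp add: p cont_Rn_1 modulated_bumps_continuous[OF d])
  next
    fix "is" :: "nat list" and i :: nat and x :: "nat \<Rightarrow> real" 
    assume "set is \<subseteq> {..<1} \<and> length is < k" "i < 1" "x \<in> Rn 1"
    then show "(\<lambda>s. pdiffs is ?g (x(i := s))) differentiable at (x i)"
      using modulated_bumps_differentiable[OF d, of "length is" "x 0"] by (simp add: p)
  qed
  moreover have "bounded_Rn 1 (closure_Rn 1 {x \<in> Rn 1. ?g x \<noteq> 0})"
    unfolding bounded_Rn_def
  proof (intro exI ballI allI impI)
    fix x and i :: nat assume "x \<in> closure_Rn 1 {x \<in> Rn 1. ?g x \<noteq> 0}" "i < 1"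
    \<comment> \<open>Radius 1 in the definition of closure is enough to bound the closed support by
      \<open>R + 1\<close>.\<close>
    then obtain y where "g (y 0) \<noteq> 0" "\<bar>x 0 - y 0\<bar> < 1"
      unfolding closure_Rn_def distn_1 by (auto dest!: spec[of _ 1])
    moreover from this have "\<bar>y 0\<bar> \<le> R" using R[of "y 0"] by force
    ultimately show "\<bar>x i\<bar> \<le> R + 1" using \<open>i < 1\<close> by simp
  qed
  moreover have "closure_Rn 1 {x \<in> Rn 1. ?g x \<noteq> 0} \<subseteq> Rn 1" by (auto simp: closure_Rn_def)
  ultimately show ?thesis by (simp add: test_fun_def)
qed

lemma integral_deriv_compact_support:
  fixes h h' :: "real \<Rightarrow> real"
  assumes D: "\<And>x. (h has_real_derivative h' x) (at x)" and c: "continuous_on UNIV h'"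
    and R: "0 \<le> R" "\<And>s. \<bar>s\<bar> > R \<Longrightarrow> h s = 0" "\<And>s. \<bar>s\<bar> > R \<Longrightarrow> h' s = 0"
  shows "(\<integral>x. h' x \<partial>lborel) = 0"
proof -
  \<comment> \<open>The interval is enlarged by 1 so that its endpoints lie strictly outside the
    support, where \<open>h\<close> vanishes.\<close>
  have "h' x = h' x * indicator {-(R + 1)..R + 1} x" for x
    using R(3)[of x] by (auto split: split_indicator)
  then have "(\<integral>x. h' x \<partial>lborel) = (\<integral>x. h' x * indicator {-(R + 1)..R + 1} x \<partial>lborel)" by presburger
  also have "\<dots> = h (R + 1) - h (-(R + 1))"
    by (rule integral_FTC_Icc_real)
      (use R c in \<open>auto intro: has_field_derivative_at_within D simp: continuous_on_eq_continuous_at\<close>)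
  also have "\<dots> = 0" using R by simp
  finally show ?thesis .
qed

lemma L2Q_separated:
  assumes a: "continuous_on UNIV a" and v: "sq_int (lebn 1) v"
  shows "L2Q 1 (Rn 1) T (\<lambda>x s. a s * v x)"
proof -
  interpret sigma_finite_measure "lebn 1" by (rule sigma_finite_lebn)
  have p: "pair_sigma_finite (lebn 1) (lborel :: real measure)" ..
  note [measurable] = borel_measurable_continuous_onI[OF a] sq_int_measurable[OF v]
  have "set_integrable lborel {0..T} (\<lambda>s. (a s)\<^sup>2)"
    by (intro borel_integrable_atLeastAtMost' continuous_intros continuous_on_subset[OF a]) auto
  moreover have "(\<lambda>s. (indicator {0..T} s * a s)\<^sup>2) = (\<lambda>s. indicator {0..T} s *\<^sub>R (a s)\<^sup>2)"
    by (auto split: split_indicator)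
  ultimately have "sq_int lborel (\<lambda>s. indicator {0..T} s * a s)"
    by (simp add: sq_int_def set_integrable_def)
  from sq_int_pair_tensor[OF p v this] show ?thesis
    by (simp add: L2Q_Rn mult_ac)
qed

lemma L2Q_add:
  assumes "L2Q n (Rn n) T A" "L2Q n (Rn n) T B"
  shows "L2Q n (Rn n) T (\<lambda>x s. A x s + B x s)"
  using assms sq_int_add[of "lebn n \<Otimes>\<^sub>M lborel" "\<lambda>(x, s). indicator {0..T} s * A x s" "\<lambda>(x, s). indicator {0..T} s * B x s"]
  by (auto simp: L2Q_Rn case_prod_beta' distrib_left)

subsection \<open>Lower bound\<close>

text \<open>With \<open>F = - 2 a g'\<close> the flux contributions reverse the sign of the
  diffusion. The source \<open>F0\<close> is then whatever makes \<open>a g\<close> a solution of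
  the backward equation, namely \<open>a' g + a g''\<close>.\<close>

lemma separated_weak_sol:
  assumes g: "g \<in> modulated_bumps" "g1 \<in> modulated_bumps" "g2 \<in> modulated_bumps"
    and D: "\<And>x. (g has_real_derivative g1 x) (at x)" "\<And>x. (g1 has_real_derivative g2 x) (at x)"
    and R: "0 \<le> R" "\<And>s. \<bar>s\<bar> > R \<Longrightarrow> g s = 0" "\<And>s. \<bar>s\<bar> > R \<Longrightarrow> g1 s = 0" "\<And>s. \<bar>s\<bar> > R \<Longrightarrow> g2 s = 0"
    and a: "\<And>s. (a has_real_derivative a' s) (at s)" "continuous_on UNIV a'" "a 0 = 0"
  shows "weak_sol 1 (Rn 1) T (\<lambda>_ _ _ _. 1) (\<lambda>_ _ _. 0) (\<lambda>_ _. 0)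
     (\<lambda>_ x s. - 2 * a s * g1 (x 0)) (\<lambda>x s. a' s * g (x 0) + a s * g2 (x 0)) (\<lambda>x s. a s * g (x 0))"
proof -
  have ca: "continuous_on UNIV a" using a(1) by (meson DERIV_isCont continuous_at_imp_continuous_on)
  have cg: "continuous_on UNIV g" "continuous_on UNIV g1" "continuous_on UNIV g2"
    using g by (auto intro: modulated_bumps_continuous)
  have sq: "sq_int (lebn 1) (\<lambda>x. g (x 0))" "sq_int (lebn 1) (\<lambda>x. g1 (x 0))" "sq_int (lebn 1) (\<lambda>x. g2 (x 0))"
    using sq_int_lebn_1[OF cg(1) R(2) refl] sq_int_lebn_1[OF cg(2) R(3) refl] sq_int_lebn_1[OF cg(3) R(4) refl]
    by auto
  have deriv: "pdiff 0 (\<lambda>x. c * g (x 0)) = (\<lambda>x. c * g1 (x 0))" for c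
    unfolding pdiff_def by (auto simp: fun_eq_iff intro!: DERIV_imp_deriv DERIV_cmult D)
  have H: "H10 1 (Rn 1) (\<lambda>x. a t * g (x 0)) (\<lambda>i x. a t * g1 (x 0))" for t
    unfolding H10_def L2D_Rn
  \<comment> \<open>At each time the function is itself a test function, so a constant sequence
    approximates it.\<close>
  proof (intro conjI allI impI sq_int_cmult sq exI[of _ "\<lambda>_ x. a t * g (x 0)"])
    show "test_fun 1 (Rn 1) (\<lambda>x. a t * g (x 0))"
      by (rule modulated_bumps_test_fun[where R=R and g="\<lambda>s. a t * g s"]) (auto intro: modulated_bumps_cmult g R)
  qed (auto simp: sqn_Rn deriv)
  show ?thesis
    unfolding weak_sol_def
  proof (intro exI[of _ "\<lambda>_ x s. a s * g1 (x 0)"] conjI allI impI ballI AE_I2)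
    show "L2Q 1 (Rn 1) T (\<lambda>x s. a s * g (x 0))" "L2Q 1 (Rn 1) T (\<lambda>x s. a s * g1 (x 0))"
      by (intro L2Q_separated ca sq)+
    show "H10 1 (Rn 1) (\<lambda>x. a t * g (x 0)) (\<lambda>i x. a t * g1 (x 0))" for t by (rule H)
    show "L2D 1 (Rn 1) (\<lambda>x. a t * g (x 0))" for t unfolding L2D_Rn by (intro sq_int_cmult sq)
    show "((\<lambda>s. sqn 1 (Rn 1) (\<lambda>x. a s * g (x 0) - a t * g (x 0))) \<longlongrightarrow> 0) (at t within {0..T})" for t
    proof -
      have "isCont a t" using a(1) by (rule DERIV_isCont)
      then have "(a \<longlongrightarrow> a t) (at t within {0..T})"
        by (meson continuous_within continuous_at_imp_continuous_at_within)
      then have "((\<lambda>s. (a s - a t)\<^sup>2 * (\<integral>x. (g (x 0))\<^sup>2 \<partial>lebn 1)) \<longlongrightarrow> (a t - a t)\<^sup>2 * (\<integral>x. (g (x 0))\<^sup>2 \<partial>lebn 1)) (at t within {0..T})"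
        by (intro tendsto_intros)
      then show ?thesis by (simp add: sqn_Rn left_diff_distrib[symmetric] power_mult_distrib)
    qed
    show "sqn 1 (Rn 1) (\<lambda>x. a 0 * g (x 0)) = 0" by (simp add: sqn_Rn a)
    fix \<psi> t assume \<psi>: "test_fun 1 (Rn 1) \<psi>" and t: "t \<in> {0..T}"
    note tsq = test_fun_sq_int[OF \<psi>]
    from test_fun_real[OF \<psi>] obtain S where S: "continuous_on UNIV (\<lambda>s. \<psi> (emb s))"
      "\<And>s. ((\<lambda>s. \<psi> (emb s)) has_real_derivative deriv (\<lambda>s. \<psi> (emb s)) s) (at s)"
      "continuous_on UNIV (deriv (\<lambda>s. \<psi> (emb s)))" by metis
    \<comment> \<open>Integration by parts: the derivative of \<open>g1\<close> times
      \<open>\<psi>\<close> has compact support and integral zero.\<close>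
    let ?h = "\<lambda>s. g1 s * \<psi> (emb s)" and ?h' = "\<lambda>s. g2 s * \<psi> (emb s) + g1 s * deriv (\<lambda>s. \<psi> (emb s)) s"
    have ch: "continuous_on UNIV ?h'" by (intro continuous_intros cg S)
    have "(\<integral>x. ?h' x \<partial>lborel) = 0"
    proof (rule integral_deriv_compact_support[OF _ ch R(1)])
      show "(?h has_real_derivative ?h' x) (at x)" for x
        using DERIV_mult[OF D(2)[of x] S(2)[of x]] by (simp add: mult.commute add.commute)
    qed (use R in auto)
    then have "(\<integral>x. ?h' (x 0) \<partial>lebn 1) = 0"
      using lebn_1_integral(2)[OF borel_measurable_continuous_onI[OF ch]] by simp
    moreover have "(\<integral>x. ?h' (x 0) \<partial>lebn 1) = (\<integral>x. g2 (x 0) * \<psi> x + g1 (x 0) * pdiff 0 \<psi> x \<partial>lebn 1)"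
      using Rn1_eq_emb by (intro Bochner_Integration.integral_cong refl) (simp add: space_lebn pdiff_emb)
    ultimately have zero: "(\<integral>x. g2 (x 0) * \<psi> x \<partial>lebn 1) + (\<integral>x. g1 (x 0) * pdiff 0 \<psi> x \<partial>lebn 1) = 0"
      using sq_int_integrable_mult[OF sq(3) tsq(1)] sq_int_integrable_mult[OF sq(2) tsq(2)] by simp
    define c where "c = (\<integral>x. g (x 0) * \<psi> x \<partial>lebn 1)"
    \<comment> \<open>The two terms with factor \<open>a s\<close> cancel by the integration by
      parts, leaving the time derivative alone.\<close>
    have inner: "(\<integral>x. - (a s * g1 (x 0) * pdiff 0 \<psi> x) - (- 2 * a s * g1 (x 0) * pdiff 0 \<psi> x) + (a' s * g (x 0) + a s * g2 (x 0)) * \<psi> x \<partial>lebn 1)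
       = a' s * c" for s
    proof -
      have "(\<integral>x. - (a s * g1 (x 0) * pdiff 0 \<psi> x) - (- 2 * a s * g1 (x 0) * pdiff 0 \<psi> x) + (a' s * g (x 0) + a s * g2 (x 0)) * \<psi> x \<partial>lebn 1)
        = (\<integral>x. a s * (g1 (x 0) * pdiff 0 \<psi> x) + a s * (g2 (x 0) * \<psi> x) + a' s * (g (x 0) * \<psi> x) \<partial>lebn 1)"
        by (rule arg_cong[where f="integral\<^sup>L _"]) (auto simp: algebra_simps)
      also have "\<dots> = a s * (\<integral>x. g1 (x 0) * pdiff 0 \<psi> x \<partial>lebn 1) + a s * (\<integral>x. g2 (x 0) * \<psi> x \<partial>lebn 1) + a' s * c"
        using sq_int_integrable_mult[OF sq(3) tsq(1)] sq_int_integrable_mult[OF sq(2) tsq(2)] sq_int_integrable_mult[OF sq(1) tsq(1)]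
        by (simp add: c_def)
      also have "\<dots> = a s * ((\<integral>x. g2 (x 0) * \<psi> x \<partial>lebn 1) + (\<integral>x. g1 (x 0) * pdiff 0 \<psi> x \<partial>lebn 1)) + a' s * c"
        by (simp add: algebra_simps)
      finally show ?thesis by (simp add: zero)
    qed
    have "(LINT s:{0..t}|lborel. a' s * c) = a t * c"
    proof -
      have "(\<integral>s. a' s * c * indicator {0..t} s \<partial>lborel) = a t * c - a 0 * c"
        by (rule integral_FTC_Icc_real)
          (use t a(2) in \<open>auto intro!: DERIV_cmult_right a continuous_intros simp: continuous_on_eq_continuous_at\<close>)
      then show ?thesis by (simp add: set_lebesgue_integral_def a mult_ac)
    qed
    moreover have "ipD 1 (Rn 1) (\<lambda>x. a t * g (x 0)) \<psi> = a t * c"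
      by (simp add: ipD_Rn c_def mult.assoc)
    ultimately show "ipD 1 (Rn 1) (\<lambda>x. a t * g (x 0)) \<psi> = (LINT s:{0..t}|lborel. LINT x:Rn 1|lebn 1.
        - (\<Sum>i<1. \<Sum>j<(1::nat). 1 * (a s * g1 (x 0)) * pdiff i \<psi> x)
        + ((\<Sum>i<(1::nat). 0 * (a s * g1 (x 0))) + 0 * (a s * g (x 0))) * \<psi> x
        - (\<Sum>i<1. - 2 * a s * g1 (x 0) * pdiff i \<psi> x)
        + (a' s * g (x 0) + a s * g2 (x 0)) * \<psi> x)"
      by (auto simp add: set_integral_Rn lessThan_1_nat inner[simplified])
  qed
qed

text \<open>The assumed inequality at time \<open>T\<close> for
  \<open>u = (exp (\<kappa> s) - 1) g\<close>. The nonnegative \<open>M\<close>-term is dropped on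
  the left, and \<open>F0\<close> is split into a part bounded in time and a part measuring how far
  \<open>g\<close> is from an eigenfunction.\<close>

lemma C1_separated_bound:
  assumes bound: "\<forall>F F0 u. (\<forall>i<1. L2Q 1 (Rn 1) T (F i)) \<and> L2Q 1 (Rn 1) T F0 \<and>
       weak_sol 1 (Rn 1) T (\<lambda>_ _ _ _. 1) (\<lambda>_ _ _. 0) (\<lambda>_ _. 0) F F0 u \<longrightarrow>
       (\<forall>t\<in>{0<..T}.
          exp (-2 * K * t) * sqn 1 (Rn 1) (\<lambda>x. u x t)
          + M * (LINT s:{0..t}|lborel. (exp (-2 * K * s) * sqn 1 (Rn 1) (\<lambda>x. u x s)))
          \<le> c1 * (LINT s:{0..t}|lborel. (exp (-2 * K * s) *
                   (LINT x:Rn 1|lebn 1. (\<Sum>i<1. \<Sum>j<1. F i x s * minv 1 (\<lambda>_ _. 1) i j * F j x s))))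
            + c0 * (LINT s:{0..t}|lborel. (exp (-2 * K * s) * sqn 1 (Rn 1) (\<lambda>x. F0 x s))))"
    and T: "0 < T" and K: "0 \<le> K" and M: "0 \<le> M"
    and g: "g \<in> modulated_bumps" "g1 \<in> modulated_bumps" "g2 \<in> modulated_bumps"
    and D: "\<And>x. (g has_real_derivative g1 x) (at x)" "\<And>x. (g1 has_real_derivative g2 x) (at x)"
    and R: "0 \<le> R" "\<And>s. \<bar>s\<bar> > R \<Longrightarrow> g s = 0" "\<And>s. \<bar>s\<bar> > R \<Longrightarrow> g1 s = 0" "\<And>s. \<bar>s\<bar> > R \<Longrightarrow> g2 s = 0"
    and A: "A = (LINT s:{0..T}|lborel. exp (- 2 * K * s) * (exp (\<kappa> * s) - 1)\<^sup>2)"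
  shows "exp (- 2 * K * T) * (exp (\<kappa> * T) - 1)\<^sup>2 * (\<integral>x. (g x)\<^sup>2 \<partial>lborel) \<le>
     4 * c1 * A * (\<integral>x. (g1 x)\<^sup>2 \<partial>lborel) +
     \<bar>c0\<bar> * (2 * \<kappa>\<^sup>2 * T * (\<integral>x. (g x)\<^sup>2 \<partial>lborel) + 2 * A * (\<integral>x. (g2 x + \<kappa> * g x)\<^sup>2 \<partial>lborel))"
proof -
  define a where "a s = exp (\<kappa> * s) - 1" for s
  define a' where "a' s = \<kappa> * exp (\<kappa> * s)" for s
  have a: "\<And>s. (a has_real_derivative a' s) (at s)" "continuous_on UNIV a'" "a 0 = 0"
    by (auto simp: a_def[abs_def] a'_def[abs_def] intro!: derivative_eq_intros continuous_intros)
  have ca: "continuous_on UNIV a" unfolding a_def by (intro continuous_intros)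
  have cg: "continuous_on UNIV g" "continuous_on UNIV g1" "continuous_on UNIV g2"
    using g by (auto intro: modulated_bumps_continuous)
  have sq: "sq_int (lebn 1) (\<lambda>x. g (x 0))" "sq_int (lebn 1) (\<lambda>x. g1 (x 0))" "sq_int (lebn 1) (\<lambda>x. g2 (x 0))"
    using sq_int_lebn_1[OF cg(1) R(2) refl] sq_int_lebn_1[OF cg(2) R(3) refl] sq_int_lebn_1[OF cg(3) R(4) refl]
    by auto
  have n: "(\<integral>x. (h (x 0))\<^sup>2 \<partial>lebn 1) = (\<integral>x. (h x)\<^sup>2 \<partial>lborel)" if "continuous_on UNIV h" for h :: "real \<Rightarrow> real"
    using borel_measurable_continuous_onI[OF that] by (intro lebn_1_integral(2)) simp
  define ng ng1 ng2 where "ng = (\<integral>x. (g x)\<^sup>2 \<partial>lborel)" and "ng1 = (\<integral>x. (g1 x)\<^sup>2 \<partial>lborel)"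
    and "ng2 = (\<integral>x. (g2 x + \<kappa> * g x)\<^sup>2 \<partial>lborel)"
  let ?p = "\<lambda>x s. - 2 * a s * g1 (x 0)" and ?q = "\<lambda>x s. a' s * g (x 0) + a s * g2 (x 0)"
    and ?u = "\<lambda>x s. a s * g (x 0)"
  have "L2Q 1 (Rn 1) T ?p" "L2Q 1 (Rn 1) T ?q"
    by (intro L2Q_separated L2Q_add continuous_intros ca a sq)+
  then have hyp: "(\<forall>i<(1::nat). L2Q 1 (Rn 1) T ?p) \<and> L2Q 1 (Rn 1) T ?q \<and>
       weak_sol 1 (Rn 1) T (\<lambda>_ _ _ _. 1) (\<lambda>_ _ _. 0) (\<lambda>_ _. 0) (\<lambda>_. ?p) ?q ?u"
    using separated_weak_sol[OF g D R(1) _ _ _ a, of T] R by blast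
  have ineq: "exp (-2 * K * T) * sqn 1 (Rn 1) (\<lambda>x. ?u x T)
          + M * (LINT s:{0..T}|lborel. (exp (-2 * K * s) * sqn 1 (Rn 1) (\<lambda>x. ?u x s)))
          \<le> c1 * (LINT s:{0..T}|lborel. (exp (-2 * K * s) *
                   (LINT x:Rn 1|lebn 1. (\<Sum>i<1. \<Sum>j<1. ?p x s * minv 1 (\<lambda>_ _. 1) i j * ?p x s))))
            + c0 * (LINT s:{0..T}|lborel. (exp (-2 * K * s) * sqn 1 (Rn 1) (\<lambda>x. ?q x s)))"
    by (rule bspec[OF bound[THEN spec[of _ "\<lambda>_. ?p"], THEN spec[of _ ?q], THEN spec[of _ ?u], THEN mp, OF hyp]])
      (use T in simp)
  have 1: "sqn 1 (Rn 1) (\<lambda>x. ?u x s) = (a s)\<^sup>2 * ng" for s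
    by (simp add: sqn_Rn power_mult_distrib n[OF cg(1)] ng_def)
  have 2: "(LINT x:Rn 1|lebn 1. (\<Sum>i<1. \<Sum>j<1. ?p x s * minv 1 (\<lambda>_ _. 1) i j * ?p x s)) = 4 * (a s)\<^sup>2 * ng1" for s
  proof -
    have "(LINT x:Rn 1|lebn 1. (\<Sum>i<1. \<Sum>j<1. ?p x s * minv 1 (\<lambda>_ _. 1) i j * ?p x s)) = (\<integral>x. 4 * (a s)\<^sup>2 * (g1 (x 0))\<^sup>2 \<partial>lebn 1)"
      unfolding set_integral_Rn
      by (rule arg_cong[where f="integral\<^sup>L _"]) (auto simp: lessThan_1_nat minv_1 power2_eq_square)
    then show ?thesis by (simp add: n[OF cg(2)] ng1_def)
  qed
  have sum2: "(p + q)\<^sup>2 \<le> 2 * p\<^sup>2 + 2 * q\<^sup>2" for p q :: real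
    using sum_squares_bound[of p q] by (simp add: power2_sum)
  have sq3: "sq_int (lebn 1) (\<lambda>x. g2 (x 0) + \<kappa> * g (x 0))"
    by (intro sq_int_add sq_int_cmult sq)
  have 3: "sqn 1 (Rn 1) (\<lambda>x. ?q x s) \<le> 2 * \<kappa>\<^sup>2 * ng + 2 * (a s)\<^sup>2 * ng2" for s
  proof -
    have "sqn 1 (Rn 1) (\<lambda>x. ?q x s) \<le> (\<integral>x. 2 * (\<kappa>\<^sup>2 * (g (x 0))\<^sup>2) + 2 * ((a s)\<^sup>2 * (g2 (x 0) + \<kappa> * g (x 0))\<^sup>2) \<partial>lebn 1)"
      unfolding sqn_Rn
    proof (rule integral_mono)
      show "integrable (lebn 1) (\<lambda>x. (?q x s)\<^sup>2)"
        by (intro sq_int_integrable_square sq_int_add sq_int_cmult sq)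
      show "integrable (lebn 1) (\<lambda>x. 2 * (\<kappa>\<^sup>2 * (g (x 0))\<^sup>2) + 2 * ((a s)\<^sup>2 * (g2 (x 0) + \<kappa> * g (x 0))\<^sup>2))"
        using sq sq3 by (simp add: sq_int_def)
      fix x
      \<comment> \<open>Since \<open>a' = \<kappa> a + \<kappa>\<close>, only the constant summand
        \<open>\<kappa>\<close> survives outside the eigenfunction defect.\<close>
      have "?q x s = \<kappa> * g (x 0) + a s * (g2 (x 0) + \<kappa> * g (x 0))"
        by (simp add: a_def a'_def algebra_simps)
      then show "(?q x s)\<^sup>2 \<le> 2 * (\<kappa>\<^sup>2 * (g (x 0))\<^sup>2) + 2 * ((a s)\<^sup>2 * (g2 (x 0) + \<kappa> * g (x 0))\<^sup>2)"
        using sum2[of "\<kappa> * g (x 0)" "a s * (g2 (x 0) + \<kappa> * g (x 0))"] by (simp add: power_mult_distrib)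
    qed
    also have "\<dots> = 2 * \<kappa>\<^sup>2 * ng + 2 * (a s)\<^sup>2 * ng2"
      using sq sq3 n[OF cg(1)] n[of "\<lambda>s. g2 s + \<kappa> * g s"] cg
      by (simp add: sq_int_def ng_def ng2_def continuous_intros)
    finally show ?thesis .
  qed
  have sI: "set_integrable lborel {0..T} f" if "continuous_on UNIV f" for f :: "real \<Rightarrow> real"
    by (intro borel_integrable_atLeastAtMost' continuous_on_subset[OF that]) auto
  \<comment> \<open>This expansion serves only to show continuity in \<open>s\<close>, hence
    integrability over the time interval.\<close>
  have F0n: "sqn 1 (Rn 1) (\<lambda>x. ?q x s) = (a' s)\<^sup>2 * ng + 2 * (a s * a' s) * (\<integral>x. g (x 0) * g2 (x 0) \<partial>lebn 1) + (a s)\<^sup>2 * (\<integral>x. (g2 (x 0))\<^sup>2 \<partial>lebn 1)" for s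
  proof -
    have "sqn 1 (Rn 1) (\<lambda>x. ?q x s) = (\<integral>x. (a' s)\<^sup>2 * (g (x 0))\<^sup>2 + 2 * (a s * a' s) * (g (x 0) * g2 (x 0)) + (a s)\<^sup>2 * (g2 (x 0))\<^sup>2 \<partial>lebn 1)"
      unfolding sqn_Rn by (rule arg_cong[where f="integral\<^sup>L _"]) (auto simp: power2_eq_square algebra_simps)
    also have "\<dots> = (a' s)\<^sup>2 * ng + 2 * (a s * a' s) * (\<integral>x. g (x 0) * g2 (x 0) \<partial>lebn 1) + (a s)\<^sup>2 * (\<integral>x. (g2 (x 0))\<^sup>2 \<partial>lebn 1)"
      using sq sq_int_integrable_mult[OF sq(1,3)] n[OF cg(1)] by (simp add: sq_int_def ng_def)
    finally show ?thesis .
  qed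
  have ng0: "0 \<le> ng" by (simp add: ng_def)
  have A': "A = (LINT s:{0..T}|lborel. exp (- 2 * K * s) * (a s)\<^sup>2)" by (simp add: A a_def)
  have cA: "continuous_on UNIV (\<lambda>s. exp (- 2 * K * s) * (a s)\<^sup>2)" by (intro continuous_intros ca)
  have "(LINT s:{0..T}|lborel. exp (-2 * K * s) * sqn 1 (Rn 1) (\<lambda>x. ?q x s)) \<le>
     (LINT s:{0..T}|lborel. 2 * \<kappa>\<^sup>2 * ng + 2 * ng2 * (exp (- 2 * K * s) * (a s)\<^sup>2))"
  proof (rule set_integral_mono)
    show "set_integrable lborel {0..T} (\<lambda>s. exp (-2 * K * s) * sqn 1 (Rn 1) (\<lambda>x. ?q x s))"
      unfolding F0n by (intro sI continuous_intros ca a)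
    show "set_integrable lborel {0..T} (\<lambda>s. 2 * \<kappa>\<^sup>2 * ng + 2 * ng2 * (exp (- 2 * K * s) * (a s)\<^sup>2))"
      by (intro sI continuous_intros ca)
    fix s assume "s \<in> {0..T}"
    then have e: "exp (- 2 * K * s) \<le> 1" using K by simp
    have "exp (-2 * K * s) * sqn 1 (Rn 1) (\<lambda>x. ?q x s) \<le> exp (- 2 * K * s) * (2 * \<kappa>\<^sup>2 * ng + 2 * (a s)\<^sup>2 * ng2)"
      by (rule mult_left_mono[OF 3]) simp
    also have "\<dots> \<le> 2 * \<kappa>\<^sup>2 * ng + 2 * ng2 * (exp (- 2 * K * s) * (a s)\<^sup>2)"
      using mult_right_mono[OF e, of "2 * \<kappa>\<^sup>2 * ng"] ng0 by (simp add: algebra_simps)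
    finally show "exp (-2 * K * s) * sqn 1 (Rn 1) (\<lambda>x. ?q x s) \<le> 2 * \<kappa>\<^sup>2 * ng + 2 * ng2 * (exp (- 2 * K * s) * (a s)\<^sup>2)" .
  qed
  also have "\<dots> = 2 * \<kappa>\<^sup>2 * T * ng + 2 * A * ng2"
    using T set_integral_add(2)[OF sI[of "\<lambda>_. 2 * \<kappa>\<^sup>2 * ng"] sI[of "\<lambda>s. 2 * ng2 * (exp (- 2 * K * s) * (a s)\<^sup>2)"]] cA
    by (simp add: A' continuous_intros set_integral_const)
  finally have 4: "(LINT s:{0..T}|lborel. exp (-2 * K * s) * sqn 1 (Rn 1) (\<lambda>x. ?q x s)) \<le> 2 * \<kappa>\<^sup>2 * T * ng + 2 * A * ng2" .
  have pos0: "0 \<le> (LINT s:{0..T}|lborel. exp (-2 * K * s) * sqn 1 (Rn 1) (\<lambda>x. ?q x s))"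
    unfolding set_lebesgue_integral_def by (intro integral_nonneg_AE) (auto simp: sqn_Rn)
  have 5: "0 \<le> M * (LINT s:{0..T}|lborel. (exp (-2 * K * s) * sqn 1 (Rn 1) (\<lambda>x. ?u x s)))"
    unfolding set_lebesgue_integral_def using M by (intro mult_nonneg_nonneg integral_nonneg_AE) (auto simp: sqn_Rn)
  \<comment> \<open>The absolute value is taken because the sign of \<open>c0\<close> is
    unrestricted.\<close>
  have 6: "c0 * (LINT s:{0..T}|lborel. (exp (-2 * K * s) * sqn 1 (Rn 1) (\<lambda>x. ?q x s))) \<le> \<bar>c0\<bar> * (2 * \<kappa>\<^sup>2 * T * ng + 2 * A * ng2)"
    by (rule order_trans[OF mult_right_mono[OF abs_ge_self pos0] mult_left_mono[OF 4 abs_ge_zero]])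
  have 7: "(LINT s:{0..T}|lborel. (exp (-2 * K * s) * (4 * (a s)\<^sup>2 * ng1))) = 4 * A * ng1"
  proof -
    have "(LINT s:{0..T}|lborel. (exp (-2 * K * s) * (4 * (a s)\<^sup>2 * ng1))) = (LINT s:{0..T}|lborel. (4 * ng1) * (exp (-2 * K * s) * (a s)\<^sup>2))"
      by (rule set_lebesgue_integral_cong) (auto simp: mult_ac)
    then show ?thesis by (simp add: A')
  qed
  show ?thesis
    using ineq 5 6 unfolding 1 2 7 by (simp add: a_def ng_def[symmetric] ng1_def[symmetric] ng2_def[symmetric] mult_ac)
qed

section \<open>Wide bumps modulated at a fixed frequency\<close>

lemma bump_exists:
  "\<exists>\<eta>\<in>modulated_bumps. (\<forall>s. \<bar>s\<bar> > 1 \<longrightarrow> \<eta> s = 0) \<and> 0 < (\<integral>x. (\<eta> x)\<^sup>2 \<partial>lborel)"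
proof -
  \<comment> \<open>The factors vanish for \<open>x \<le> -1\<close> and \<open>x \<ge> 1\<close>
    respectively; the unsimplified arguments match the introduction rule for
    \<open>flat\<close>.\<close>
  define \<eta> where "\<eta> x = flat 0 (1 * x + 1) * flat 0 ((- 1) * x + 1)" for x
  have \<eta>: "\<eta> \<in> modulated_bumps"
    unfolding \<eta>_def by (intro modulated_bumps.mult modulated_bumps.flat)
  have z: "\<eta> s = 0" if "\<bar>s\<bar> > 1" for s
    using that by (auto simp: \<eta>_def flat_def)
  \<comment> \<open>On \<open>{- 1 / 2..1 / 2}\<close> both arguments are at least 1/2, so each
    factor is at least \<open>exp (- 2)\<close>; this makes the norm positive.\<close>
  have ge: "exp (- 2) \<le> flat 0 y" if "1 / 2 \<le> y" for y
    using that by (auto simp: flat_def field_simps)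
  have "0 < (exp (- 2) * exp (- 2))\<^sup>2 * (\<integral>x. indicator {- 1 / 2..1 / 2 :: real} x \<partial>lborel :: real)" by simp
  also have "\<dots> = (\<integral>x. (exp (- 2) * exp (- 2))\<^sup>2 * indicator {- 1 / 2..1 / 2 :: real} x \<partial>lborel)"
    by simp
  also have "\<dots> \<le> (\<integral>x. (\<eta> x)\<^sup>2 \<partial>lborel)"
  proof (rule integral_mono)
    show "integrable lborel (\<lambda>x. (exp (- 2) * exp (- 2))\<^sup>2 * indicator {- 1 / 2..1 / 2 :: real} x :: real)"
      using sq_int_indicator_Icc[of "- 1 / 2" "1 / 2"]
      by (auto simp: sq_int_def power2_eq_square indicator_inter_arith[symmetric])
    show "integrable lborel (\<lambda>x. (\<eta> x)\<^sup>2)"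
      by (intro integrable_continuous_support[of _ 1] continuous_intros modulated_bumps_continuous[OF \<eta>]) (simp add: z)
    show "(exp (- 2) * exp (- 2))\<^sup>2 * indicator {- 1 / 2..1 / 2 :: real} x \<le> (\<eta> x)\<^sup>2" for x
      by (auto simp: \<eta>_def split: split_indicator intro!: power_mono mult_mono ge) (auto simp: flat_def)
  qed
  finally show ?thesis using \<eta> z by blast
qed

text \<open>Pointwise, the pair \<open>(p, q)\<close> is rotated by the angle \<open>k * x\<close>,
  up to a reflection, which preserves \<open>p^2 + q^2\<close>.\<close>

lemma integral_rotation:
  assumes pq: "p \<in> modulated_bumps" "q \<in> modulated_bumps"
    and R: "\<And>s. \<bar>s\<bar> > R \<Longrightarrow> p s = 0" "\<And>s. \<bar>s\<bar> > R \<Longrightarrow> q s = 0"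
  shows "(\<integral>x. (p x * sin (k * x) + q x * cos (k * x))\<^sup>2 \<partial>lborel) + (\<integral>x. (p x * cos (k * x) - q x * sin (k * x))\<^sup>2 \<partial>lborel)
    = (\<integral>x. (p x)\<^sup>2 \<partial>lborel) + (\<integral>x. (q x)\<^sup>2 \<partial>lborel)"
proof -
  have c: "continuous_on UNIV p" "continuous_on UNIV q" using pq by (auto intro: modulated_bumps_continuous)
  have i: "integrable lborel (\<lambda>x. (p x)\<^sup>2)" "integrable lborel (\<lambda>x. (q x)\<^sup>2)"
    "integrable lborel (\<lambda>x. (p x * sin (k * x) + q x * cos (k * x))\<^sup>2)"
    "integrable lborel (\<lambda>x. (p x * cos (k * x) - q x * sin (k * x))\<^sup>2)"
    by (rule integrable_continuous_support[of _ R], intro continuous_intros c, simp add: R)+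
  have "(p x * sin (k * x) + q x * cos (k * x))\<^sup>2 + (p x * cos (k * x) - q x * sin (k * x))\<^sup>2 = (p x)\<^sup>2 + (q x)\<^sup>2" for x
  proof -
    have "(p x * sin (k * x) + q x * cos (k * x))\<^sup>2 + (p x * cos (k * x) - q x * sin (k * x))\<^sup>2
      = ((p x)\<^sup>2 + (q x)\<^sup>2) * ((sin (k * x))\<^sup>2 + (cos (k * x))\<^sup>2)"
      by algebra
    then show ?thesis by simp
  qed
  then have "(\<integral>x. (p x * sin (k * x) + q x * cos (k * x))\<^sup>2 + (p x * cos (k * x) - q x * sin (k * x))\<^sup>2 \<partial>lborel) = (\<integral>x. (p x)\<^sup>2 + (q x)\<^sup>2 \<partial>lborel)"
    by presburger
  then show ?thesis using i by simp
qed

lemma integral_square_scale: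
  fixes p :: "real \<Rightarrow> real"
  assumes "0 < m"
  shows "(\<integral>x. (c * p (m * x))\<^sup>2 \<partial>lborel) = c\<^sup>2 / m * (\<integral>x. (p x)\<^sup>2 \<partial>lborel)"
  using lborel_integral_real_affine[of m "\<lambda>x. (p x)\<^sup>2" 0] assms by (simp add: power_mult_distrib)

text \<open>Uses the bumps \<open>\<eta> (m x)\<close> modulated at frequency
  \<open>k = sqrt \<kappa>\<close>. Summed over sine and cosine, the squared norms are
  \<open>1 / m\<close> times polynomials in \<open>m\<close>; the common factor cancels, and as
  \<open>m\<close> tends to 0 the eigenfunction defect disappears.\<close>

lemma C1_frequency_bound:
  assumes bound: "\<forall>F F0 u. (\<forall>i<1. L2Q 1 (Rn 1) T (F i)) \<and> L2Q 1 (Rn 1) T F0 \<and>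
       weak_sol 1 (Rn 1) T (\<lambda>_ _ _ _. 1) (\<lambda>_ _ _. 0) (\<lambda>_ _. 0) F F0 u \<longrightarrow>
       (\<forall>t\<in>{0<..T}.
          exp (-2 * K * t) * sqn 1 (Rn 1) (\<lambda>x. u x t)
          + M * (LINT s:{0..t}|lborel. (exp (-2 * K * s) * sqn 1 (Rn 1) (\<lambda>x. u x s)))
          \<le> c1 * (LINT s:{0..t}|lborel. (exp (-2 * K * s) *
                   (LINT x:Rn 1|lebn 1. (\<Sum>i<1. \<Sum>j<1. F i x s * minv 1 (\<lambda>_ _. 1) i j * F j x s))))
            + c0 * (LINT s:{0..t}|lborel. (exp (-2 * K * s) * sqn 1 (Rn 1) (\<lambda>x. F0 x s))))"
    and T: "0 < T" and K: "0 \<le> K" and M: "0 \<le> M" and \<kappa>: "0 < \<kappa>"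
    and A: "A = (LINT s:{0..T}|lborel. exp (- 2 * K * s) * (exp (\<kappa> * s) - 1)\<^sup>2)"
  shows "exp (- 2 * K * T) * (exp (\<kappa> * T) - 1)\<^sup>2 \<le> 4 * c1 * A * \<kappa> + \<bar>c0\<bar> * (2 * \<kappa>\<^sup>2 * T)"
proof -
  obtain \<eta> where \<eta>: "\<eta> \<in> modulated_bumps" and z: "\<And>s. \<bar>s\<bar> > 1 \<Longrightarrow> \<eta> s = 0" and pos: "0 < (\<integral>x. (\<eta> x)\<^sup>2 \<partial>lborel)"
    using bump_exists by blast
  obtain \<eta>1 where \<eta>1: "\<eta>1 \<in> modulated_bumps" and D1: "\<And>x. (\<eta> has_real_derivative \<eta>1 x) (at x)"
    using modulated_bumps_DERIV[OF \<eta>] by blast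
  obtain \<eta>2 where \<eta>2: "\<eta>2 \<in> modulated_bumps" and D2: "\<And>x. (\<eta>1 has_real_derivative \<eta>2 x) (at x)"
    using modulated_bumps_DERIV[OF \<eta>1] by blast
  have z1: "\<eta>1 s = 0" if "\<bar>s\<bar> > 1" for s by (rule DERIV_zero_outside[OF D1 z that])
  have z2: "\<eta>2 s = 0" if "\<bar>s\<bar> > 1" for s by (rule DERIV_zero_outside[OF D2 z1 that])
  define k where "k = sqrt \<kappa>"
  have k: "0 < k" "k\<^sup>2 = \<kappa>" using \<kappa> by (auto simp: k_def)
  define n0 n1 n2 where "n0 = (\<integral>x. (\<eta> x)\<^sup>2 \<partial>lborel)" and "n1 = (\<integral>x. (\<eta>1 x)\<^sup>2 \<partial>lborel)" and "n2 = (\<integral>x. (\<eta>2 x)\<^sup>2 \<partial>lborel)"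
  define L where "L = exp (- 2 * K * T) * (exp (\<kappa> * T) - 1)\<^sup>2"
  have main: "L * n0 \<le> 4 * c1 * A * (m\<^sup>2 * n1 + \<kappa> * n0) + \<bar>c0\<bar> * (2 * \<kappa>\<^sup>2 * T * n0 + 2 * A * (m ^ 4 * n2 + 4 * m\<^sup>2 * \<kappa> * n1))"
    if m: "0 < m" for m
  proof -
    define p q r where "p x = \<eta> (m * x)" and "q x = \<eta>1 (m * x)" and "r x = \<eta>2 (m * x)" for x
    have pqr: "p \<in> modulated_bumps" "q \<in> modulated_bumps" "r \<in> modulated_bumps"
      unfolding p_def q_def r_def by (intro modulated_bumps_scale \<eta> \<eta>1 \<eta>2)+
    have out: "\<bar>m * s\<bar> > 1" if "\<bar>s\<bar> > 1 / m" for s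
      using that m by (simp add: abs_mult field_simps)
    have zz: "p s = 0" "q s = 0" "r s = 0" if "\<bar>s\<bar> > 1 / m" for s
      using out[OF that] z z1 z2 by (auto simp: p_def q_def r_def)
    have Dm: "((\<lambda>x. m * x) has_real_derivative m) (at x)" for x by (auto intro!: derivative_eq_intros)
    have Dp: "(p has_real_derivative m * q x) (at x)" and Dq: "(q has_real_derivative m * r x) (at x)" for x
      using DERIV_chain2[OF D1 Dm, of x] DERIV_chain2[OF D2 Dm, of x]
      by (simp_all add: p_def[abs_def] q_def[abs_def] r_def mult.commute[of "\<eta>1 (m * x)" m] mult.commute[of "\<eta>2 (m * x)" m])
    \<comment> \<open>The second derivative is arranged so that adding \<open>\<kappa>\<close> times
      the function leaves only terms carrying a factor \<open>m\<close>.\<close>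
    define gs gs1 gs2 where "gs x = p x * sin (k * x)" and "gs1 x = (m * q x) * sin (k * x) + (k * p x) * cos (k * x)"
      and "gs2 x = (m\<^sup>2 * r x) * sin (k * x) + (2 * m * k * q x) * cos (k * x) - \<kappa> * (p x * sin (k * x))" for x
    define gc gc1 gc2 where "gc x = p x * cos (k * x)" and "gc1 x = (m * q x) * cos (k * x) - (k * p x) * sin (k * x)"
      and "gc2 x = (m\<^sup>2 * r x) * cos (k * x) - (2 * m * k * q x) * sin (k * x) - \<kappa> * (p x * cos (k * x))" for x
    note defs = gs_def gs1_def gs2_def gc_def gc1_def gc2_def
    note mb = modulated_bumps.add modulated_bumps.mult modulated_bumps.sin modulated_bumps.cos
      modulated_bumps_cmult modulated_bumps_diff pqr
    have mbs: "gs \<in> modulated_bumps" "gs1 \<in> modulated_bumps" "gs2 \<in> modulated_bumps"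
      "gc \<in> modulated_bumps" "gc1 \<in> modulated_bumps" "gc2 \<in> modulated_bumps"
      unfolding defs by (intro mb)+
    have R: "0 \<le> 1 / m" using m by simp
    have S: "L * (\<integral>x. (gs x)\<^sup>2 \<partial>lborel) \<le> 4 * c1 * A * (\<integral>x. (gs1 x)\<^sup>2 \<partial>lborel) +
     \<bar>c0\<bar> * (2 * \<kappa>\<^sup>2 * T * (\<integral>x. (gs x)\<^sup>2 \<partial>lborel) + 2 * A * (\<integral>x. (gs2 x + \<kappa> * gs x)\<^sup>2 \<partial>lborel))"
      unfolding L_def
    proof (rule C1_separated_bound[OF bound T K M mbs(1-3) _ _ R _ _ _ A])
      show "(gs has_real_derivative gs1 x) (at x)" for x
        unfolding gs_def gs1_def by (auto intro!: derivative_eq_intros Dp)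
      show "(gs1 has_real_derivative gs2 x) (at x)" for x
        unfolding gs1_def gs2_def k(2)[symmetric]
        by (auto intro!: derivative_eq_intros Dp Dq simp: power2_eq_square algebra_simps)
    qed (auto simp: defs zz)
    have C: "L * (\<integral>x. (gc x)\<^sup>2 \<partial>lborel) \<le> 4 * c1 * A * (\<integral>x. (gc1 x)\<^sup>2 \<partial>lborel) +
     \<bar>c0\<bar> * (2 * \<kappa>\<^sup>2 * T * (\<integral>x. (gc x)\<^sup>2 \<partial>lborel) + 2 * A * (\<integral>x. (gc2 x + \<kappa> * gc x)\<^sup>2 \<partial>lborel))"
      unfolding L_def
    proof (rule C1_separated_bound[OF bound T K M mbs(4-6) _ _ R _ _ _ A])
      show "(gc has_real_derivative gc1 x) (at x)" for x
        unfolding gc_def gc1_def by (auto intro!: derivative_eq_intros Dp)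
      show "(gc1 has_real_derivative gc2 x) (at x)" for x
        unfolding gc1_def gc2_def k(2)[symmetric]
        by (auto intro!: derivative_eq_intros Dp Dq simp: power2_eq_square algebra_simps)
    qed (auto simp: defs zz)
    have s0: "(\<integral>x. (gs x)\<^sup>2 \<partial>lborel) + (\<integral>x. (gc x)\<^sup>2 \<partial>lborel) = n0 / m"
      using integral_rotation[OF pqr(1) modulated_bumps.const[of 0], of "1 / m" k] zz integral_square_scale[OF m, of 1 \<eta>]
      by (simp add: defs n0_def p_def)
    have s1: "(\<integral>x. (gs1 x)\<^sup>2 \<partial>lborel) + (\<integral>x. (gc1 x)\<^sup>2 \<partial>lborel) = (m\<^sup>2 * n1 + \<kappa> * n0) / m"
      using integral_rotation[OF modulated_bumps_cmult[OF pqr(2)] modulated_bumps_cmult[OF pqr(1)], of "1 / m" m k k]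
        integral_square_scale[OF m, of m \<eta>1] integral_square_scale[OF m, of k \<eta>] zz k
      by (simp add: defs n0_def n1_def p_def q_def add_divide_distrib)
    have s2: "(\<integral>x. (gs2 x + \<kappa> * gs x)\<^sup>2 \<partial>lborel) + (\<integral>x. (gc2 x + \<kappa> * gc x)\<^sup>2 \<partial>lborel) = (m ^ 4 * n2 + 4 * m\<^sup>2 * \<kappa> * n1) / m"
      using integral_rotation[OF modulated_bumps_cmult[OF pqr(3)] modulated_bumps_cmult[OF pqr(2)], of "1 / m" "m\<^sup>2" "2 * m * k" k]
        integral_square_scale[OF m, of "m\<^sup>2" \<eta>2] integral_square_scale[OF m, of "2 * m * k" \<eta>1] zz k
      by (simp add: defs n1_def n2_def q_def r_def add_divide_distrib power_mult_distrib power_mult[symmetric])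
    have "L * (n0 / m) \<le> 4 * c1 * A * ((m\<^sup>2 * n1 + \<kappa> * n0) / m) +
      \<bar>c0\<bar> * (2 * \<kappa>\<^sup>2 * T * (n0 / m) + 2 * A * ((m ^ 4 * n2 + 4 * m\<^sup>2 * \<kappa> * n1) / m))"
      using add_mono[OF S C] unfolding s0[symmetric] s1[symmetric] s2[symmetric] by (simp add: distrib_left)
    also have "\<dots> = (4 * c1 * A * (m\<^sup>2 * n1 + \<kappa> * n0) + \<bar>c0\<bar> * (2 * \<kappa>\<^sup>2 * T * n0 + 2 * A * (m ^ 4 * n2 + 4 * m\<^sup>2 * \<kappa> * n1))) / m"
      by (simp add: divide_inverse algebra_simps)
    finally have "L * n0 / m \<le> \<dots>" by simp
    then show ?thesis using m by (simp only: divide_le_cancel)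
  qed
  \<comment> \<open>Here \<open>c1\<close>, \<open>c0\<close>, \<open>\<kappa>\<close> and
    \<open>A\<close> are fixed, so the bound passes to the limit of infinite width, where only the
    \<open>n0\<close> terms remain.\<close>
  have "L * n0 \<le> 4 * c1 * A * (0\<^sup>2 * n1 + \<kappa> * n0) + \<bar>c0\<bar> * (2 * \<kappa>\<^sup>2 * T * n0 + 2 * A * (0 ^ 4 * n2 + 4 * 0\<^sup>2 * \<kappa> * n1))"
  proof (rule tendsto_lowerbound)
    show "((\<lambda>m. 4 * c1 * A * (m\<^sup>2 * n1 + \<kappa> * n0) + \<bar>c0\<bar> * (2 * \<kappa>\<^sup>2 * T * n0 + 2 * A * (m ^ 4 * n2 + 4 * m\<^sup>2 * \<kappa> * n1)))
      \<longlongrightarrow> 4 * c1 * A * (0\<^sup>2 * n1 + \<kappa> * n0) + \<bar>c0\<bar> * (2 * \<kappa>\<^sup>2 * T * n0 + 2 * A * (0 ^ 4 * n2 + 4 * 0\<^sup>2 * \<kappa> * n1))) (at_right 0)"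
      by (intro tendsto_intros)
    show "\<forall>\<^sub>F m in at_right 0. L * n0 \<le> 4 * c1 * A * (m\<^sup>2 * n1 + \<kappa> * n0) + \<bar>c0\<bar> * (2 * \<kappa>\<^sup>2 * T * n0 + 2 * A * (m ^ 4 * n2 + 4 * m\<^sup>2 * \<kappa> * n1))"
      using main by (auto simp: eventually_at_right_field intro: exI[of _ 1])
  qed simp
  then have "n0 * L \<le> n0 * (4 * c1 * A * \<kappa> + \<bar>c0\<bar> * (2 * \<kappa>\<^sup>2 * T))" by (simp add: algebra_simps)
  then show ?thesis using pos by (simp add: L_def n0_def)
qed

text \<open>Rescaling the frequency bound by \<open>exp (- 2 (\<kappa> - K) T)\<close> sends the
  left side to 1 as \<open>\<kappa>\<close> grows, whatever the fixed values of \<open>K\<close> and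
  \<open>c0\<close>.\<close>

lemma C1_heat_ge:
  assumes T: "0 < T" and K: "0 \<le> K" and M: "0 \<le> M"
  shows "ereal (1 / 2) \<le> C1 1 (Rn 1) T (\<lambda>_ _ _ _. 1) (\<lambda>_ _ _. 0) (\<lambda>_ _. 0) K M"
  unfolding C1_def
proof (rule Inf_greatest, clarify)
  fix c1 c0
  assume bound: "\<forall>F F0 u. (\<forall>i<1. L2Q 1 (Rn 1) T (F i)) \<and> L2Q 1 (Rn 1) T F0 \<and>
       weak_sol 1 (Rn 1) T (\<lambda>_ _ _ _. 1) (\<lambda>_ _ _. 0) (\<lambda>_ _. 0) F F0 u \<longrightarrow>
       (\<forall>t\<in>{0<..T}.
          exp (-2 * K * t) * sqn 1 (Rn 1) (\<lambda>x. u x t)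
          + M * (LINT s:{0..t}|lborel. (exp (-2 * K * s) * sqn 1 (Rn 1) (\<lambda>x. u x s)))
          \<le> c1 * (LINT s:{0..t}|lborel. (exp (-2 * K * s) *
                   (LINT x:Rn 1|lebn 1. (\<Sum>i<1. \<Sum>j<1. F i x s * minv 1 (\<lambda>_ _. 1) i j * F j x s))))
            + c0 * (LINT s:{0..t}|lborel. (exp (-2 * K * s) * sqn 1 (Rn 1) (\<lambda>x. F0 x s))))"
  \<comment> \<open>The upper bound on \<open>A\<close> may be inserted only with a nonnegative
    coefficient; positivity of \<open>c1\<close> is not known in advance.\<close>
  define c where "c = max c1 0"
  have main: "0 \<le> 2 * c * (\<kappa> / (\<kappa> - K)) + 2 * \<bar>c0\<bar> * \<kappa>\<^sup>2 * T * exp (- 2 * (\<kappa> - K) * T) - (1 - exp (- \<kappa> * T))\<^sup>2"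
    if \<kappa>: "K < \<kappa>" for \<kappa>
  proof -
    define A where "A = (LINT s:{0..T}|lborel. exp (- 2 * K * s) * (exp (\<kappa> * s) - 1)\<^sup>2)"
    define d where "d = 2 * (\<kappa> - K)"
    have d: "0 < d" using \<kappa> by (simp add: d_def)
    have \<kappa>0: "0 < \<kappa>" using \<kappa> K by simp
    have sI: "set_integrable lborel {0..T} f" if "continuous_on UNIV f" for f :: "real \<Rightarrow> real"
      by (intro borel_integrable_atLeastAtMost' continuous_on_subset[OF that]) auto
    \<comment> \<open>Dropping the -1 gives a pure exponential that integrates explicitly and loses
      nothing in the limit of large \<open>\<kappa>\<close>.\<close>
    have "A \<le> (LINT s:{0..T}|lborel. exp (d * s))"
      unfolding A_def
    proof (rule set_integral_mono)
      fix s assume s: "s \<in> {0..T}"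
      have "(exp (\<kappa> * s) - 1)\<^sup>2 \<le> (exp (\<kappa> * s))\<^sup>2"
        using s \<kappa>0 by (intro power_mono) auto
      then have "exp (- 2 * K * s) * (exp (\<kappa> * s) - 1)\<^sup>2 \<le> exp (- 2 * K * s) * (exp (\<kappa> * s))\<^sup>2"
        by (rule mult_left_mono) simp
      also have "\<dots> = exp (d * s)"
        by (simp add: d_def power2_eq_square algebra_simps flip: exp_add)
      finally show "exp (- 2 * K * s) * (exp (\<kappa> * s) - 1)\<^sup>2 \<le> exp (d * s)" .
    qed (intro sI continuous_intros)+
    also have "\<dots> = exp (d * T) / d - exp (d * 0) / d"
      unfolding set_lebesgue_integral_def real_scaleR_def
      by (subst mult.commute, rule integral_FTC_Icc_real) (use T d in \<open>auto intro!: derivative_eq_intros\<close>)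
    also have "\<dots> \<le> exp (d * T) / d" using d by simp
    finally have A: "A \<le> exp (d * T) / d" .
    have A0: "0 \<le> A"
      unfolding A_def set_lebesgue_integral_def by (intro integral_nonneg_AE) auto
    have e: "exp (- (d * T)) * exp (d * T) = 1" by (simp flip: exp_add)
    have "exp (- 2 * K * T) * (exp (\<kappa> * T) - 1)\<^sup>2 \<le> 4 * c1 * A * \<kappa> + \<bar>c0\<bar> * (2 * \<kappa>\<^sup>2 * T)"
      by (rule C1_frequency_bound[OF bound T K M \<kappa>0 A_def])
    also have "4 * c1 * A * \<kappa> \<le> 4 * c * (exp (d * T) / d) * \<kappa>"
    proof -
      have "c1 * A \<le> c * (exp (d * T) / d)"
        by (rule order_trans[OF mult_right_mono[OF _ A0] mult_left_mono[OF A]]) (auto simp: c_def)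
      from mult_left_mono[OF this, of "4 * \<kappa>"] show ?thesis using \<kappa>0 by (simp add: mult_ac)
    qed
    finally have "exp (- (d * T)) * (exp (- 2 * K * T) * (exp (\<kappa> * T) - 1)\<^sup>2) \<le>
       exp (- (d * T)) * (4 * c * (exp (d * T) / d) * \<kappa> + \<bar>c0\<bar> * (2 * \<kappa>\<^sup>2 * T))"
      by (intro mult_left_mono) auto
    also have "\<dots> = (exp (- (d * T)) * exp (d * T)) * (4 * c * \<kappa> / d) + 2 * \<bar>c0\<bar> * \<kappa>\<^sup>2 * T * exp (- (d * T))"
      by (simp add: algebra_simps)
    also have "\<dots> = 2 * c * (\<kappa> / (\<kappa> - K)) + 2 * \<bar>c0\<bar> * \<kappa>\<^sup>2 * T * exp (- 2 * (\<kappa> - K) * T)"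
      unfolding e using \<kappa> by (simp add: d_def field_simps)
    also have "exp (- (d * T)) * (exp (- 2 * K * T) * (exp (\<kappa> * T) - 1)\<^sup>2) = (1 - exp (- \<kappa> * T))\<^sup>2"
    proof -
      have "exp (- (d * T)) * exp (- 2 * K * T) = (exp (- \<kappa> * T))\<^sup>2"
        by (simp add: d_def power2_eq_square algebra_simps flip: exp_add)
      moreover have "exp (- \<kappa> * T) * (exp (\<kappa> * T) - 1) = 1 - exp (- \<kappa> * T)"
        by (simp add: right_diff_distrib flip: exp_add)
      ultimately show ?thesis by (simp add: power_mult_distrib[symmetric] mult.assoc[symmetric])
    qed
    finally show ?thesis by simp
  qed
  \<comment> \<open>The quotient tends to 1, while the \<open>c0\<close> term is
    \<open>\<kappa>^2\<close> times an exponential that decays because \<open>T\<close> is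
    positive.\<close>
  have "0 \<le> 2 * c - 1"
  proof (rule tendsto_lowerbound)
    show "((\<lambda>\<kappa>. 2 * c * (\<kappa> / (\<kappa> - K)) + 2 * \<bar>c0\<bar> * \<kappa>\<^sup>2 * T * exp (- 2 * (\<kappa> - K) * T) - (1 - exp (- \<kappa> * T))\<^sup>2) \<longlongrightarrow> 2 * c - 1) at_top"
      using T by real_asymp
    show "\<forall>\<^sub>F \<kappa> in at_top. 0 \<le> 2 * c * (\<kappa> / (\<kappa> - K)) + 2 * \<bar>c0\<bar> * \<kappa>\<^sup>2 * T * exp (- 2 * (\<kappa> - K) * T) - (1 - exp (- \<kappa> * T))\<^sup>2"
      using eventually_gt_at_top[of K] by eventually_elim (rule main)
  qed simp
  \<comment> \<open>Since \<open>c\<close> is at least 1/2, the maximum with 0 must be attained by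
    \<open>c1\<close>.\<close>
  then show "ereal (1 / 2) \<le> ereal c1" by (auto simp: c_def max_def split: if_splits)
qed

section \<open>The heat equation as an admissible example\<close>

lemma coeff_ok_heat: "coeff_ok 1 (Rn 1) T (\<lambda>_ _ _ _. 1) (\<lambda>_ _ _. 0) (\<lambda>_ _. 0)"
proof -
  have "Rn 1 \<times> {0<..<T} \<in> sets (lebn 1 \<Otimes>\<^sub>M lborel)"
    unfolding space_lebn[symmetric] by simp
  then have [measurable]: "(indicator (Rn 1 \<times> {0<..<T}) :: _ \<Rightarrow> real) \<in> borel_measurable (lebn 1 \<Otimes>\<^sub>M lborel)"
    by simp
  have p: "(\<Sum>i<1. \<Sum>j<1. \<xi> i * 1 * \<xi> j) \<ge> 1 * (\<Sum>i<1. (\<xi> i)\<^sup>2)" for \<xi> :: "nat \<Rightarrow> real"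
    by (simp add: lessThan_1_nat power2_eq_square)
  have i: "i < 1 \<Longrightarrow> i = 0" for i :: nat by simp
  show ?thesis
    unfolding coeff_ok_def Let_def
  proof (intro conjI)
    show "\<exists>\<delta>>0. AE z in lebn 1 \<Otimes>\<^sub>M lborel. z \<in> Rn 1 \<times> {0<..<T} \<longrightarrow>
       (\<forall>\<xi>::nat \<Rightarrow> real. (\<Sum>i<1. \<Sum>j<1. \<xi> i * 1 * \<xi> j) \<ge> \<delta> * (\<Sum>i<1. (\<xi> i)\<^sup>2))"
      using p by (intro exI[of _ 1]) auto
    show "\<exists>C. AE z in lebn 1 \<Otimes>\<^sub>M lborel. z \<in> Rn 1 \<times> {0<..<T} \<longrightarrow>
         (\<forall>i<1. \<forall>j<1. \<bar>1\<bar> \<le> C \<and> \<bar>minv 1 (\<lambda>_ _. 1) i j\<bar> \<le> C) \<and>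
         (\<forall>i<1. \<bar>0\<bar> \<le> C) \<and> \<bar>0\<bar> \<le> C"
      by (intro exI[of _ 1]) (auto simp: minv_1 dest!: i)
  qed auto
qed

theorem theorem7p1:
  shows "\<exists>(n::nat) (D::(nat \<Rightarrow> real) set)
            (b::(nat \<Rightarrow> real) \<Rightarrow> real \<Rightarrow> nat \<Rightarrow> nat \<Rightarrow> real)
            (f::(nat \<Rightarrow> real) \<Rightarrow> real \<Rightarrow> nat \<Rightarrow> real)
            (lam::(nat \<Rightarrow> real) \<Rightarrow> real \<Rightarrow> real).
           dom_ok n D \<and>
           (\<forall>T>0. coeff_ok n D T b f lam \<and>
              (\<forall>M\<ge>0. (INF K\<in>{0::real..}. C1 n D T b f lam K M) = ereal (1/2)))"
proof (intro exI conjI allI impI)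
  show "dom_ok 1 (Rn 1)" by (simp add: dom_ok_def)
  fix T :: real assume T: "0 < T"
  show "coeff_ok 1 (Rn 1) T (\<lambda>_ _ _ _. 1) (\<lambda>_ _ _. 0) (\<lambda>_ _. 0)" by (rule coeff_ok_heat)
  fix M :: real assume M: "0 \<le> M"
  show "(INF K\<in>{0..}. C1 1 (Rn 1) T (\<lambda>_ _ _ _. 1) (\<lambda>_ _ _. 0) (\<lambda>_ _. 0) K M) = ereal (1 / 2)"
  proof (rule antisym)
    show "(INF K\<in>{0..}. C1 1 (Rn 1) T (\<lambda>_ _ _ _. 1) (\<lambda>_ _ _. 0) (\<lambda>_ _. 0) K M) \<le> ereal (1 / 2)"
      \<comment> \<open>The value \<open>(M + 1) / 2\<close> is admissible because
        \<open>M \<ge> 0\<close> makes it nonnegative.\<close>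
      using M by (intro INF_lower2[of "(M + 1) / 2"] C1_heat_le[OF T M]) simp
    show "ereal (1 / 2) \<le> (INF K\<in>{0..}. C1 1 (Rn 1) T (\<lambda>_ _ _ _. 1) (\<lambda>_ _ _. 0) (\<lambda>_ _. 0) K M)"
      by (intro INF_greatest C1_heat_ge[OF T _ M]) simp
  qed
qed

end
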